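(* Let $\mathbb{H}$ be a separable Hilbert space over $\mathbb{C}$. Then $$\mathcal{B}_{Leb}(\mathbb{H})\cap\mathcal{B}_{Nor}(\mathbb{H})\neq\emptyset\quad\text{and}\quad \mathcal{B}_{Leb}(\mathbb{H})\cap(\mathcal{B}(\mathbb{H})\setminus\mathcal{B}_{Nor}(\mathbb{H}))\neq\emptyset,$$ where $\mathcal{B}_{Leb}(\mathbb{H})$ is the set of all Lebesgue operators on $\mathbb{H}$ and $\mathcal{B}_{Nor}(\mathbb{H})$ is the set of all normal operators on $\mathbb{H}$.
   Context: $\mathcal{B}(\mathbb{H})$ is the set of all bounded linear operators on $\mathbb{H}$. For $A\in\mathcal{B}(\mathbb{H})$, $|A|=(A^*A)^{1/2}$, $\sigma(A)$ is the spectrum, and $\mathcal{A}(|A|)$ is the $C^*$-algebra generated by $|A|$ and $1$. A vector $\xi_n$ is $\mathcal{A}(|T^n|)$-cyclic if $\overline{\mathcal{A}(|T^n|)\xi_n}=\mathbb{H}$. For such a vector, $\mu_{|T^n|}$ is the unique finite positive (completed) Borel measure on $\sigma(|T^n|)$ with $\int f\,d\mu_{|T^n|}=\langle f(|T^n|)\xi_n,\xi_n\rangle$ for all $f\in\mathcal{C}(\sigma(|T^n|))$ (also viewed as a measure on $\mathbb{R}_+$), and for $g\in\mathcal{L}^2(\sigma(|T^n|),\mu_{|T^n|})$, $g(|T^n|)\xi_n$ denotes the image of $g$ under the unitary $\mathcal{L}^2(\sigma(|T^n|),\mu_{|T^n|})\to\mathbb{H}$ extending $f\mapsto f(|T^n|)\xi_n$,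 $f$ continuous; $g(|T^n|^{-1})\xi_n$ is the vector corresponding to $t\mapsto g(t^{-1})$. Lebesgue operator: an invertible bounded linear operator $T$ on $\mathbb{H}$ is a Lebesgue operator if: (1) there is $N>0$ such that for all $n\ge N$, $n\in\mathbb{N}$, $d\mu_{|T^n|}=f_n(x)\,dx$ with $f_n\in\mathcal{L}^1(\mathbb{R}_+)$ ($dx$ Lebesgue measure), and $x^2f_n(x)=f_n(x^{-1})$ for $0<x\le 1$; (2) there is $N>0$ such that for all $n\ge N$, $n\in\mathbb{N}$, there is an $\mathcal{A}(|T^n|)$-cyclic vector $\xi_n$, and for any given $0\ne x\in\mathbb{H}$ and any given $0\ne g_n(t)\in\mathcal{L}^2(\sigma(|T^n|),\mu_{|T^n|})$ there is a unique $0\ne y\in\mathbb{H}$ such that $y=g_n(|T^n|^{-1})\xi_n$ whenever $x=g_n(|T^n|)\xi_n$.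
   Formalization: The Hilbert space is additionally assumed infinite-dimensional; in finite dimension at least 1 the spectral measure is atomic, so no Lebesgue operator exists, and on the zero space every operator is normal, so the claim fails there. *)

theory Defs
  imports "HOL-Analysis.Analysis" "HOL-Computational_Algebra.Polynomial"
begin

(* The inner product is linear in its first argument. *)
class complex_hilbert = banach +
  fixes scaleC :: "complex \<Rightarrow> 'a \<Rightarrow> 'a"  (infixr "*\<^sub>C" 75)
    and cinner :: "'a \<Rightarrow> 'a \<Rightarrow> complex"
  assumes scaleR_scaleC: "r *\<^sub>R x = complex_of_real r *\<^sub>C x"
    and scaleC_add_right: "c *\<^sub>C (x + y) = c *\<^sub>C x + c *\<^sub>C y"
    and scaleC_add_left: "(c + d) *\<^sub>C x = c *\<^sub>C x + d *\<^sub>C x"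
    and scaleC_scaleC: "c *\<^sub>C (d *\<^sub>C x) = (c * d) *\<^sub>C x"
    and scaleC_one: "1 *\<^sub>C x = x"
    and cinner_commute: "cinner x y = cnj (cinner y x)"
    and cinner_add_left: "cinner (x + y) z = cinner x z + cinner y z"
    and cinner_scaleC_left: "cinner (c *\<^sub>C x) y = c * cinner x y"
    and cinner_norm: "cinner x x = complex_of_real ((norm x)\<^sup>2)"

lemma vector_space_scaleC:
  "vector_space (scaleC :: complex \<Rightarrow> 'a \<Rightarrow> 'a::complex_hilbert)"
  by unfold_locales
    (simp_all add: scaleC_add_right scaleC_add_left scaleC_scaleC scaleC_one)

definition bounded_operators :: "('a::complex_hilbert \<Rightarrow> 'a) set" where
  "bounded_operators = {A. bounded_linear A \<and> (\<forall>c x. A (c *\<^sub>C x) = c *\<^sub>C A x)}"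

definition invertible_operator :: "('a::complex_hilbert \<Rightarrow> 'a) \<Rightarrow> bool" where
  "invertible_operator A \<longleftrightarrow>
     A \<in> bounded_operators \<and> (\<exists>B\<in>bounded_operators. A \<circ> B = id \<and> B \<circ> A = id)"

definition adjoint_operator :: "('a::complex_hilbert \<Rightarrow> 'a) \<Rightarrow> 'a \<Rightarrow> 'a" where
  "adjoint_operator A = (THE B. \<forall>x y. cinner (A x) y = cinner x (B y))"

definition positive_operator :: "('a::complex_hilbert \<Rightarrow> 'a) \<Rightarrow> bool" where
  "positive_operator A \<longleftrightarrow>
     A \<in> bounded_operators \<and> (\<forall>x. Im (cinner (A x) x) = 0 \<and> 0 \<le> Re (cinner (A x) x))"

definition abs_operator :: "('a::complex_hilbert \<Rightarrow> 'a) \<Rightarrow> 'a \<Rightarrow> 'a" where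
  "abs_operator A = (THE B. positive_operator B \<and> B \<circ> B = adjoint_operator A \<circ> A)"

definition spectrum :: "('a::complex_hilbert \<Rightarrow> 'a) \<Rightarrow> complex set" where
  "spectrum A = {z. \<not> invertible_operator (\<lambda>x. A x - z *\<^sub>C x)}"

(* For self-adjoint A (in particular for A = |T^n|) this is the whole spectrum, viewed as a
   set of real numbers. *)
definition real_spectrum :: "('a::complex_hilbert \<Rightarrow> 'a) \<Rightarrow> real set" where
  "real_spectrum A = {t. complex_of_real t \<in> spectrum A}"

(* The last closure condition is closedness in the operator norm. *)
definition cstar_algebra :: "('a::complex_hilbert \<Rightarrow> 'a) set \<Rightarrow> bool" where
  "cstar_algebra S \<longleftrightarrow>
     S \<subseteq> bounded_operators \<and>
     (\<lambda>x. 0) \<in> S \<and>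
     (\<forall>A\<in>S. \<forall>B\<in>S. (\<lambda>x. A x + B x) \<in> S) \<and>
     (\<forall>c. \<forall>A\<in>S. (\<lambda>x. c *\<^sub>C A x) \<in> S) \<and>
     (\<forall>A\<in>S. \<forall>B\<in>S. A \<circ> B \<in> S) \<and>
     (\<forall>A\<in>S. adjoint_operator A \<in> S) \<and>
     (\<forall>F. \<forall>A\<in>bounded_operators.
        (\<forall>k. F k \<in> S) \<and> (\<lambda>k. onorm (\<lambda>x. F k x - A x)) \<longlonglongrightarrow> 0 \<longrightarrow> A \<in> S)"

definition generated_cstar_algebra ::
    "('a::complex_hilbert \<Rightarrow> 'a) \<Rightarrow> ('a \<Rightarrow> 'a) set" where
  "generated_cstar_algebra A = \<Inter>{S. cstar_algebra S \<and> A \<in> S \<and> id \<in> S}"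

definition cyclic_vector :: "('a::complex_hilbert \<Rightarrow> 'a) \<Rightarrow> 'a \<Rightarrow> bool" where
  "cyclic_vector A \<xi> \<longleftrightarrow> closure ((\<lambda>B. B \<xi>) ` generated_cstar_algebra A) = UNIV"

definition poly_operator ::
    "complex poly \<Rightarrow> ('a::complex_hilbert \<Rightarrow> 'a) \<Rightarrow> 'a \<Rightarrow> 'a" where
  "poly_operator p A = (\<lambda>x. \<Sum>i\<le>degree p. coeff p i *\<^sub>C (A ^^ i) x)"

(* Continuous functional calculus of a self-adjoint operator: f(A) is the operator-norm limit
   of p_k(A) for polynomials p_k converging to f uniformly on the spectrum.  Only the values
   of f on the spectrum of A matter. *)
definition functional_calculus ::
    "('a::complex_hilbert \<Rightarrow> 'a) \<Rightarrow> (real \<Rightarrow> complex) \<Rightarrow> 'a \<Rightarrow> 'a" where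
  "functional_calculus A f = (THE B. B \<in> bounded_operators \<and>
     (\<forall>p. uniform_limit (real_spectrum A) (\<lambda>k t. poly (p k) (complex_of_real t)) f sequentially
        \<longrightarrow> (\<lambda>k. onorm (\<lambda>x. poly_operator (p k) A x - B x)) \<longlonglongrightarrow> 0))"

(* The measure on the spectrum is viewed as a completed Borel measure on the real line that
   vanishes off the spectrum. *)
definition spectral_measure :: "('a::complex_hilbert \<Rightarrow> 'a) \<Rightarrow> 'a \<Rightarrow> real measure" where
  "spectral_measure A \<xi> = completion (THE \<mu>.
     sets \<mu> = sets borel \<and> finite_measure \<mu> \<and> emeasure \<mu> (- real_spectrum A) = 0 \<and>
     (\<forall>f. continuous_on (real_spectrum A) f \<longrightarrow>
        (LINT t:real_spectrum A|\<mu>. f t) = cinner (functional_calculus A f \<xi>) \<xi>))"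

(* Representatives of the elements of the Hilbert space L^2; equality there is equality
   almost everywhere. *)
definition L2_functions :: "real measure \<Rightarrow> (real \<Rightarrow> complex) set" where
  "L2_functions M =
     {g. g \<in> borel_measurable M \<and> integrable M (\<lambda>t. (cmod (g t))\<^sup>2)}"

definition cyclic_unitary ::
    "('a::complex_hilbert \<Rightarrow> 'a) \<Rightarrow> 'a \<Rightarrow> ((real \<Rightarrow> complex) \<Rightarrow> 'a) \<Rightarrow> bool" where
  "cyclic_unitary A \<xi> U \<longleftrightarrow> (let M = spectral_measure A \<xi> in
     (\<forall>g\<in>L2_functions M. \<forall>h\<in>L2_functions M. U (\<lambda>t. g t + h t) = U g + U h) \<and>
     (\<forall>c. \<forall>g\<in>L2_functions M. U (\<lambda>t. c * g t) = c *\<^sub>C U g) \<and>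
     (\<forall>g\<in>L2_functions M. \<forall>h\<in>L2_functions M.
        cinner (U g) (U h) = (LINT t|M. g t * cnj (h t))) \<and>
     U ` L2_functions M = UNIV \<and>
     (\<forall>f. continuous_on (real_spectrum A) f \<longrightarrow> U f = functional_calculus A f \<xi>))"

(* The vector g(A)\<xi>.  On L^2 the unitary is uniquely determined when \<xi> is cyclic, so the
   choice is immaterial there. *)
definition L2_calculus_vector ::
    "('a::complex_hilbert \<Rightarrow> 'a) \<Rightarrow> 'a \<Rightarrow> (real \<Rightarrow> complex) \<Rightarrow> 'a" where
  "L2_calculus_vector A \<xi> g = (SOME U. cyclic_unitary A \<xi> U) g"

definition lebesgue_density_condition :: "('a::complex_hilbert \<Rightarrow> 'a) \<Rightarrow> 'a \<Rightarrow> bool" where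
  "lebesgue_density_condition A \<xi> \<longleftrightarrow> (\<exists>f::real \<Rightarrow> real.
     set_integrable lborel {0..} f \<and> (\<forall>x\<ge>0. 0 \<le> f x) \<and>
     spectral_measure A \<xi> =
       completion (density lborel (\<lambda>x. ennreal (indicator {0..} x * f x))) \<and>
     (\<forall>x. 0 < x \<and> x \<le> 1 \<longrightarrow> x\<^sup>2 * f x = f (inverse x)))"

(* The requirement on y is imposed for those pairs x, g that satisfy x = g(A)\<xi>; for other
   pairs there is no condition on y. *)
definition lebesgue_inversion_condition :: "('a::complex_hilbert \<Rightarrow> 'a) \<Rightarrow> 'a \<Rightarrow> bool" where
  "lebesgue_inversion_condition A \<xi> \<longleftrightarrow> (let M = spectral_measure A \<xi> in
     \<forall>x. \<forall>g\<in>L2_functions M.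
       x \<noteq> 0 \<and> \<not> (AE t in M. g t = 0) \<and> x = L2_calculus_vector A \<xi> g \<longrightarrow>
       (\<exists>!y. y \<noteq> 0 \<and> (\<lambda>t. g (inverse t)) \<in> L2_functions M \<and>
             y = L2_calculus_vector A \<xi> (\<lambda>t. g (inverse t))))"

(* The measure in the first condition depends on the cyclic vector, so both conditions refer
   to one sequence of cyclic vectors. *)
definition lebesgue_operators :: "('a::complex_hilbert \<Rightarrow> 'a) set" where
  "lebesgue_operators = {T. invertible_operator T \<and>
     (\<exists>\<xi>::nat \<Rightarrow> 'a.
        (\<exists>N>0. \<forall>n\<ge>N. cyclic_vector (abs_operator (T ^^ n)) (\<xi> n) \<and>
                     lebesgue_density_condition (abs_operator (T ^^ n)) (\<xi> n)) \<and>
        (\<exists>N>0. \<forall>n\<ge>N. cyclic_vector (abs_operator (T ^^ n)) (\<xi> n) \<and>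
                     lebesgue_inversion_condition (abs_operator (T ^^ n)) (\<xi> n)))}"

definition normal_operators :: "('a::complex_hilbert \<Rightarrow> 'a) set" where
  "normal_operators =
     {T \<in> bounded_operators. T \<circ> adjoint_operator T = adjoint_operator T \<circ> T}"

end

(* On L^2(R, dx) let T_s be the weighted translation (T_s g)(t) = exp(arctan t) g(s + t).  Then
   |T_s^n| is multiplication by exp(a_n), where a_n(t) is the sum of arctan(t + (k - n) s) over
   k < n.  Since a_n is an increasing diffeomorphism of R onto (-c, c) with c = n pi / 2, the vector
   sqrt(a_n') is cyclic for |T_s^n| and its spectral measure is the image of a_n'(t) dt under
   exp(a_n), that is dx / x on (exp(-c), exp c), which is invariant under x -> 1/x.  Hence T_s is a
   Lebesgue operator for every s.  It is normal for s = 0 but not for s = 1.  A separable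
   infinite-dimensional Hilbert space is unitarily equivalent to L^2(R, dx). *)
theory Submission
  imports Defs
begin

section \<open>Orthogonality and orthonormal bases\<close>

text \<open>The density condition is inversion invariance in disguise: the image of f(x) dx under x
  -> 1/x has density f(1/x) / x^2. In logarithmic coordinates inversion is reflection, so what is
  wanted is an injective real function a with symmetric range. The arctangent is bounded, which
  makes the weight and its inverse bounded, and it is increasing with symmetric range. Sums of
  translates keep these properties, so all powers are treated alike. The translation moves the
  weight of |T_s| but not that of the absolute value of the adjoint, and this destroys normality.
  Infinite dimension is essential: in finite nonzero dimension spectral measures are sums of point
  masses and have no density. Adjoint, absolute value, functional calculus and spectral measure are
  definite descriptions, so each has to be identified by a uniqueness argument. Two models of the
  same space are used for this: L^2(R, dx), where powers and adjoints are explicit, and L^2 of the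
  spectral measure, where |T_s^n| is multiplication by the independent variable.\<close>

interpretation scaleC: vector_space "scaleC :: complex \<Rightarrow> 'a \<Rightarrow> 'a::complex_hilbert"
  by (rule vector_space_scaleC)

section \<open>Inner product identities and the Cauchy-Schwarz inequality\<close>

lemma cinner_scaleC_right: "cinner x (c *\<^sub>C y) = cnj c * cinner x y"
  using cinner_commute[of x "c *\<^sub>C y"] cinner_commute[of x y] by (simp add: cinner_scaleC_left)

lemma cinner_add_right: "cinner x (y + z) = cinner x y + cinner x z"
  using cinner_commute[of x "y + z"] cinner_commute[of x y] cinner_commute[of x z]
  by (simp add: cinner_add_left)

lemma cinner_zero_left [simp]: "cinner 0 x = 0"
  using cinner_scaleC_left[of 0 0 x] by simp

lemma cinner_zero_right [simp]: "cinner x 0 = 0"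
  using cinner_commute[of x 0] by simp

lemma cinner_minus_left: "cinner (- x) y = - cinner x y"
  using cinner_add_left[of x "- x" y] by (simp add: add_eq_0_iff)

lemma cinner_minus_right: "cinner x (- y) = - cinner x y"
  using cinner_add_right[of x y "- y"] by (simp add: add_eq_0_iff)

lemma cinner_diff_left: "cinner (x - y) z = cinner x z - cinner y z"
  using cinner_add_left[of x "- y" z] by (simp add: cinner_minus_left)

lemma cinner_diff_right: "cinner x (y - z) = cinner x y - cinner x z"
  using cinner_add_right[of x y "- z"] by (simp add: cinner_minus_right)

lemma cinner_sum_left: "cinner (\<Sum>i\<in>I. f i) y = (\<Sum>i\<in>I. cinner (f i) y)"
  by (induction I rule: infinite_finite_induct) (auto simp: cinner_add_left)

lemma cinner_sum_right: "cinner x (\<Sum>i\<in>I. f i) = (\<Sum>i\<in>I. cinner x (f i))"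
  by (induction I rule: infinite_finite_induct) (auto simp: cinner_add_right)

lemma cinner_eq_zero_iff: "cinner x x = 0 \<longleftrightarrow> x = 0"
  by (simp add: cinner_norm)

lemma norm_sq_cinner: "(norm x)\<^sup>2 = Re (cinner x x)"
  by (simp add: cinner_norm)

text \<open>The class axioms tie \<open>norm\<close> to complex scalars only through the inner
  product, so the identity is proved for squares.\<close>

lemma norm_scaleC: "norm (c *\<^sub>C x) = cmod c * norm x"
proof -
  have "complex_of_real ((norm (c *\<^sub>C x))\<^sup>2) = complex_of_real ((cmod c * norm x)\<^sup>2)"
    unfolding cinner_norm[symmetric] cinner_scaleC_left cinner_scaleC_right
    by (simp add: cinner_norm power_mult_distrib complex_norm_square del: of_real_power)
  then have "(norm (c *\<^sub>C x))\<^sup>2 = (cmod c * norm x)\<^sup>2"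
    by (simp only: of_real_eq_iff)
  then show ?thesis by simp
qed

lemma norm_diff_sq:
  "(norm (x - y))\<^sup>2 = (norm x)\<^sup>2 - 2 * Re (cinner x y) + (norm y)\<^sup>2"
proof -
  have "Re (cinner y x) = Re (cinner x y)"
    using cinner_commute[of y x] by simp
  then show ?thesis
    unfolding norm_sq_cinner by (simp add: cinner_diff_left cinner_diff_right)
qed

lemma norm_add_sq:
  "(norm (x + y))\<^sup>2 = (norm x)\<^sup>2 + 2 * Re (cinner x y) + (norm y)\<^sup>2"
  using norm_diff_sq[of x "- y"] by (simp add: cinner_minus_right)

text \<open>The coefficient is the one whose multiple of y is closest to x. Nonnegativity of the
  left side gives Cauchy-Schwarz; the drop in norm drives the minimality argument for closed
  subspaces.\<close>

lemma norm_diff_projection_sq: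
  assumes "y \<noteq> 0"
  shows "(norm (x - (cinner x y / complex_of_real ((norm y)\<^sup>2)) *\<^sub>C y))\<^sup>2
    = (norm x)\<^sup>2 - (cmod (cinner x y))\<^sup>2 / (norm y)\<^sup>2"
proof -
  define c where "c = cinner x y / complex_of_real ((norm y)\<^sup>2)"
  have "cinner x (c *\<^sub>C y) = cinner x y * cnj (cinner x y) / complex_of_real ((norm y)\<^sup>2)"
    unfolding c_def cinner_scaleC_right by (simp add: mult.commute)
  also have "\<dots> = complex_of_real ((cmod (cinner x y))\<^sup>2 / (norm y)\<^sup>2)"
    by (simp only: complex_norm_square[symmetric] of_real_divide of_real_power)
  finally have "Re (cinner x (c *\<^sub>C y)) = (cmod (cinner x y))\<^sup>2 / (norm y)\<^sup>2"
    by (simp only: Re_complex_of_real)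
  moreover have "(norm (c *\<^sub>C y))\<^sup>2 = (cmod (cinner x y))\<^sup>2 / (norm y)\<^sup>2"
    using assms unfolding norm_scaleC c_def norm_divide norm_of_real
    by (simp add: power2_eq_square)
  ultimately show ?thesis
    unfolding norm_diff_sq c_def[symmetric] by linarith
qed

lemma cinner_Cauchy_Schwarz: "cmod (cinner x y) \<le> norm x * norm y"
proof (cases "y = 0")
  case False
  then have "(cmod (cinner x y))\<^sup>2 / (norm y)\<^sup>2 \<le> (norm x)\<^sup>2"
    using norm_diff_projection_sq[OF False, of x] by (metis diff_ge_0_iff_ge zero_le_power2)
  then have "(cmod (cinner x y))\<^sup>2 \<le> (norm x * norm y)\<^sup>2"
    using False by (simp add: field_simps power_mult_distrib)
  then show ?thesis by (rule power2_le_imp_le) simp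
qed simp

lemma bounded_linear_cinner_left: "bounded_linear (\<lambda>x. cinner x y)"
  by (rule bounded_linear_intro[where K = "norm y"])
    (auto simp: cinner_add_left scaleR_scaleC cinner_scaleC_left cinner_Cauchy_Schwarz scaleR_conv_of_real)

lemma bounded_linear_cinner_right: "bounded_linear (\<lambda>y. cinner x y)"
  by (rule bounded_linear_intro[where K = "norm x"])
    (auto simp: cinner_add_right scaleR_scaleC cinner_scaleC_right scaleR_conv_of_real mult.commute
      intro: order_trans[OF cinner_Cauchy_Schwarz])

lemma bounded_linear_scaleC_right: "bounded_linear (\<lambda>x. c *\<^sub>C x)"
  by (rule bounded_linear_intro[where K = "cmod c"])
    (auto simp: scaleC_add_right scaleR_scaleC scaleC_scaleC norm_scaleC mult.commute)

lemma eq_if_cinner_eq: "(\<And>z. cinner x z = cinner y z) \<Longrightarrow> x = y"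
  using cinner_eq_zero_iff[of "x - y"] by (simp add: cinner_diff_left)

text \<open>Projection theorem: each x has a nearest point z in C, the residual x - z is orthogonal
  to C, and so it is zero.\<close>

lemma closed_subspace_eq_UNIV:
  fixes C :: "'a::complex_hilbert set"
  assumes "closed C" "0 \<in> C"
    and add: "\<And>x y. x \<in> C \<Longrightarrow> y \<in> C \<Longrightarrow> x + y \<in> C"
    and scale: "\<And>c x. x \<in> C \<Longrightarrow> c *\<^sub>C x \<in> C"
    and orth: "\<And>x. (\<And>y. y \<in> C \<Longrightarrow> cinner x y = 0) \<Longrightarrow> x = 0"
  shows "C = UNIV"
proof -
  have "x \<in> C" for x
  proof -
    define d where "d = infdist x C"
    have ne: "C \<noteq> {}" using \<open>0 \<in> C\<close> by auto
    have d_le: "d \<le> norm (x - y)" if "y \<in> C" for y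
      using infdist_le[OF that, of x] by (simp add: d_def dist_norm)
    have d0: "0 \<le> d" by (simp add: d_def infdist_nonneg)
    have "\<exists>y\<in>C. norm (x - y) < d + e" if "0 < e" for e
    proof (rule ccontr)
      assume "\<not> ?thesis"
      then have "d + e \<le> infdist x C"
        unfolding infdist_notempty[OF ne]
        by (intro cINF_greatest ne) (auto simp: dist_norm not_less)
      with that show False by (simp add: d_def)
    qed
    then have "\<exists>y. y \<in> C \<and> norm (x - y) < d + inverse (real (Suc n))" for n
      unfolding Bex_def by simp
    then have "\<forall>n. \<exists>y. y \<in> C \<and> norm (x - y) < d + inverse (real (Suc n))" ..
    from choice[OF this] obtain y where yC: "\<And>n. y n \<in> C"
      and yn: "\<And>n. norm (x - y n) < d + inverse (real (Suc n))" by blast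
    have lim: "(\<lambda>n. (norm (x - y n))\<^sup>2) \<longlonglongrightarrow> d\<^sup>2"
    proof (rule tendsto_power, rule tendsto_sandwich[of "\<lambda>_. d" _ _ "\<lambda>n. d + inverse (real (Suc n))"])
      show "(\<lambda>n. d + inverse (real (Suc n))) \<longlonglongrightarrow> d"
        using tendsto_add[OF tendsto_const LIMSEQ_inverse_real_of_nat, of d] by simp
      show "\<forall>\<^sub>F n in sequentially. d \<le> norm (x - y n)"
        using d_le[OF yC] by (intro always_eventually) simp
      show "\<forall>\<^sub>F n in sequentially. norm (x - y n) \<le> d + inverse (real (Suc n))"
        using yn by (intro always_eventually allI less_imp_le)
    qed simp
    \<comment> \<open>The midpoint of two members of C lies in C, so its distance to x is at least
      d. The parallelogram law for the two residuals then bounds the distance of the members, which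
      makes the minimising sequence Cauchy.\<close>
    have par: "(norm (y m - y n))\<^sup>2 \<le> 2 * (norm (x - y m))\<^sup>2 + 2 * (norm (x - y n))\<^sup>2 - 4 * d\<^sup>2" for m n
    proof -
      let ?u = "x - y m" and ?v = "x - y n"
      have "(1/2::complex) *\<^sub>C (y m + y n) \<in> C" by (intro scale add yC)
      then have "d \<le> norm (x - (1/2::complex) *\<^sub>C (y m + y n))" by (rule d_le)
      moreover have "x - (1/2::complex) *\<^sub>C (y m + y n) = (1/2::complex) *\<^sub>C (?u + ?v)"
        using scaleC_add_left[of "1/2" "1/2" x]
        by (simp add: scaleC.scale_right_diff_distrib scaleC_add_right)
      ultimately have "2 * d \<le> norm (?u + ?v)" by (simp add: norm_scaleC)
      then have "4 * d\<^sup>2 \<le> (norm (?u + ?v))\<^sup>2"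
        using d0 power_mono[of "2 * d" "norm (?u + ?v)" 2] by (simp add: power_mult_distrib)
      moreover have "(norm (y m - y n))\<^sup>2 = (norm (?u - ?v))\<^sup>2"
        by (simp add: norm_minus_commute)
      ultimately show ?thesis
        using norm_diff_sq[of ?u ?v] norm_add_sq[of ?u ?v] by linarith
    qed
    have "Cauchy y"
    proof (rule metric_CauchyI)
      fix e :: real assume "0 < e"
      then have "0 < e\<^sup>2 / 4" by simp
      from order_tendstoD(2)[OF lim, of "d\<^sup>2 + e\<^sup>2 / 4"] this
      obtain N where N: "\<And>n. n \<ge> N \<Longrightarrow> (norm (x - y n))\<^sup>2 < d\<^sup>2 + e\<^sup>2 / 4"
        by (auto simp: eventually_sequentially)
      have "dist (y m) (y n) < e" if "m \<ge> N" "n \<ge> N" for m n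
      proof -
        have "(norm (y m - y n))\<^sup>2 < e\<^sup>2"
          using par[of m n] N[OF that(1)] N[OF that(2)] by linarith
        then show ?thesis
          using \<open>0 < e\<close> by (simp add: dist_norm power2_less_imp_less)
      qed
      then show "\<exists>M. \<forall>m\<ge>M. \<forall>n\<ge>M. dist (y m) (y n) < e" by blast
    qed
    then obtain z where z: "y \<longlonglongrightarrow> z"
      by (auto simp: Cauchy_convergent_iff convergent_def)
    have zC: "z \<in> C" using closed_sequentially[OF \<open>closed C\<close> yC z] .
    have "(\<lambda>n. (norm (x - y n))\<^sup>2) \<longlonglongrightarrow> (norm (x - z))\<^sup>2"
      by (intro tendsto_intros z)
    then have dz: "(norm (x - z))\<^sup>2 = d\<^sup>2" using lim LIMSEQ_unique by blast
    \<comment> \<open>Moving z along w by the projection coefficient stays in C and cannot come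
      closer to x than d, so the drop given by \<open>norm_diff_projection_sq\<close> must
      vanish.\<close>
    have "cinner (x - z) w = 0" if "w \<in> C" for w
    proof (cases "w = 0")
      case False
      define c where "c = cinner (x - z) w / complex_of_real ((norm w)\<^sup>2)"
      have "z + c *\<^sub>C w \<in> C" by (intro add scale zC that)
      then have "d \<le> norm ((x - z) - c *\<^sub>C w)" using d_le by (simp add: diff_diff_eq)
      then have "d\<^sup>2 \<le> (norm ((x - z) - c *\<^sub>C w))\<^sup>2" using d0 by (simp add: power_mono)
      then have "(cmod (cinner (x - z) w))\<^sup>2 / (norm w)\<^sup>2 \<le> 0"
        using norm_diff_projection_sq[OF False, of "x - z"] dz unfolding c_def[symmetric] by linarith
      then show ?thesis
        using False by (simp add: divide_le_0_iff)
    qed simp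
    then have "x - z = 0" by (rule orth)
    then show ?thesis using zC by simp
  qed
  then show ?thesis by auto
qed

section \<open>Orthonormal sets: extension, Bessel's inequality, countability\<close>

definition orthonormal :: "'a::complex_hilbert set \<Rightarrow> bool" where
  "orthonormal E \<longleftrightarrow> (\<forall>x\<in>E. \<forall>y\<in>E. cinner x y = (if x = y then 1 else 0))"

text \<open>Totality is phrased as a trivial orthogonal complement, so that no closure of a span has
  to be formed; dense sets and maximal orthonormal sets satisfy it directly.\<close>

definition total_family :: "'a::complex_hilbert set \<Rightarrow> bool" where
  "total_family D \<longleftrightarrow> (\<forall>x. (\<forall>d\<in>D. cinner x d = 0) \<longrightarrow> x = 0)"

lemma total_if_dense:
  assumes "closure D = UNIV"
  shows "total_family D"
  unfolding total_family_def
proof (intro allI impI)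
  fix x assume *: "\<forall>d\<in>D. cinner x d = 0"
  have "closed {y. cinner x y = 0}"
    by (intro closed_Collect_eq continuous_intros
        linear_continuous_on[OF bounded_linear_cinner_right])
  then have "closure D \<subseteq> {y. cinner x y = 0}"
    using * by (intro closure_minimal) auto
  then show "x = 0" using assms cinner_eq_zero_iff by auto
qed

text \<open>Zorn's lemma yields a maximal orthonormal set above \<open>E0\<close>. A nonzero vector
  orthogonal to it could be normalised and added, so there is none.\<close>

lemma orthonormal_extend_total:
  assumes "orthonormal E0"
  obtains E where "E0 \<subseteq> E" "orthonormal E" "total_family E"
proof -
  let ?A = "{E. orthonormal E \<and> E0 \<subseteq> E}"
  have "\<exists>M\<in>?A. \<forall>X\<in>?A. M \<subseteq> X \<longrightarrow> X = M"
  proof (rule subset_Zorn_nonempty)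
    show "?A \<noteq> {}" using assms by blast
    fix C assume C: "C \<noteq> {}" "subset.chain ?A C"
    have "orthonormal (\<Union> C)"
      unfolding orthonormal_def
    proof (intro ballI)
      fix x y assume "x \<in> \<Union> C" "y \<in> \<Union> C"
      then obtain X Y where XY: "X \<in> C" "Y \<in> C" "x \<in> X" "y \<in> Y" by blast
      then have "X \<subseteq> Y \<or> Y \<subseteq> X" using C(2) unfolding subset_chain_def by blast
      then obtain Z where "Z \<in> C" "x \<in> Z" "y \<in> Z" using XY by (metis subsetD)
      moreover have "orthonormal Z" using \<open>Z \<in> C\<close> C(2) unfolding subset_chain_def by blast
      ultimately show "cinner x y = (if x = y then 1 else 0)" by (auto simp: orthonormal_def)
    qed
    moreover have "E0 \<subseteq> \<Union> C" using C unfolding subset_chain_def by blast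
    ultimately show "\<Union> C \<in> ?A" by simp
  qed
  then obtain E where EA: "E \<in> ?A" and m: "\<forall>X\<in>?A. E \<subseteq> X \<longrightarrow> X = E" by blast
  have E: "orthonormal E" "E0 \<subseteq> E" using EA by simp_all
  have max: "X = E" if "orthonormal X" "E0 \<subseteq> X" "E \<subseteq> X" for X
    using m that by blast
  have "total_family E"
    unfolding total_family_def
  proof (intro allI impI, rule ccontr)
    fix x assume x: "\<forall>d\<in>E. cinner x d = 0" "x \<noteq> 0"
    define u where "u = complex_of_real (inverse (norm x)) *\<^sub>C x"
    have u: "cinner u u = 1"
      using x(2) unfolding u_def
      unfolding cinner_scaleC_left cinner_scaleC_right
      by (simp add: cinner_norm power2_eq_square field_simps)
    have o: "cinner u d = 0" "cinner d u = 0" if "d \<in> E" for d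
      using x(1) that cinner_commute[of d x] by (auto simp: u_def cinner_scaleC_left cinner_scaleC_right)
    have "orthonormal (insert u E)"
      using E(1) u o by (auto simp: orthonormal_def)
    then have "u \<in> E" using max[of "insert u E"] E(2) by auto
    then show False using o u by fastforce
  qed
  then show ?thesis using E that by blast
qed

lemma orthonormal_norm: "orthonormal E \<Longrightarrow> e \<in> E \<Longrightarrow> cinner e e = 1"
  by (auto simp: orthonormal_def)

text \<open>With s the projection of x onto the span of F, both <x, s> and <s, s> equal the sum, so
  the squared norm of x - s is the difference of the two sides.\<close>

lemma Bessel_finite:
  assumes "finite F" "orthonormal F"
  shows "(\<Sum>e\<in>F. (cmod (cinner x e))\<^sup>2) \<le> (norm x)\<^sup>2"
proof -
  define s where "s = (\<Sum>e\<in>F. cinner x e *\<^sub>C e)"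
  have "cinner x s = (\<Sum>e\<in>F. complex_of_real ((cmod (cinner x e))\<^sup>2))"
    unfolding s_def cinner_sum_right cinner_scaleC_right
    by (rule sum.cong) (simp_all add: complex_norm_square mult.commute del: of_real_power)
  moreover have "cinner s s = (\<Sum>e\<in>F. complex_of_real ((cmod (cinner x e))\<^sup>2))"
  proof -
    have "cinner s s = (\<Sum>e\<in>F. cinner x e * cinner e s)"
      by (subst (1) s_def) (simp add: cinner_sum_left cinner_scaleC_left)
    also have "\<dots> = (\<Sum>e\<in>F. cinner x e * cnj (cinner x e))"
    proof (rule sum.cong)
      fix e assume e: "e \<in> F"
      have "cinner e s = (\<Sum>d\<in>F. if d = e then cnj (cinner x d) else 0)"
        using assms(2) e unfolding s_def cinner_sum_right cinner_scaleC_right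
        by (intro sum.cong) (auto simp: orthonormal_def)
      then show "cinner x e * cinner e s = cinner x e * cnj (cinner x e)"
        using assms(1) e by simp
    qed simp
    finally show ?thesis by (simp add: complex_norm_square del: of_real_power)
  qed
  ultimately have "(norm (x - s))\<^sup>2 = (norm x)\<^sup>2 - (\<Sum>e\<in>F. (cmod (cinner x e))\<^sup>2)"
    unfolding norm_diff_sq norm_sq_cinner[of s] by simp
  then show ?thesis by (metis diff_ge_0_iff_ge zero_le_power2)
qed

text \<open>By Bessel, each d in D has only finitely many e with |<d, e>|^2 above a given 1/(n + 1).
  Totality of D puts every e, being nonzero, into one of these countably many finite sets.\<close>

lemma countable_orthonormal:
  fixes E D :: "'a::complex_hilbert set"
  assumes "countable D" "total_family D" "orthonormal E"
  shows "countable E"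
proof -
  have fin: "finite {e\<in>E. (cmod (cinner d e))\<^sup>2 > inverse (real (Suc n))}" for d n
  proof (rule ccontr)
    let ?S = "{e\<in>E. (cmod (cinner d e))\<^sup>2 > inverse (real (Suc n))}"
    assume "infinite ?S"
    obtain N where N: "(norm d)\<^sup>2 * real (Suc n) < real N" using reals_Archimedean2 by blast
    obtain F where F: "F \<subseteq> ?S" "finite F" "card F = N"
      using infinite_arbitrarily_large[OF \<open>infinite ?S\<close>] by blast
    have "orthonormal F" using F assms(3) by (auto simp: orthonormal_def subset_iff)
    have "real N * inverse (real (Suc n)) = (\<Sum>e\<in>F. inverse (real (Suc n)))" using F by simp
    also have "\<dots> \<le> (\<Sum>e\<in>F. (cmod (cinner d e))\<^sup>2)"
      using F by (intro sum_mono) (auto simp: subset_iff intro: less_imp_le)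
    also have "\<dots> \<le> (norm d)\<^sup>2" using Bessel_finite[OF F(2) \<open>orthonormal F\<close>] .
    finally have "real N \<le> (norm d)\<^sup>2 * real (Suc n)"
      by (simp add: field_simps)
    then show False using N by simp
  qed
  have "E \<subseteq> (\<Union>d\<in>D. \<Union>n. {e\<in>E. (cmod (cinner d e))\<^sup>2 > inverse (real (Suc n))})"
  proof
    fix e assume e: "e \<in> E"
    then have "e \<noteq> 0" using orthonormal_norm[OF assms(3) e] by auto
    then obtain d where d: "d \<in> D" "cinner e d \<noteq> 0" using assms(2) by (auto simp: total_family_def)
    then have "(cmod (cinner d e))\<^sup>2 > 0" using cinner_commute[of e d] by simp
    then obtain n where "inverse (real (Suc n)) < (cmod (cinner d e))\<^sup>2"
      using reals_Archimedean by blast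
    then show "e \<in> (\<Union>d\<in>D. \<Union>n. {e\<in>E. (cmod (cinner d e))\<^sup>2 > inverse (real (Suc n))})"
      using d e by blast
  qed
  moreover have "countable (\<Union>d\<in>D. \<Union>n. {e\<in>E. (cmod (cinner d e))\<^sup>2 > inverse (real (Suc n))})"
    using assms(1) fin by (intro countable_UN) (auto intro: countable_finite)
  ultimately show ?thesis by (rule countable_subset)
qed

text \<open>This excludes a finite total orthonormal set in the space of the theorem, so a total one
  can be enumerated by the natural numbers.\<close>

lemma total_finite_orthonormal_spans:
  assumes "finite E" "orthonormal E" "total_family E"
  shows "module.span scaleC E = UNIV"
proof -
  have "x \<in> scaleC.span E" for x
  proof -
    define s where "s = (\<Sum>e\<in>E. cinner x e *\<^sub>C e)"
    have "cinner (x - s) e = 0" if e: "e \<in> E" for e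
    proof -
      have "cinner s e = (\<Sum>d\<in>E. if d = e then cinner x d else 0)"
        using assms(2) e unfolding s_def cinner_sum_left cinner_scaleC_left
        by (intro sum.cong) (auto simp: orthonormal_def)
      then show ?thesis using assms(1) e by (simp add: cinner_diff_left)
    qed
    then have "x - s = 0" using assms(3) unfolding total_family_def by blast
    moreover have "s \<in> scaleC.span E"
      unfolding s_def by (intro scaleC.span_sum scaleC.span_scale scaleC.span_base)
    ultimately show ?thesis by simp
  qed
  then show ?thesis by auto
qed

section \<open>Orthonormal bases indexed by the natural numbers and the unitary between two of
  them\<close>

definition orthonormal_basis :: "(nat \<Rightarrow> 'a::complex_hilbert) \<Rightarrow> bool" where
  "orthonormal_basis e \<longleftrightarrow>
     (\<forall>m n. cinner (e m) (e n) = (if m = n then 1 else 0)) \<and> total_family (range e)"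

lemma orthonormal_basis_from_set:
  assumes "countable E" "infinite E" "orthonormal E" "total_family E"
  shows "orthonormal_basis (from_nat_into E)"
proof -
  have "bij_betw (from_nat_into E) UNIV E" by (rule bij_betw_from_nat_into[OF assms(1,2)])
  then have "inj (from_nat_into E)" "range (from_nat_into E) = E" by (auto simp: bij_betw_def)
  moreover from this have "from_nat_into E n \<in> E" for n by blast
  ultimately show ?thesis
    using assms(3,4) unfolding orthonormal_basis_def orthonormal_def by (simp add: inj_eq)
qed

text \<open>By Pythagoras the squared norm of a block of the series is the same block of the scalar
  series, so the Cauchy criterion carries over.\<close>

lemma summable_orthonormal_series:
  fixes e :: "nat \<Rightarrow> 'a::complex_hilbert"
  assumes e: "\<And>m n. cinner (e m) (e n) = (if m = n then 1 else 0)"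
    and c: "summable (\<lambda>n. (cmod (c n))\<^sup>2)"
  shows "summable (\<lambda>n. c n *\<^sub>C e n)"
proof -
  have sq: "(norm (\<Sum>k\<in>F. c k *\<^sub>C e k))\<^sup>2 = (\<Sum>k\<in>F. (cmod (c k))\<^sup>2)" if "finite F" for F
  proof -
    have "cinner (\<Sum>k\<in>F. c k *\<^sub>C e k) (\<Sum>k\<in>F. c k *\<^sub>C e k)
        = (\<Sum>k\<in>F. \<Sum>j\<in>F. if j = k then c k * cnj (c k) else 0)"
      unfolding cinner_sum_left cinner_scaleC_left cinner_sum_right cinner_scaleC_right sum_distrib_left
      by (intro sum.cong) (auto simp: e)
    also have "\<dots> = (\<Sum>k\<in>F. complex_of_real ((cmod (c k))\<^sup>2))"
      using that by (intro sum.cong) (simp_all add: complex_norm_square del: of_real_power)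
    finally show ?thesis by (simp add: norm_sq_cinner)
  qed
  show ?thesis
    unfolding summable_Cauchy
  proof (intro allI impI)
    fix \<epsilon> :: real assume "0 < \<epsilon>"
    then obtain N where N: "\<And>m n. m \<ge> N \<Longrightarrow> norm (\<Sum>k=m..<n. (cmod (c k))\<^sup>2) < \<epsilon>\<^sup>2"
      using c unfolding summable_Cauchy by (meson zero_less_power)
    have "norm (\<Sum>k=m..<n. c k *\<^sub>C e k) < \<epsilon>" if "m \<ge> N" for m n
    proof -
      have "(norm (\<Sum>k=m..<n. c k *\<^sub>C e k))\<^sup>2 < \<epsilon>\<^sup>2"
        using N[OF that, of n] sq[of "{m..<n}"] by simp
      then show ?thesis using \<open>0 < \<epsilon>\<close> by (simp add: power2_less_imp_less)
    qed
    then show "\<exists>N. \<forall>m\<ge>N. \<forall>n. norm (\<Sum>k=m..<n. c k *\<^sub>C e k) < \<epsilon>" by blast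
  qed
qed

lemma Bessel_summable:
  assumes e: "\<And>m n. cinner (e m) (e n) = (if m = n then 1 else 0)"
  shows "summable (\<lambda>n. (cmod (cinner x (e n)))\<^sup>2)"
proof (rule bounded_imp_summable)
  have inj: "inj e"
  proof (rule injI)
    fix m n assume "e m = e n"
    then have "cinner (e m) (e n) = 1" using e[of m m] by simp
    then show "m = n" using e[of m n] by (auto split: if_splits)
  qed
  show "(\<Sum>k\<le>n. (cmod (cinner x (e k)))\<^sup>2) \<le> (norm x)\<^sup>2" for n
  proof -
    have "orthonormal (e ` {..n})" by (auto simp: orthonormal_def e inj_eq[OF inj])
    then have "(\<Sum>y\<in>e ` {..n}. (cmod (cinner x y))\<^sup>2) \<le> (norm x)\<^sup>2"
      by (intro Bessel_finite) simp
    moreover have "inj_on e {..n}"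
      by (rule inj_onI) (rule injD[OF inj])
    ultimately show ?thesis
      by (simp only: sum.reindex o_def)
  qed
qed simp

text \<open>The series converges to some s by Bessel; x - s is orthogonal to every
  \<open>e m\<close>, and totality forces s = x.\<close>

lemma orthonormal_basis_expansion:
  assumes "orthonormal_basis e"
  shows "(\<lambda>n. cinner x (e n) *\<^sub>C e n) sums x"
proof -
  have e: "\<And>m n. cinner (e m) (e n) = (if m = n then 1 else 0)" and t: "total_family (range e)"
    using assms by (auto simp: orthonormal_basis_def)
  have "summable (\<lambda>n. cinner x (e n) *\<^sub>C e n)"
    by (rule summable_orthonormal_series[OF e Bessel_summable[OF e]])
  then obtain s where s: "(\<lambda>n. cinner x (e n) *\<^sub>C e n) sums s" by (auto simp: summable_def)
  have "cinner (x - s) (e m) = 0" for m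
  proof -
    have "(\<lambda>n. cinner (cinner x (e n) *\<^sub>C e n) (e m)) sums cinner s (e m)"
      by (rule bounded_linear.sums[OF bounded_linear_cinner_left s])
    moreover have "(\<lambda>n. cinner (cinner x (e n) *\<^sub>C e n) (e m))
        = (\<lambda>n. if n = m then cinner x (e m) else 0)"
      by (auto simp: cinner_scaleC_left e)
    ultimately have "cinner s (e m) = cinner x (e m)"
      using sums_single[of m "\<lambda>_. cinner x (e m)"] by (metis (full_types) sums_unique2)
    then show ?thesis by (simp add: cinner_diff_left)
  qed
  then have "x - s = 0" using t unfolding total_family_def by blast
  then show ?thesis using s by simp
qed

text \<open>V keeps the coefficients and exchanges e for f. Square summability of the coefficients
  is the same condition in both spaces, which also gives surjectivity.\<close>

lemma orthonormal_basis_unitary: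
  fixes e :: "nat \<Rightarrow> 'a::complex_hilbert" and f :: "nat \<Rightarrow> 'b::complex_hilbert"
  assumes "orthonormal_basis e" "orthonormal_basis f"
  obtains V :: "'a \<Rightarrow> 'b" where "\<And>x y. V (x + y) = V x + V y" "\<And>c x. V (c *\<^sub>C x) = c *\<^sub>C V x"
    "\<And>x y. cinner (V x) (V y) = cinner x y" "surj V"
proof -
  have e: "\<And>m n. cinner (e m) (e n) = (if m = n then 1 else 0)"
    and f: "\<And>m n. cinner (f m) (f n) = (if m = n then 1 else 0)"
    using assms by (auto simp: orthonormal_basis_def)
  \<comment> \<open>Recovers the coefficients of a convergent orthonormal series. It is used with f
    to compute V and with e to prove surjectivity, hence the general type.\<close>
  have coeff: "cinner s (h m) = c m" if "(\<lambda>n. c n *\<^sub>C h n) sums s"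
    "\<And>m n. cinner (h m) (h n) = (if m = n then 1 else 0)"
    for s :: "'c::complex_hilbert" and c h m
  proof -
    have "(\<lambda>n. cinner (c n *\<^sub>C h n) (h m)) sums cinner s (h m)"
      by (rule bounded_linear.sums[OF bounded_linear_cinner_left that(1)])
    moreover have "(\<lambda>n. cinner (c n *\<^sub>C h n) (h m)) = (\<lambda>n. if n = m then c m else 0)"
      by (auto simp: cinner_scaleC_left that(2))
    ultimately show ?thesis
      using sums_single[of m "\<lambda>_. c m"] by (metis (full_types) sums_unique2)
  qed
  define V where "V x = (\<Sum>n. cinner x (e n) *\<^sub>C f n)" for x
  have V: "(\<lambda>n. cinner x (e n) *\<^sub>C f n) sums V x" for x
    unfolding V_def
    by (intro summable_sums summable_orthonormal_series[OF f] Bessel_summable e)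
  have Vf: "cinner (V x) (f m) = cinner x (e m)" for x m
    using coeff[OF V f] .
  show ?thesis
  proof (rule that)
    show "V (x + y) = V x + V y" for x y
      using sums_unique2[OF V[of "x + y"]] sums_add[OF V[of x] V[of y]]
      by (simp add: cinner_add_left scaleC_add_left)
    show "V (c *\<^sub>C x) = c *\<^sub>C V x" for c x
      using sums_unique2[OF V[of "c *\<^sub>C x"]]
        bounded_linear.sums[OF bounded_linear_scaleC_right V[of x], of c]
      by (simp add: cinner_scaleC_left scaleC_scaleC)
    show "cinner (V x) (V y) = cinner x y" for x y
    proof -
      \<comment> \<open>Both inner products are expanded in their first argument; the terms agree
        because \<open>V y\<close> has the same coefficients as y.\<close>
      have "(\<lambda>n. cinner (cinner x (e n) *\<^sub>C f n) (V y)) sums cinner (V x) (V y)"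
        by (rule bounded_linear.sums[OF bounded_linear_cinner_left V])
      moreover have "(\<lambda>n. cinner (cinner x (e n) *\<^sub>C e n) y) sums cinner x y"
        by (rule bounded_linear.sums[OF bounded_linear_cinner_left
              orthonormal_basis_expansion[OF assms(1)]])
      moreover have "cinner (f n) (V y) = cinner (e n) y" for n
        using Vf[of y n] cinner_commute[of "f n" "V y"] cinner_commute[of "e n" y] by simp
      ultimately show ?thesis by (simp add: cinner_scaleC_left sums_unique2)
    qed
    show "surj V"
      unfolding surj_def
    proof
      fix y
      have "summable (\<lambda>n. cinner y (f n) *\<^sub>C e n)"
        by (intro summable_orthonormal_series[OF e] Bessel_summable f)
      then obtain x where x: "(\<lambda>n. cinner y (f n) *\<^sub>C e n) sums x" by (auto simp: summable_def)
      have "(\<lambda>n. cinner y (f n) *\<^sub>C f n) sums V x"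
        using V[of x] coeff[OF x e] by simp
      then show "\<exists>x. y = V x"
        using orthonormal_basis_expansion[OF assms(2), of y] sums_unique2 by blast
    qed
  qed
qed

section \<open>Square-integrable functions\<close>

lemma borel_measurable_cnj [measurable (raw)]:
  "f \<in> borel_measurable M \<Longrightarrow> (\<lambda>x. cnj (f x)) \<in> borel_measurable M"
  by (rule measurable_compose[OF _ borel_measurable_continuous_onI])
    (auto intro: continuous_intros)

lemma L2_functions_measurable: "g \<in> L2_functions M \<Longrightarrow> g \<in> borel_measurable M"
  by (simp add: L2_functions_def)

lemma L2_functions_integrable_sq: "g \<in> L2_functions M \<Longrightarrow> integrable M (\<lambda>t. (cmod (g t))\<^sup>2)"
  by (simp add: L2_functions_def)

lemma L2_functions_zero: "(\<lambda>t. 0) \<in> L2_functions M"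
  by (simp add: L2_functions_def)

lemma L2_functions_add:
  assumes "f \<in> L2_functions M" "g \<in> L2_functions M"
  shows "(\<lambda>t. f t + g t) \<in> L2_functions M"
proof -
  have [measurable]: "f \<in> borel_measurable M" "g \<in> borel_measurable M"
    using assms by (auto simp: L2_functions_def)
  have "integrable M (\<lambda>t. (cmod (f t + g t))\<^sup>2)"
  proof (rule Bochner_Integration.integrable_bound)
    show "integrable M (\<lambda>t. 2 * (cmod (f t))\<^sup>2 + 2 * (cmod (g t))\<^sup>2)"
      using assms by (auto simp: L2_functions_def)
    show "AE t in M. norm ((cmod (f t + g t))\<^sup>2) \<le> norm (2 * (cmod (f t))\<^sup>2 + 2 * (cmod (g t))\<^sup>2)"
    proof (intro AE_I2)
      fix t
      have "(cmod (f t + g t))\<^sup>2 \<le> (cmod (f t) + cmod (g t))\<^sup>2"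
        by (intro power_mono norm_triangle_ineq) simp
      also have "\<dots> \<le> 2 * (cmod (f t))\<^sup>2 + 2 * (cmod (g t))\<^sup>2"
        using zero_le_power2[of "cmod (f t) - cmod (g t)"] unfolding power2_sum power2_diff by linarith
      finally show "norm ((cmod (f t + g t))\<^sup>2) \<le> norm (2 * (cmod (f t))\<^sup>2 + 2 * (cmod (g t))\<^sup>2)"
        by simp
    qed
  qed measurable
  then show ?thesis by (simp add: L2_functions_def)
qed

lemma L2_functions_mult_bounded:
  assumes g: "g \<in> L2_functions M" and [measurable]: "\<phi> \<in> borel_measurable M"
    and bound: "AE t in M. cmod (\<phi> t) \<le> B"
  shows "(\<lambda>t. \<phi> t * g t) \<in> L2_functions M"
proof -
  have [measurable]: "g \<in> borel_measurable M" using g by (rule L2_functions_measurable)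
  have "integrable M (\<lambda>t. (cmod (\<phi> t * g t))\<^sup>2)"
  proof (rule Bochner_Integration.integrable_bound)
    show "integrable M (\<lambda>t. B\<^sup>2 * (cmod (g t))\<^sup>2)"
      using g by (auto simp: L2_functions_def)
    show "AE t in M. norm ((cmod (\<phi> t * g t))\<^sup>2) \<le> norm (B\<^sup>2 * (cmod (g t))\<^sup>2)"
      using bound
    proof eventually_elim
      case (elim t)
      then show ?case
        by (simp add: norm_mult power_mult_distrib mult_right_mono power_mono)
    qed
  qed measurable
  then show ?thesis by (simp add: L2_functions_def)
qed

lemma L2_functions_scale: "g \<in> L2_functions M \<Longrightarrow> (\<lambda>t. c * g t) \<in> L2_functions M"
  by (rule L2_functions_mult_bounded[where B = "cmod c"]) auto

lemma L2_functions_minus: "g \<in> L2_functions M \<Longrightarrow> (\<lambda>t. - g t) \<in> L2_functions M"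
  using L2_functions_scale[of g M "- 1"] by simp

lemma L2_functions_diff:
  "f \<in> L2_functions M \<Longrightarrow> g \<in> L2_functions M \<Longrightarrow> (\<lambda>t. f t - g t) \<in> L2_functions M"
  using L2_functions_add[of f M "\<lambda>t. (- 1) * g t"] L2_functions_scale[of g M "- 1"] by simp

lemma L2_functions_integrable_mult:
  assumes "f \<in> L2_functions M" "g \<in> L2_functions M"
  shows "integrable M (\<lambda>t. f t * cnj (g t))"
proof (rule Bochner_Integration.integrable_bound)
  have [measurable]: "f \<in> borel_measurable M" "g \<in> borel_measurable M"
    using assms by (auto simp: L2_functions_def)
  show "integrable M (\<lambda>t. (cmod (f t))\<^sup>2 + (cmod (g t))\<^sup>2)"
    using assms by (auto simp: L2_functions_def)
  show "(\<lambda>t. f t * cnj (g t)) \<in> borel_measurable M"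
    by measurable
  show "AE t in M. norm (f t * cnj (g t)) \<le> norm ((cmod (f t))\<^sup>2 + (cmod (g t))\<^sup>2)"
  proof (intro AE_I2)
    fix t
    have "cmod (f t) * cmod (g t) \<le> (cmod (f t))\<^sup>2 + (cmod (g t))\<^sup>2"
      using zero_le_power2[of "cmod (f t) - cmod (g t)"] zero_le_power2[of "cmod (f t)"]
        zero_le_power2[of "cmod (g t)"] unfolding power2_diff by linarith
    then show "norm (f t * cnj (g t)) \<le> norm ((cmod (f t))\<^sup>2 + (cmod (g t))\<^sup>2)"
      by (simp add: norm_mult)
  qed
qed

lemma L2_functions_cong_AE:
  assumes "f \<in> L2_functions M" "g \<in> borel_measurable M" "AE t in M. f t = g t"
  shows "g \<in> L2_functions M"
proof -
  have "integrable M (\<lambda>t. (cmod (f t))\<^sup>2) \<longleftrightarrow> integrable M (\<lambda>t. (cmod (g t))\<^sup>2)"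
    using assms by (intro integrable_cong_AE) (auto simp: L2_functions_def)
  then show ?thesis using assms by (simp add: L2_functions_def)
qed

lemma integral_mult_cnj_self:
  "(LINT t|M. g t * cnj (g t)) = complex_of_real (LINT t|M. (cmod (g t))\<^sup>2)"
  unfolding integral_complex_of_real[symmetric]
  by (intro Bochner_Integration.integral_cong) (simp_all add: complex_norm_square del: of_real_power)

text \<open>The positive and negative parts of g are densities of two finite measures that agree on
  half-lines, hence are equal, and such densities are unique almost everywhere. Only rational
  endpoints are assumed, so that a countable family of intervals can be shown total.\<close>

lemma AE_zero_if_integral_half_lines_zero_real:
  fixes M :: "real measure" and g :: "real \<Rightarrow> real"
  assumes sets: "sets M = sets borel" and int: "integrable M g"
    and zero: "\<And>q. q \<in> \<rat> \<Longrightarrow> (LINT t|M. indicator {q<..} t * g t) = 0"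
  shows "AE t in M. g t = 0"
proof -
  have [measurable]: "g \<in> borel_measurable M" using int by auto
  note [measurable_cong] = sets
  have intg: "integrable M (\<lambda>t. indicator {x<..} t * h t)" if "integrable M h" for x and h :: "real \<Rightarrow> real"
    using integrable_mult_indicator[OF _ that, of "{x<..}"] by (simp add: sets)
  \<comment> \<open>Rational endpoints tending to x from above give indicators that converge
    pointwise to that of the open half-line; dominated convergence does the rest.\<close>
  have zero': "(LINT t|M. indicator {x<..} t * g t) = 0" for x
  proof -
    have "\<exists>q\<in>\<rat>. x < q \<and> q < x + inverse (real (Suc n))" for n
      by (rule Rats_dense_in_real) simp
    then have "\<forall>n. \<exists>q. q \<in> \<rat> \<and> x < q \<and> q < x + inverse (real (Suc n))" by blast
    from choice[OF this] obtain q where q: "\<And>n. q n \<in> \<rat>" "\<And>n. x < q n"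
      "\<And>n. q n < x + inverse (real (Suc n))" by blast
    have qx: "q \<longlonglongrightarrow> x"
    proof (rule tendsto_sandwich[of "\<lambda>_. x" _ _ "\<lambda>n. x + inverse (real (Suc n))"])
      show "\<forall>\<^sub>F n in sequentially. x \<le> q n"
        using q(2) by (intro always_eventually allI less_imp_le)
      show "\<forall>\<^sub>F n in sequentially. q n \<le> x + inverse (real (Suc n))"
        using q(3) by (intro always_eventually allI less_imp_le)
      show "(\<lambda>n. x + inverse (real (Suc n))) \<longlonglongrightarrow> x"
        using tendsto_add[OF tendsto_const LIMSEQ_inverse_real_of_nat, of x] by simp
    qed simp
    have "(\<lambda>n. LINT t|M. indicator {q n<..} t * g t) \<longlonglongrightarrow> (LINT t|M. indicator {x<..} t * g t)"
    proof (rule integral_dominated_convergence[where w = "\<lambda>t. \<bar>g t\<bar>"])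
      show "AE t in M. (\<lambda>n. indicator {q n<..} t * g t) \<longlonglongrightarrow> indicator {x<..} t * g t"
      proof (intro AE_I2 tendsto_mult tendsto_const)
        fix t
        show "(\<lambda>n. indicator {q n<..} t :: real) \<longlonglongrightarrow> indicator {x<..} t"
        proof (cases "x < t")
          case True
          with qx have "\<forall>\<^sub>F n in sequentially. q n < t" by (rule order_tendstoD)
          then show ?thesis
            using True by (intro tendsto_eventually) (auto elim!: eventually_mono)
        next
          case False
          then have "t \<le> q n" for n using q(2)[of n] by simp
          then have "indicator {q n<..} t = (0::real)" for n by (simp add: indicator_def not_less)
          then show ?thesis using False by simp
        qed
      qed
    qed (use int in \<open>auto simp: indicator_def\<close>)
    then show ?thesis using zero q(1) by (simp add: LIMSEQ_const_iff)
  qed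
  have em: "emeasure (density M (\<lambda>t. ennreal (h t))) {x<..}
      = ennreal (LINT t|M. indicator {x<..} t * max 0 (h t))"
    if h: "integrable M h" for h x
  proof -
    have [measurable]: "h \<in> borel_measurable M" using h by auto
    have "emeasure (density M (\<lambda>t. ennreal (h t))) {x<..}
      = (\<integral>\<^sup>+t. ennreal (indicator {x<..} t * max 0 (h t)) \<partial>M)"
      by (subst emeasure_density)
        (auto simp: sets indicator_def ennreal_neg max_def intro!: nn_integral_cong)
    also have "\<dots> = ennreal (LINT t|M. indicator {x<..} t * max 0 (h t))"
      using h by (intro nn_integral_eq_integral intg integrable_max) auto
    finally show ?thesis .
  qed
  \<comment> \<open>\<open>ennreal\<close> cuts negative values off to 0, so these two densities are
    the positive and the negative part of g.\<close>
  have "density M (\<lambda>t. ennreal (g t)) = density M (\<lambda>t. ennreal (- g t))"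
  proof (rule measure_eqI_lessThan)
    fix x
    show "emeasure (density M (\<lambda>t. ennreal (g t))) {x<..} < \<infinity>"
      using em[OF int] by simp
    have "(LINT t|M. indicator {x<..} t * max 0 (g t)) - (LINT t|M. indicator {x<..} t * max 0 (- g t))
        = (LINT t|M. indicator {x<..} t * max 0 (g t) - indicator {x<..} t * max 0 (- g t))"
      using int by (intro Bochner_Integration.integral_diff[symmetric] intg integrable_max) auto
    also have "\<dots> = (LINT t|M. indicator {x<..} t * g t)"
      by (intro Bochner_Integration.integral_cong) (auto simp: max_def indicator_def)
    finally show "emeasure (density M (\<lambda>t. ennreal (g t))) {x<..}
        = emeasure (density M (\<lambda>t. ennreal (- g t))) {x<..}"
      using em[OF int, of x] em[of "\<lambda>t. - g t" x] int zero'[of x] by simp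
  qed (auto simp: sets)
  moreover have "(\<integral>\<^sup>+t. ennreal (g t) \<partial>M) \<noteq> \<infinity>"
  proof -
    have "(\<integral>\<^sup>+t. ennreal (g t) \<partial>M) \<le> (\<integral>\<^sup>+t. ennreal (norm (g t)) \<partial>M)"
      by (intro nn_integral_mono ennreal_leI) simp
    also have "\<dots> < \<infinity>" using int by (simp add: integrable_iff_bounded)
    finally show ?thesis by simp
  qed
  ultimately have "AE t in M. ennreal (g t) = ennreal (- g t)"
    by (subst (asm) finite_density_unique) auto
  then show ?thesis
  proof eventually_elim
    case (elim t)
    then show ?case
      by (cases "0 \<le> g t") (auto simp: ennreal_neg ennreal_eq_0_iff)
  qed
qed

lemma AE_zero_if_integral_half_lines_zero:
  fixes M :: "real measure" and g :: "real \<Rightarrow> complex"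
  assumes sets: "sets M = sets borel" and int: "integrable M g"
    and zero: "\<And>q. q \<in> \<rat> \<Longrightarrow> (LINT t|M. indicator {q<..} t * g t) = 0"
  shows "AE t in M. g t = 0"
proof -
  have ind: "integrable M (\<lambda>t. indicator {q<..} t * g t)" for q
    using integrable_mult_indicator[OF _ int, of "{q<..}"]
    by (simp add: sets scaleR_conv_of_real of_real_indicator)
  have "AE t in M. Re (g t) = 0"
  proof (rule AE_zero_if_integral_half_lines_zero_real[OF sets])
    fix q :: real assume "q \<in> \<rat>"
    have "(LINT t|M. indicator {q<..} t * Re (g t)) = (LINT t|M. Re (indicator {q<..} t * g t))"
      by (intro Bochner_Integration.integral_cong) (auto simp: indicator_def)
    also have "\<dots> = Re (LINT t|M. indicator {q<..} t * g t)"
      using ind[of q] by (rule integral_Re)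
    finally show "(LINT t|M. indicator {q<..} t * Re (g t)) = 0"
      using zero[OF \<open>q \<in> \<rat>\<close>] by simp
  qed (use int in auto)
  moreover have "AE t in M. Im (g t) = 0"
  proof (rule AE_zero_if_integral_half_lines_zero_real[OF sets])
    fix q :: real assume "q \<in> \<rat>"
    have "(LINT t|M. indicator {q<..} t * Im (g t)) = (LINT t|M. Im (indicator {q<..} t * g t))"
      by (intro Bochner_Integration.integral_cong) (auto simp: indicator_def)
    also have "\<dots> = Im (LINT t|M. indicator {q<..} t * g t)"
      using ind[of q] by (rule integral_Im)
    finally show "(LINT t|M. indicator {q<..} t * Im (g t)) = 0"
      using zero[OF \<open>q \<in> \<rat>\<close>] by simp
  qed (use int in auto)
  ultimately show ?thesis
    by eventually_elim (simp add: complex_eq_iff)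
qed

section \<open>The Hilbert space of square-integrable functions on the line\<close>

text \<open>The relation is reflexive exactly on the square-integrable functions, so one partial
  quotient both restricts to them and identifies functions that agree almost everywhere.\<close>

definition l2_rel :: "(real \<Rightarrow> complex) \<Rightarrow> (real \<Rightarrow> complex) \<Rightarrow> bool" where
  "l2_rel f g \<longleftrightarrow> f \<in> L2_functions lborel \<and> g \<in> L2_functions lborel \<and> (AE t in lborel. f t = g t)"

quotient_type l2 = "real \<Rightarrow> complex" / partial: l2_rel
proof (rule part_equivpI)
  show "\<exists>f. l2_rel f f"
    using L2_functions_zero by (auto simp: l2_rel_def)
  show "symp l2_rel"
    by (auto simp: symp_def l2_rel_def elim: AE_mp)
  show "transp l2_rel"
    unfolding transp_def l2_rel_def by (auto elim: AE_mp)
qed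

lemma l2_rel_refl: "l2_rel f f \<longleftrightarrow> f \<in> L2_functions lborel"
  by (auto simp: l2_rel_def)

lemma l2_relD:
  assumes "l2_rel f g"
  shows "f \<in> L2_functions lborel" "g \<in> L2_functions lborel"
    "f \<in> borel_measurable borel" "g \<in> borel_measurable borel" "AE t in lborel. f t = g t"
  using assms by (auto simp: l2_rel_def dest!: L2_functions_measurable)

instantiation l2 :: real_vector
begin

lift_definition zero_l2 :: l2 is "\<lambda>t. 0"
  by (simp add: l2_rel_refl L2_functions_zero)

lift_definition plus_l2 :: "l2 \<Rightarrow> l2 \<Rightarrow> l2" is "\<lambda>f g t. f t + g t"
  unfolding l2_rel_def by (auto intro: L2_functions_add)

lift_definition minus_l2 :: "l2 \<Rightarrow> l2 \<Rightarrow> l2" is "\<lambda>f g t. f t - g t"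
  unfolding l2_rel_def by (auto intro: L2_functions_diff)

lift_definition uminus_l2 :: "l2 \<Rightarrow> l2" is "\<lambda>f t. - f t"
  unfolding l2_rel_def by (auto intro: L2_functions_minus)

lift_definition scaleR_l2 :: "real \<Rightarrow> l2 \<Rightarrow> l2" is "\<lambda>r f t. complex_of_real r * f t"
  unfolding l2_rel_def by (auto intro: L2_functions_scale)

instance
proof
  fix x y z :: l2 and a b :: real
  show "x + y + z = x + (y + z)"
    by transfer (auto simp: l2_rel_def add.assoc intro!: L2_functions_add)
  show "x + y = y + x"
    by transfer (auto simp: l2_rel_def add.commute intro!: L2_functions_add)
  show "0 + x = x"
    by transfer (auto simp: l2_rel_def)
  show "- x + x = 0"
    by transfer (auto simp: l2_rel_def L2_functions_zero)
  show "x - y = x + - y"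
    by transfer (auto simp: l2_rel_def intro!: L2_functions_diff)
  show "a *\<^sub>R (x + y) = a *\<^sub>R x + a *\<^sub>R y"
    by transfer (auto simp: l2_rel_def distrib_left intro!: L2_functions_add L2_functions_scale)
  show "(a + b) *\<^sub>R x = a *\<^sub>R x + b *\<^sub>R x"
    by transfer (auto simp: l2_rel_def distrib_right intro!: L2_functions_add L2_functions_scale)
  show "a *\<^sub>R b *\<^sub>R x = (a * b) *\<^sub>R x"
    by transfer (auto simp: l2_rel_def mult.assoc intro!: L2_functions_scale)
  show "1 *\<^sub>R x = x"
    by transfer (auto simp: l2_rel_def)
qed

end

text \<open>The complex inner product is lifted before any norm exists: its real part supplies the
  \<open>real_inner\<close> structure, and with it norm and triangle inequality; later it serves as
  \<open>cinner\<close>.\<close>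

lift_definition l2_cinner :: "l2 \<Rightarrow> l2 \<Rightarrow> complex" is "\<lambda>f g. LINT t|lborel. f t * cnj (g t)"
proof -
  fix f f' g g' assume "l2_rel f f'" "l2_rel g g'"
  note * = l2_relD[OF this(1)] l2_relD[OF this(2)]
  note [measurable] = *(3,4,8,9)
  show "(LINT t|lborel. f t * cnj (g t)) = (LINT t|lborel. f' t * cnj (g' t))"
  proof (rule integral_cong_AE)
    show "AE t in lborel. f t * cnj (g t) = f' t * cnj (g' t)"
      using *(5,10) by eventually_elim simp
  qed measurable
qed

lemma l2_cinner_commute: "l2_cinner x y = cnj (l2_cinner y x)"
proof transfer
  fix f g
  have "cnj (LINT t|lborel. g t * cnj (f t)) = (LINT t|lborel. cnj (g t * cnj (f t)))"
    by (simp del: complex_cnj_mult)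
  then show "(LINT t|lborel. f t * cnj (g t)) = cnj (LINT t|lborel. g t * cnj (f t))"
    by (simp add: mult.commute)
qed

lemma l2_cinner_add_left: "l2_cinner (x + y) z = l2_cinner x z + l2_cinner y z"
  by transfer (simp add: l2_rel_refl distrib_right Bochner_Integration.integral_add L2_functions_integrable_mult)

lemma l2_cinner_self: "l2_cinner x x = complex_of_real (Re (l2_cinner x x)) \<and> 0 \<le> Re (l2_cinner x x)"
  by transfer (simp add: integral_mult_cnj_self)

lemma l2_cinner_self_eq_0: "Re (l2_cinner x x) = 0 \<longleftrightarrow> x = 0"
proof transfer
  fix f assume "l2_rel f f"
  then have f: "f \<in> L2_functions lborel" by (simp add: l2_rel_refl)
  then show "(Re (LINT t|lborel. f t * cnj (f t)) = 0) = l2_rel f (\<lambda>t. 0)"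
    unfolding integral_mult_cnj_self Re_complex_of_real
    by (subst integral_nonneg_eq_0_iff_AE)
      (auto simp: l2_rel_def L2_functions_zero L2_functions_def)
qed

instantiation l2 :: real_inner
begin

definition inner_l2 :: "l2 \<Rightarrow> l2 \<Rightarrow> real" where "inner_l2 x y = Re (l2_cinner x y)"
definition norm_l2 :: "l2 \<Rightarrow> real" where "norm_l2 x = sqrt (inner x x)"
definition dist_l2 :: "l2 \<Rightarrow> l2 \<Rightarrow> real" where "dist_l2 x y = norm (x - y)"
definition sgn_l2 :: "l2 \<Rightarrow> l2" where "sgn_l2 x = x /\<^sub>R norm x"
definition uniformity_l2 :: "(l2 \<times> l2) filter" where
  "uniformity_l2 = (INF e\<in>{0 <..}. principal {(x, y). dist x y < e})"
definition open_l2 :: "l2 set \<Rightarrow> bool" where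
  "open_l2 U \<longleftrightarrow> (\<forall>x\<in>U. eventually (\<lambda>(x', y). x' = x \<longrightarrow> y \<in> U) uniformity)"

lemma l2_cinner_scaleR_left: "l2_cinner (r *\<^sub>R x) y = complex_of_real r * l2_cinner x y"
  by transfer (simp add: mult.assoc)

instance
proof
  fix x y z :: l2 and r :: real
  show "inner x y = inner y x"
    using l2_cinner_commute[of x y] by (simp add: inner_l2_def)
  show "inner (x + y) z = inner x z + inner y z"
    by (simp add: inner_l2_def l2_cinner_add_left)
  show "inner (r *\<^sub>R x) y = r * inner x y"
    by (simp add: inner_l2_def l2_cinner_scaleR_left)
  show "0 \<le> inner x x"
    using l2_cinner_self[of x] by (simp add: inner_l2_def)
  show "inner x x = 0 \<longleftrightarrow> x = 0"
    by (simp add: inner_l2_def l2_cinner_self_eq_0)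
qed (simp_all add: dist_l2_def sgn_l2_def uniformity_l2_def open_l2_def norm_l2_def)

end

lemma norm_abs_l2:
  assumes "f \<in> L2_functions lborel"
  shows "(norm (abs_l2 f))\<^sup>2 = (LINT t|lborel. (cmod (f t))\<^sup>2)"
  using assms
  by (simp add: norm_l2_def inner_l2_def l2_cinner.abs_eq l2_rel_refl integral_mult_cnj_self)

lemma abs_l2_eq_iff:
  "f \<in> L2_functions lborel \<Longrightarrow> g \<in> L2_functions lborel \<Longrightarrow>
    abs_l2 f = abs_l2 g \<longleftrightarrow> (AE t in lborel. f t = g t)"
  using Quotient_rel[OF Quotient_l2, of f g] by (simp add: l2_rel_def)

lemma abs_l2_surj: obtains f where "f \<in> L2_functions lborel" "abs_l2 f = x"
proof -
  have "l2_rel (rep_l2 x) (rep_l2 x)" by (rule Quotient_rep_reflp[OF Quotient_l2])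
  then show ?thesis using that[of "rep_l2 x"] Quotient_abs_rep[OF Quotient_l2] by (simp add: l2_rel_refl)
qed

lemma abs_l2_add: "f \<in> L2_functions lborel \<Longrightarrow> g \<in> L2_functions lborel \<Longrightarrow>
    abs_l2 f + abs_l2 g = abs_l2 (\<lambda>t. f t + g t)"
  by (simp add: plus_l2.abs_eq l2_rel_refl)

lemma abs_l2_diff: "f \<in> L2_functions lborel \<Longrightarrow> g \<in> L2_functions lborel \<Longrightarrow>
    abs_l2 f - abs_l2 g = abs_l2 (\<lambda>t. f t - g t)"
  by (simp add: minus_l2.abs_eq l2_rel_refl)

lemma nn_integral_abs_l2:
  assumes "f \<in> L2_functions lborel"
  shows "(\<integral>\<^sup>+t. ennreal ((cmod (f t))\<^sup>2) \<partial>lborel) = ennreal ((norm (abs_l2 f))\<^sup>2)"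
  unfolding norm_abs_l2[OF assms] using assms
  by (intro nn_integral_eq_integral) (auto simp: L2_functions_def)

text \<open>Riesz-Fischer: a rapidly converging subsequence converges almost everywhere, and Fatou's
  lemma upgrades this to convergence in norm.\<close>

instance l2 :: banach
proof
  fix X :: "nat \<Rightarrow> l2" assume X: "Cauchy X"
  have "\<exists>N. \<forall>m\<ge>N. \<forall>n\<ge>N. norm (X m - X n) < (1/2) ^ k" for k
    using CauchyD[OF X, of "(1/2) ^ k"] by simp
  then have "\<forall>k. \<exists>N. \<forall>m\<ge>N. \<forall>n\<ge>N. norm (X m - X n) < (1/2) ^ k" by blast
  from choice[OF this] obtain N
    where N: "\<And>k m n. m \<ge> N k \<Longrightarrow> n \<ge> N k \<Longrightarrow> norm (X m - X n) < (1/2) ^ k" by blast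
  \<comment> \<open>The sum makes \<open>r k\<close> dominate \<open>N i\<close> for all i up to k,
    and the summand k makes r strictly increasing.\<close>
  define r where "r k = k + (\<Sum>i\<le>k. N i)" for k
  have r_mono: "strict_mono r" by (rule strict_monoI_Suc) (simp add: r_def)
  have r_N: "N k \<le> r l" if "k \<le> l" for k l
  proof -
    have "N k \<le> (\<Sum>i\<le>l. N i)" using that by (intro member_le_sum) auto
    then show ?thesis by (simp add: r_def)
  qed
  define Y where "Y = X \<circ> r"
  have Y: "norm (Y m - Y n) < (1/2) ^ k" if "k \<le> m" "k \<le> n" for k m n
    using N[OF r_N[OF that(1)] r_N[OF that(2)]] by (simp add: Y_def)
  define f where "f k = rep_l2 (Y k)" for k
  have fL2: "f k \<in> L2_functions lborel" and fY: "abs_l2 (f k) = Y k" for k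
    using Quotient_rep_reflp[OF Quotient_l2, of "Y k"] Quotient_abs_rep[OF Quotient_l2, of "Y k"]
    by (simp_all add: f_def l2_rel_refl)
  have [measurable]: "f k \<in> borel_measurable borel" for k
    using L2_functions_measurable[OF fL2[of k]] by simp
  define d where "d k t = cmod (f (Suc k) t - f k t)" for k t
  have d0: "0 \<le> d k t" for k t by (simp add: d_def)
  have [measurable]: "d k \<in> borel_measurable borel" for k
    unfolding d_def by measurable
  \<comment> \<open>\<open>G n\<close> adds up the absolute values of the first n steps of the
    subsequence. Its norm stays below the geometric sum 2, so by monotone convergence the pointwise
    supremum is finite almost everywhere.\<close>
  define G where "G n t = (\<Sum>k<n. d k t)" for n t
  have dL2: "(\<lambda>t. complex_of_real (d k t)) \<in> L2_functions lborel"
    and dn: "norm (abs_l2 (\<lambda>t. complex_of_real (d k t))) \<le> (1/2) ^ k" for k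
  proof -
    have D: "(\<lambda>t. f (Suc k) t - f k t) \<in> L2_functions lborel" by (intro L2_functions_diff fL2)
    then show dL: "(\<lambda>t. complex_of_real (d k t)) \<in> L2_functions lborel"
      by (auto simp: d_def L2_functions_def)
    have "(norm (abs_l2 (\<lambda>t. complex_of_real (d k t))))\<^sup>2 = (norm (Y (Suc k) - Y k))\<^sup>2"
      unfolding fY[symmetric] abs_l2_diff[OF fL2 fL2] norm_abs_l2[OF dL] norm_abs_l2[OF D]
      by (simp add: d_def)
    then have "norm (abs_l2 (\<lambda>t. complex_of_real (d k t))) = norm (Y (Suc k) - Y k)"
      by simp
    then show "norm (abs_l2 (\<lambda>t. complex_of_real (d k t))) \<le> (1/2) ^ k"
      using Y[of k "Suc k" k] by simp
  qed
  have GL2: "(\<lambda>t. complex_of_real (G n t)) \<in> L2_functions lborel \<and>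
      norm (abs_l2 (\<lambda>t. complex_of_real (G n t))) \<le> (\<Sum>k<n. (1/2) ^ k)" for n
  proof (induction n)
    case 0
    have "(norm (abs_l2 (\<lambda>t. 0)))\<^sup>2 = 0" using norm_abs_l2[OF L2_functions_zero] by simp
    then show ?case by (simp add: G_def L2_functions_zero)
  next
    case (Suc n)
    have eq: "(\<lambda>t. complex_of_real (G (Suc n) t)) = (\<lambda>t. complex_of_real (G n t) + complex_of_real (d n t))"
      by (simp add: G_def)
    have "abs_l2 (\<lambda>t. complex_of_real (G (Suc n) t))
        = abs_l2 (\<lambda>t. complex_of_real (G n t)) + abs_l2 (\<lambda>t. complex_of_real (d n t))"
      unfolding eq using Suc dL2 by (intro abs_l2_add[symmetric]) auto
    moreover have "(\<lambda>t. complex_of_real (G (Suc n) t)) \<in> L2_functions lborel"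
      unfolding eq using Suc dL2 by (intro L2_functions_add) auto
    moreover have "norm (abs_l2 (\<lambda>t. complex_of_real (G n t)) + abs_l2 (\<lambda>t. complex_of_real (d n t)))
        \<le> (\<Sum>k<n. (1/2) ^ k) + (1/2) ^ n"
      using Suc dn[of n] norm_triangle_ineq order_trans add_mono by meson
    ultimately show ?case by simp
  qed
  have Gint: "(\<integral>\<^sup>+t. ennreal ((G n t)\<^sup>2) \<partial>lborel) \<le> 4" for n
  proof -
    have "(\<Sum>k<n. (1/2::real) ^ k) = 2 - 2 * (1/2) ^ n"
      by (induction n) auto
    moreover have "0 \<le> (1/2::real) ^ n" by simp
    ultimately have "(\<Sum>k<n. (1/2::real) ^ k) \<le> 2" by linarith
    then have "norm (abs_l2 (\<lambda>t. complex_of_real (G n t))) \<le> 2" using GL2[of n] by linarith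
    then have "(norm (abs_l2 (\<lambda>t. complex_of_real (G n t))))\<^sup>2 \<le> 2\<^sup>2" by (intro power_mono) auto
    then have "ennreal ((norm (abs_l2 (\<lambda>t. complex_of_real (G n t))))\<^sup>2) \<le> ennreal 4"
      by (intro ennreal_leI) simp
    then show ?thesis
      using nn_integral_abs_l2[OF conjunct1[OF GL2[of n]]] by simp
  qed
  have G_mono: "G n t \<le> G (Suc n) t" and G0: "0 \<le> G n t" for n t
    by (simp_all add: G_def d0 sum_nonneg)
  have "(\<integral>\<^sup>+t. (SUP n. ennreal ((G n t)\<^sup>2)) \<partial>lborel) = (SUP n. \<integral>\<^sup>+t. ennreal ((G n t)\<^sup>2) \<partial>lborel)"
  proof (rule nn_integral_monotone_convergence_SUP)
    show "incseq (\<lambda>n t. ennreal ((G n t)\<^sup>2))"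
      by (intro incseq_SucI le_funI ennreal_leI power_mono G_mono G0)
    show "(\<lambda>t. ennreal ((G n t)\<^sup>2)) \<in> borel_measurable lborel" for n
      unfolding G_def by measurable
  qed
  also have "\<dots> \<le> 4" by (intro SUP_least Gint)
  finally have "(\<integral>\<^sup>+t. (SUP n. ennreal ((G n t)\<^sup>2)) \<partial>lborel) \<noteq> \<infinity>"
    by (auto simp: top_unique)
  then have fin: "AE t in lborel. (SUP n. ennreal ((G n t)\<^sup>2)) \<noteq> \<infinity>"
    by (intro nn_integral_PInf_AE) (simp_all add: G_def)
  \<comment> \<open>Where the supremum is finite, the telescoping series of differences converges
    absolutely.\<close>
  have conv: "AE t in lborel. convergent (\<lambda>k. f k t)"
    using fin
  proof eventually_elim
    case (elim t)
    then obtain B where B: "(SUP n. ennreal ((G n t)\<^sup>2)) = ennreal B" "0 \<le> B"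
      by (cases "SUP n. ennreal ((G n t)\<^sup>2)") auto
    have "summable (\<lambda>k. d k t)"
    proof (rule bounded_imp_summable[OF d0])
      fix n
      have "ennreal ((G (Suc n) t)\<^sup>2) \<le> ennreal B"
        unfolding B(1)[symmetric] by (rule SUP_upper) simp
      then have "(G (Suc n) t)\<^sup>2 \<le> B" using B(2) by simp
      then show "(\<Sum>k\<le>n. d k t) \<le> sqrt B"
        using real_le_rsqrt by (simp add: G_def lessThan_Suc_atMost)
    qed
    then have "summable (\<lambda>k. f (Suc k) t - f k t)"
      unfolding d_def by (rule summable_norm_cancel)
    then have "convergent (\<lambda>n. \<Sum>k<n. f (Suc k) t - f k t)" by (simp add: summable_iff_convergent)
    moreover have "(\<lambda>n. \<Sum>k<n. f (Suc k) t - f k t) = (\<lambda>n. f n t - f 0 t)"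
      using sum_lessThan_telescope[of "\<lambda>k. f k t"] by blast
    ultimately have "convergent (\<lambda>n. f n t - f 0 t)" by simp
    then have "convergent (\<lambda>n. (f n t - f 0 t) + f 0 t)"
      by (intro convergent_add convergent_const)
    then show ?case by simp
  qed
  define h where "h t = lim (\<lambda>k. f k t)" for t
  have [measurable]: "h \<in> borel_measurable borel"
    unfolding h_def by measurable
  have fh: "AE t in lborel. (\<lambda>k. f k t) \<longlonglongrightarrow> h t"
    using conv by eventually_elim (simp add: h_def convergent_LIMSEQ_iff)
  \<comment> \<open>Fatou's lemma is applied in j with k fixed: \<open>f j\<close> tends to h almost
    everywhere, while \<open>Y j\<close> stays within (1/2)^k of \<open>Y k\<close>.\<close>
  have Fatou: "(\<integral>\<^sup>+t. ennreal ((cmod (h t - f k t))\<^sup>2) \<partial>lborel) \<le> ennreal (((1/2) ^ k)\<^sup>2)" for k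
  proof -
    have "(\<integral>\<^sup>+t. ennreal ((cmod (h t - f k t))\<^sup>2) \<partial>lborel)
        = (\<integral>\<^sup>+t. liminf (\<lambda>j. ennreal ((cmod (f j t - f k t))\<^sup>2)) \<partial>lborel)"
    proof (rule nn_integral_cong_AE, use fh in eventually_elim)
      fix t assume "(\<lambda>j. f j t) \<longlonglongrightarrow> h t"
      then have "(\<lambda>j. ennreal ((cmod (f j t - f k t))\<^sup>2)) \<longlonglongrightarrow> ennreal ((cmod (h t - f k t))\<^sup>2)"
        by (intro tendsto_intros tendsto_ennrealI)
      then show "ennreal ((cmod (h t - f k t))\<^sup>2) = liminf (\<lambda>j. ennreal ((cmod (f j t - f k t))\<^sup>2))"
        by (intro lim_imp_Liminf[symmetric]) auto
    qed
    also have "\<dots> \<le> liminf (\<lambda>j. \<integral>\<^sup>+t. ennreal ((cmod (f j t - f k t))\<^sup>2) \<partial>lborel)"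
      by (intro nn_integral_liminf) measurable
    also have "\<dots> \<le> ennreal (((1/2) ^ k)\<^sup>2)"
    proof (rule Liminf_le)
      show "\<forall>\<^sub>F j in sequentially. (\<integral>\<^sup>+t. ennreal ((cmod (f j t - f k t))\<^sup>2) \<partial>lborel) \<le> ennreal (((1/2) ^ k)\<^sup>2)"
        using eventually_ge_at_top[of k]
      proof eventually_elim
        case (elim j)
        have "(\<integral>\<^sup>+t. ennreal ((cmod (f j t - f k t))\<^sup>2) \<partial>lborel) = ennreal ((norm (Y j - Y k))\<^sup>2)"
          unfolding fY[symmetric] abs_l2_diff[OF fL2 fL2]
          by (rule nn_integral_abs_l2[OF L2_functions_diff[OF fL2 fL2]])
        also have "\<dots> \<le> ennreal (((1/2) ^ k)\<^sup>2)"
          using Y[of k j k] elim by (intro ennreal_leI power_mono) auto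
        finally show ?case .
      qed
    qed simp
    finally show ?thesis .
  qed
  have hf: "(\<lambda>t. h t - f k t) \<in> L2_functions lborel" for k
  proof -
    have "(\<integral>\<^sup>+t. ennreal ((cmod (h t - f k t))\<^sup>2) \<partial>lborel) < \<infinity>"
      using Fatou[of k] by (rule order_le_less_trans) simp
    then have "integrable lborel (\<lambda>t. (cmod (h t - f k t))\<^sup>2)"
      by (intro integrableI_bounded) auto
    then show ?thesis by (simp add: L2_functions_def)
  qed
  have hL2: "h \<in> L2_functions lborel"
    using L2_functions_add[OF hf[of 0] fL2[of 0]] by simp
  have dist: "norm (Y k - abs_l2 h) \<le> (1/2) ^ k" for k
  proof -
    have "ennreal ((norm (abs_l2 h - Y k))\<^sup>2) \<le> ennreal (((1/2) ^ k)\<^sup>2)"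
      unfolding fY[symmetric] abs_l2_diff[OF hL2 fL2] nn_integral_abs_l2[OF hf, symmetric]
      by (rule Fatou)
    then have "(norm (abs_l2 h - Y k))\<^sup>2 \<le> ((1/2) ^ k)\<^sup>2"
      by (subst (asm) ennreal_le_iff) simp_all
    then show ?thesis
      by (subst norm_minus_commute) (rule power2_le_imp_le, simp_all)
  qed
  have "Y \<longlonglongrightarrow> abs_l2 h"
    by (rule LIM_zero_cancel, rule Lim_null_comparison[OF _ LIMSEQ_realpow_zero[of "1/2"]])
      (use dist in auto)
  then have "(X \<circ> r) \<longlonglongrightarrow> abs_l2 h" by (simp add: Y_def)
  from Cauchy_converges_subseq[OF X r_mono this] show "convergent X"
    by (auto simp: convergent_def)
qed

instantiation l2 :: complex_hilbert
begin

lift_definition scaleC_l2 :: "complex \<Rightarrow> l2 \<Rightarrow> l2" is "\<lambda>c f t. c * f t"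
  unfolding l2_rel_def by (auto intro: L2_functions_scale)

definition cinner_l2 :: "l2 \<Rightarrow> l2 \<Rightarrow> complex" where "cinner_l2 = l2_cinner"

instance
proof
  fix x y z :: l2 and r :: real and c d :: complex
  show "r *\<^sub>R x = complex_of_real r *\<^sub>C x"
    by transfer (auto simp: l2_rel_refl intro: L2_functions_scale)
  show "c *\<^sub>C (x + y) = c *\<^sub>C x + c *\<^sub>C y"
    by transfer (auto simp: l2_rel_def distrib_left intro!: L2_functions_add L2_functions_scale)
  show "(c + d) *\<^sub>C x = c *\<^sub>C x + d *\<^sub>C x"
    by transfer (auto simp: l2_rel_def distrib_right intro!: L2_functions_add L2_functions_scale)
  show "c *\<^sub>C (d *\<^sub>C x) = (c * d) *\<^sub>C x"
    by transfer (auto simp: l2_rel_def mult.assoc intro!: L2_functions_scale)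
  show "1 *\<^sub>C x = x"
    by transfer (auto simp: l2_rel_def)
  show "cinner x y = cnj (cinner y x)"
    unfolding cinner_l2_def by (rule l2_cinner_commute)
  show "cinner (x + y) z = cinner x z + cinner y z"
    unfolding cinner_l2_def by (rule l2_cinner_add_left)
  show "cinner (c *\<^sub>C x) y = c * cinner x y"
    unfolding cinner_l2_def by transfer (simp add: mult.assoc)
  show "cinner x x = complex_of_real ((norm x)\<^sup>2)"
    using l2_cinner_self[of x] by (simp add: cinner_l2_def norm_l2_def inner_l2_def)
qed

end

lemma cinner_abs_l2: "f \<in> L2_functions lborel \<Longrightarrow> g \<in> L2_functions lborel \<Longrightarrow>
    cinner (abs_l2 f) (abs_l2 g) = (LINT t|lborel. f t * cnj (g t))"
  by (simp add: cinner_l2_def l2_cinner.abs_eq l2_rel_refl)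

lemma scaleC_abs_l2: "f \<in> L2_functions lborel \<Longrightarrow> c *\<^sub>C abs_l2 f = abs_l2 (\<lambda>t. c * f t)"
  by (simp add: scaleC_l2.abs_eq l2_rel_refl)

section \<open>Separability and infinite dimension of the space of square-integrable
  functions\<close>

definition l2_interval :: "real \<Rightarrow> real \<Rightarrow> l2" where
  "l2_interval a b = abs_l2 (indicator {a<..b})"

lemma indicator_L2_functions: "indicator {a<..b::real} \<in> L2_functions lborel"
proof -
  have "integrable lborel (indicator {a<..b} :: real \<Rightarrow> real)"
    by (intro integrable_real_indicator emeasure_bounded_finite
        bounded_subset[OF bounded_closed_interval[of a b]]) auto
  moreover have "(\<lambda>t. (cmod (indicator {a<..b} t))\<^sup>2) = indicat_real {a<..b}"
    by (auto simp: indicator_def)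
  ultimately show ?thesis by (simp add: L2_functions_def)
qed

lemma cinner_l2_interval:
  "f \<in> L2_functions lborel \<Longrightarrow>
    cinner (abs_l2 f) (l2_interval a b) = (LINT t|lborel. indicator {a<..b} t * f t)"
  unfolding l2_interval_def
  by (subst cinner_abs_l2)
    (auto simp: indicator_L2_functions indicator_def intro!: Bochner_Integration.integral_cong)

text \<open>On each (-N, N] the function f is integrable, and cutting this interval by a rational
  half-line gives a rational interval again, possibly empty. So the half-line criterion applies on
  each of them.\<close>

lemma total_l2_intervals: "total_family ((\<lambda>(a, b). l2_interval a b) ` (\<rat> \<times> \<rat>))"
  unfolding total_family_def
proof (intro allI impI)
  fix x :: l2
  assume *: "\<forall>d\<in>(\<lambda>(a, b). l2_interval a b) ` (\<rat> \<times> \<rat>). cinner x d = 0"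
  obtain f where f: "f \<in> L2_functions lborel" and x: "abs_l2 f = x" by (rule abs_l2_surj)
  have zero: "(LINT t|lborel. indicator {a<..b} t * f t) = 0" if "a \<in> \<rat>" "b \<in> \<rat>" for a b
    using * that cinner_l2_interval[OF f, of a b] by (auto simp: x)
  have "AE t in lborel. indicator {- real N<..real N} t * f t = 0" for N
  proof (rule AE_zero_if_integral_half_lines_zero)
    show "integrable lborel (\<lambda>t. indicator {- real N<..real N} t * f t)"
      using L2_functions_integrable_mult[OF f indicator_L2_functions[of "- real N" "real N"]]
      by (rule Bochner_Integration.integrable_cong[THEN iffD1, rotated -1]) (auto simp: indicator_def)
    fix q :: real assume "q \<in> \<rat>"
    then have "max q (- real N) \<in> \<rat>" by (simp add: max_def)
    then have "(LINT t|lborel. indicator {max q (- real N)<..real N} t * f t) = 0"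
      by (intro zero) auto
    also have "(\<lambda>t. indicator {max q (- real N)<..real N} t * f t)
        = (\<lambda>t. indicator {q<..} t * (indicator {- real N<..real N} t * f t))"
      by (auto simp: indicator_def)
    finally show "(LINT t|lborel. indicator {q<..} t * (indicator {- real N<..real N} t * f t)) = 0" .
  qed simp
  then have "AE t in lborel. \<forall>N. indicator {- real N<..real N} t * f t = 0"
    unfolding AE_all_countable by blast
  then have "AE t in lborel. f t = 0"
  proof eventually_elim
    case (elim t)
    obtain N where "\<bar>t\<bar> < real N" using reals_Archimedean2 by blast
    then show ?case using elim[rule_format, of N] by (auto simp: indicator_def)
  qed
  then have "abs_l2 f = abs_l2 (\<lambda>t. 0)"
    by (simp add: abs_l2_eq_iff f L2_functions_zero)
  then show "x = 0" by (simp add: x zero_l2.abs_eq)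
qed

text \<open>The indicators of (k, k + 1] form an infinite orthonormal set. Extending it keeps it
  infinite, and the countable total family of rational intervals forces the extension to be
  countable.\<close>

lemma l2_orthonormal_basis: obtains e :: "nat \<Rightarrow> l2" where "orthonormal_basis e"
proof -
  define u where "u k = l2_interval (real k) (real (Suc k))" for k
  have u: "cinner (u j) (u k) = (if j = k then 1 else 0)" for j k
  proof -
    have "cinner (u j) (u k) = (LINT t|lborel. indicator {real k<..real (Suc k)} t
        * indicator {real j<..real (Suc j)} t)"
      unfolding u_def by (subst (1) l2_interval_def) (rule cinner_l2_interval[OF indicator_L2_functions])
    also have "\<dots> = (LINT t|lborel. complex_of_real ((if j = k then 1 else 0) * indicator {real k<..real (Suc k)} t))"
      by (intro Bochner_Integration.integral_cong) (auto simp: indicator_def)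
    also have "\<dots> = (if j = k then 1 else 0)"
      by simp
    finally show ?thesis .
  qed
  have "inj u"
  proof (rule injI)
    fix j k assume "u j = u k"
    then have "cinner (u j) (u k) = 1" using u[of j j] by simp
    then show "j = k" using u[of j k] by (auto split: if_splits)
  qed
  have "orthonormal (range u)"
    by (auto simp: orthonormal_def u inj_eq[OF \<open>inj u\<close>])
  then obtain E where E: "range u \<subseteq> E" "orthonormal E" "total_family E"
    by (rule orthonormal_extend_total)
  have "infinite E"
    using E(1) \<open>inj u\<close> finite_subset range_inj_infinite by blast
  moreover have "countable ((\<lambda>(a, b). l2_interval a b) ` (\<rat> \<times> \<rat>))"
    by (intro countable_image countable_SIGMA countable_rat)
  then have "countable E"
    using total_l2_intervals E(2) by (rule countable_orthonormal)
  ultimately show ?thesis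
    using E that orthonormal_basis_from_set by blast
qed

lemma exists_l2_unitary:
  assumes separable: "\<exists>D::'a::complex_hilbert set. countable D \<and> closure D = UNIV"
    and infinite_dimensional: "\<not> (\<exists>B::'a set. finite B \<and> module.span scaleC B = UNIV)"
  obtains V :: "l2 \<Rightarrow> 'a::complex_hilbert" where "\<And>x y. V (x + y) = V x + V y" "\<And>c x. V (c *\<^sub>C x) = c *\<^sub>C V x"
    "\<And>x y. cinner (V x) (V y) = cinner x y" "surj V"
proof -
  obtain D :: "'a set" where D: "countable D" "closure D = UNIV" using separable by blast
  obtain E :: "'a set" where E: "orthonormal E" "total_family E"
    using orthonormal_extend_total[of "{}"] by (auto simp: orthonormal_def)
  have "countable E"
    using countable_orthonormal[OF D(1) total_if_dense[OF D(2)] E(1)] .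
  moreover have "infinite E"
    using total_finite_orthonormal_spans E infinite_dimensional by blast
  ultimately have "orthonormal_basis (from_nat_into E)"
    using E by (intro orthonormal_basis_from_set)
  moreover obtain e :: "nat \<Rightarrow> l2" where "orthonormal_basis e" by (rule l2_orthonormal_basis)
  ultimately show ?thesis using orthonormal_basis_unitary that by blast
qed

section \<open>Multiplication operators\<close>

lemma bounded_operatorsI:
  assumes "\<And>x y. A (x + y) = A x + A y" "\<And>c x. A (c *\<^sub>C x) = c *\<^sub>C A x"
    "\<And>x. norm (A x) \<le> B * norm x"
  shows "A \<in> bounded_operators"
proof -
  have "bounded_linear A"
    by (rule bounded_linear_intro[where K = B]) (use assms in \<open>auto simp: scaleR_scaleC mult.commute\<close>)
  then show ?thesis using assms(2) by (simp add: bounded_operators_def)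
qed

lemma bounded_operators_linear: "A \<in> bounded_operators \<Longrightarrow> bounded_linear A"
  by (simp add: bounded_operators_def)

lemma bounded_operators_scaleC: "A \<in> bounded_operators \<Longrightarrow> A (c *\<^sub>C x) = c *\<^sub>C A x"
  by (simp add: bounded_operators_def)

text \<open>Adjoints are always exhibited explicitly, so only uniqueness is at stake; it holds
  because the inner product separates vectors.\<close>

lemma adjoint_operator_eqI:
  assumes "\<And>x y. cinner (A x) y = cinner x (B y)"
  shows "adjoint_operator A = B"
  unfolding adjoint_operator_def
proof (rule the_equality)
  fix C assume C: "\<forall>x y. cinner (A x) y = cinner x (C y)"
  show "C = B"
  proof
    fix y
    have "cinner (C y) z = cinner (B y) z" for z
      using C assms[of z y] cinner_commute[of "C y" z] cinner_commute[of "B y" z] by simp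
    then show "C y = B y" by (rule eq_if_cinner_eq)
  qed
qed (use assms in auto)

lemma bounded_operators_funpow:
  assumes "A \<in> bounded_operators"
  shows "A ^^ i \<in> bounded_operators"
proof (induction i)
  case 0
  show ?case by (simp add: bounded_operators_def id_def)
next
  case (Suc i)
  have "bounded_linear (\<lambda>x. A ((A ^^ i) x))"
    using bounded_linear_compose[OF bounded_operators_linear[OF assms] bounded_operators_linear[OF Suc]] .
  then show ?case using Suc assms by (simp add: bounded_operators_def o_def)
qed

lemma poly_operator_bounded_operators:
  assumes "A \<in> bounded_operators"
  shows "poly_operator p A \<in> bounded_operators"
proof -
  note A = bounded_operators_funpow[OF assms]
  have "bounded_linear (\<lambda>x. \<Sum>i\<le>degree p. coeff p i *\<^sub>C (A ^^ i) x)"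
    using A by (intro bounded_linear_sum bounded_linear_compose[OF bounded_linear_scaleC_right]
      bounded_operators_linear)
  then show ?thesis
    by (simp add: poly_operator_def bounded_operators_def bounded_operators_scaleC[OF A]
        scaleC.scale_sum_right scaleC_scaleC mult.commute)
qed

text \<open>In the square root argument Q commutes with its own square, hence with all polynomials
  in it.\<close>

lemma poly_operator_commute:
  assumes "Q \<in> bounded_operators" "\<And>x. Q (A x) = A (Q x)"
  shows "Q (poly_operator p A x) = poly_operator p A (Q x)"
proof -
  have "Q ((A ^^ i) x) = (A ^^ i) (Q x)" for i
    by (induction i) (auto simp: assms(2))
  then show ?thesis
    unfolding poly_operator_def
    by (simp add: linear_sum[OF bounded_linear.linear[OF bounded_operators_linear[OF assms(1)]]]
        bounded_operators_scaleC[OF assms(1)])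
qed

section \<open>Weierstrass approximation of complex functions on a compact set of reals\<close>

lemma poly_sum_monom:
  "poly (\<Sum>i\<le>n. monom (c i) i) z = (\<Sum>i\<le>n. c i * (z :: complex) ^ i)"
  by (simp add: poly_sum poly_monom)

text \<open>Real and imaginary part are approximated separately and recombined. Since the argument
  is real, polynomials with complex coefficients suffice and no conjugates enter.\<close>

lemma complex_polynomial_approximation:
  fixes f :: "real \<Rightarrow> complex"
  assumes K: "compact K" and f: "continuous_on K f" and e: "0 < e"
  obtains p where "\<And>t. t \<in> K \<Longrightarrow> cmod (poly p (complex_of_real t) - f t) < e"
proof -
  have "continuous_on K (\<lambda>t. Re (f t))" "continuous_on K (\<lambda>t. Im (f t))"
    using f by (auto intro: continuous_intros)
  from Stone_Weierstrass_real_polynomial_function[OF K this(1), of "e / 2"]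
    Stone_Weierstrass_real_polynomial_function[OF K this(2), of "e / 2"] e
  obtain u v where u: "real_polynomial_function u" "\<And>t. t \<in> K \<Longrightarrow> \<bar>Re (f t) - u t\<bar> < e / 2"
    and v: "real_polynomial_function v" "\<And>t. t \<in> K \<Longrightarrow> \<bar>Im (f t) - v t\<bar> < e / 2"
    by (metis half_gt_zero)
  obtain a m where a: "u = (\<lambda>t. \<Sum>i\<le>m. a i * t ^ i)"
    using u(1) unfolding real_polynomial_function_iff_sum by blast
  obtain b n where b: "v = (\<lambda>t. \<Sum>i\<le>n. b i * t ^ i)"
    using v(1) unfolding real_polynomial_function_iff_sum by blast
  define p where "p = (\<Sum>i\<le>m. monom (complex_of_real (a i)) i)
    + smult \<i> (\<Sum>i\<le>n. monom (complex_of_real (b i)) i)"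
  have p: "poly p (complex_of_real t) = Complex (u t) (v t)" for t
    unfolding p_def poly_add poly_smult poly_sum_monom a b
    by (simp add: complex_eq_iff flip: of_real_power of_real_mult of_real_sum)
  have "cmod (poly p (complex_of_real t) - f t) < e" if t: "t \<in> K" for t
  proof -
    have "cmod (poly p (complex_of_real t) - f t) \<le> \<bar>u t - Re (f t)\<bar> + \<bar>v t - Im (f t)\<bar>"
      using cmod_le[of "poly p (complex_of_real t) - f t"] by (simp add: p)
    also have "\<dots> < e" using u(2)[OF t] v(2)[OF t] by linarith
    finally show ?thesis .
  qed
  then show ?thesis by (rule that)
qed

lemma complex_Weierstrass:
  fixes f :: "real \<Rightarrow> complex"
  assumes K: "compact K" and f: "continuous_on K f"
  obtains p where "uniform_limit K (\<lambda>k t. poly (p k) (complex_of_real t)) f sequentially"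
proof -
  have "\<exists>p. \<forall>t\<in>K. cmod (poly p (complex_of_real t) - f t) < inverse (real (Suc k))" for k
    by (rule complex_polynomial_approximation[OF K f, of "inverse (real (Suc k))"]) auto
  then have "\<forall>k. \<exists>p. \<forall>t\<in>K. cmod (poly p (complex_of_real t) - f t) < inverse (real (Suc k))"
    by blast
  from choice[OF this] obtain p
    where p: "\<And>k t. t \<in> K \<Longrightarrow> cmod (poly (p k) (complex_of_real t) - f t) < inverse (real (Suc k))"
    by blast
  have "uniform_limit K (\<lambda>k t. poly (p k) (complex_of_real t)) f sequentially"
    unfolding uniform_limit_iff
  proof (intro allI impI)
    fix e :: real assume "0 < e"
    then obtain N where N: "inverse (real (Suc N)) < e" using reals_Archimedean by blast
    show "\<forall>\<^sub>F k in sequentially. \<forall>t\<in>K. dist (poly (p k) (complex_of_real t)) (f t) < e"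
      using eventually_ge_at_top[of N]
    proof eventually_elim
      case (elim k)
      then have "inverse (real (Suc k)) \<le> inverse (real (Suc N))" by simp
      then have "inverse (real (Suc k)) < e" using N by (rule order_le_less_trans)
      then show ?case
        unfolding dist_norm using p order_less_trans by blast
    qed
  qed
  then show ?thesis by (rule that)
qed

text \<open>A model of the Hilbert space as L^2(M). W acts on functions instead of equivalence
  classes, so it is injective only up to null sets. The space stays fixed while M varies, which
  allows several models of it at once.\<close>

locale L2_unitary =
  fixes M :: "real measure" and W :: "(real \<Rightarrow> complex) \<Rightarrow> 'a::complex_hilbert"
  assumes sets_M: "sets M = sets borel"
    and W_add: "\<And>g h. g \<in> L2_functions M \<Longrightarrow> h \<in> L2_functions M \<Longrightarrow> W (\<lambda>t. g t + h t) = W g + W h"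
    and W_scale: "\<And>c g. g \<in> L2_functions M \<Longrightarrow> W (\<lambda>t. c * g t) = c *\<^sub>C W g"
    and W_inner: "\<And>g h. g \<in> L2_functions M \<Longrightarrow> h \<in> L2_functions M \<Longrightarrow>
      cinner (W g) (W h) = (LINT t|M. g t * cnj (h t))"
    and W_surj: "W ` L2_functions M = UNIV"
begin

lemma measurable_M: "borel_measurable M = borel_measurable borel"
  by (rule measurable_cong_sets[OF sets_M refl])

lemma L2_borel: "g \<in> L2_functions M \<Longrightarrow> g \<in> borel_measurable borel"
  using L2_functions_measurable[of g M] by (simp add: measurable_M)

lemma W_cases: obtains g where "g \<in> L2_functions M" "x = W g"
proof -
  have "x \<in> W ` L2_functions M" by (simp add: W_surj)
  then show ?thesis using that by blast
qed

lemma W_diff: "g \<in> L2_functions M \<Longrightarrow> h \<in> L2_functions M \<Longrightarrow> W (\<lambda>t. g t - h t) = W g - W h"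
  using W_add[of g "\<lambda>t. - 1 * h t"] W_scale[of h "- 1"] L2_functions_scale[of h M "- 1"]
  by (simp add: scaleC.scale_minus_left)

lemma W_zero: "W (\<lambda>t. 0) = 0"
  using W_scale[OF L2_functions_zero, of 0] by simp

lemma W_sum: "finite I \<Longrightarrow> (\<And>i. i \<in> I \<Longrightarrow> f i \<in> L2_functions M) \<Longrightarrow>
    (\<lambda>t. \<Sum>i\<in>I. f i t) \<in> L2_functions M \<and> W (\<lambda>t. \<Sum>i\<in>I. f i t) = (\<Sum>i\<in>I. W (f i))"
  by (induction I rule: finite_induct)
    (auto simp: W_zero L2_functions_zero W_add intro!: L2_functions_add)

lemma W_norm: "g \<in> L2_functions M \<Longrightarrow> (norm (W g))\<^sup>2 = (LINT t|M. (cmod (g t))\<^sup>2)"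
  by (simp add: norm_sq_cinner W_inner integral_mult_cnj_self)

lemma W_eq_0_iff: "g \<in> L2_functions M \<Longrightarrow> W g = 0 \<longleftrightarrow> (AE t in M. g t = 0)"
proof -
  assume g: "g \<in> L2_functions M"
  have "W g = 0 \<longleftrightarrow> (norm (W g))\<^sup>2 = 0" by simp
  also have "\<dots> \<longleftrightarrow> (AE t in M. g t = 0)"
    unfolding W_norm[OF g] using g
    by (subst integral_nonneg_eq_0_iff_AE) (auto simp: L2_functions_def)
  finally show ?thesis .
qed

lemma W_eq_iff: "g \<in> L2_functions M \<Longrightarrow> h \<in> L2_functions M \<Longrightarrow> W g = W h \<longleftrightarrow> (AE t in M. g t = h t)"
  using W_eq_0_iff[of "\<lambda>t. g t - h t"] by (simp add: W_diff L2_functions_diff)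

lemma W_norm_le:
  assumes g: "g \<in> L2_functions M" and h: "h \<in> L2_functions M" and B: "0 \<le> B"
    and le: "AE t in M. cmod (g t) \<le> B * cmod (h t)"
  shows "norm (W g) \<le> B * norm (W h)"
proof (rule power2_le_imp_le)
  have "(norm (W g))\<^sup>2 \<le> (LINT t|M. B\<^sup>2 * (cmod (h t))\<^sup>2)"
    unfolding W_norm[OF g]
  proof (rule integral_mono_AE)
    show "AE t in M. (cmod (g t))\<^sup>2 \<le> B\<^sup>2 * (cmod (h t))\<^sup>2"
      using le
    proof eventually_elim
      case (elim t)
      then show ?case using power_mono[OF elim, of 2] by (simp add: power_mult_distrib)
    qed
  qed (use g h in \<open>auto simp: L2_functions_def\<close>)
  then show "(norm (W g))\<^sup>2 \<le> (B * norm (W h))\<^sup>2"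
    by (simp add: power_mult_distrib W_norm[OF h])
qed (simp add: B)

text \<open>By \<open>rep_W\<close> the choice is determined almost everywhere, so operators defined
  through it do not depend on it.\<close>

definition rep :: "'a \<Rightarrow> real \<Rightarrow> complex" where
  "rep x = (SOME g. g \<in> L2_functions M \<and> W g = x)"

lemma rep: "rep x \<in> L2_functions M" "W (rep x) = x"
proof -
  obtain g where "g \<in> L2_functions M" "x = W g" by (rule W_cases)
  then have "\<exists>g. g \<in> L2_functions M \<and> W g = x" by blast
  from someI_ex[OF this] show "rep x \<in> L2_functions M" "W (rep x) = x"
    unfolding rep_def by simp_all
qed

lemma rep_W: "g \<in> L2_functions M \<Longrightarrow> AE t in M. rep (W g) t = g t"
  using W_eq_iff[of "rep (W g)" g] rep by simp

definition mult_op :: "(real \<Rightarrow> complex) \<Rightarrow> 'a \<Rightarrow> 'a" where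
  "mult_op \<phi> x = W (\<lambda>t. \<phi> t * rep x t)"

text \<open>The bound is a parameter because it also bounds the operator, see
  \<open>mult_op_norm\<close>. It is required almost everywhere only, so functions bounded just on
  the spectrum qualify.\<close>

definition ess_bounded :: "(real \<Rightarrow> complex) \<Rightarrow> real \<Rightarrow> bool" where
  "ess_bounded \<phi> B \<longleftrightarrow> \<phi> \<in> borel_measurable borel \<and> 0 \<le> B \<and> (AE t in M. cmod (\<phi> t) \<le> B)"

lemma L2_mult: "ess_bounded \<phi> B \<Longrightarrow> g \<in> L2_functions M \<Longrightarrow> (\<lambda>t. \<phi> t * g t) \<in> L2_functions M"
  by (rule L2_functions_mult_bounded) (auto simp: ess_bounded_def measurable_M)

lemma mult_op_W:
  assumes "ess_bounded \<phi> B" "g \<in> L2_functions M"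
  shows "mult_op \<phi> (W g) = W (\<lambda>t. \<phi> t * g t)"
  unfolding mult_op_def
proof (subst W_eq_iff)
  show "AE t in M. \<phi> t * rep (W g) t = \<phi> t * g t"
    using rep_W[OF assms(2)] by eventually_elim simp
qed (use assms rep L2_mult in auto)

lemma mult_op_norm: "ess_bounded \<phi> B \<Longrightarrow> norm (mult_op \<phi> x) \<le> B * norm x"
proof -
  assume \<phi>: "ess_bounded \<phi> B"
  obtain g where g: "g \<in> L2_functions M" "x = W g" by (rule W_cases)
  show ?thesis
    unfolding g(2) mult_op_W[OF \<phi> g(1)]
  proof (rule W_norm_le[OF L2_mult[OF \<phi> g(1)] g(1)])
    show "AE t in M. cmod (\<phi> t * g t) \<le> B * cmod (g t)"
      using \<phi> unfolding ess_bounded_def norm_mult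
      by (auto elim!: eventually_mono mult_right_mono)
  qed (use \<phi> in \<open>auto simp: ess_bounded_def\<close>)
qed

lemma mult_op_bounded: "ess_bounded \<phi> B \<Longrightarrow> mult_op \<phi> \<in> bounded_operators"
proof (rule bounded_operatorsI)
  assume \<phi>: "ess_bounded \<phi> B"
  show "norm (mult_op \<phi> x) \<le> B * norm x" for x using mult_op_norm[OF \<phi>] .
  show "mult_op \<phi> (x + y) = mult_op \<phi> x + mult_op \<phi> y" for x y
  proof -
    obtain g where g: "g \<in> L2_functions M" "x = W g" by (rule W_cases)
    obtain h where h: "h \<in> L2_functions M" "y = W h" by (rule W_cases)
    have "mult_op \<phi> (x + y) = W (\<lambda>t. \<phi> t * g t + \<phi> t * h t)"
      unfolding g h W_add[OF g(1) h(1), symmetric]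
      by (subst mult_op_W[OF \<phi>]) (auto simp: distrib_left g h L2_functions_add)
    then show ?thesis
      unfolding g h mult_op_W[OF \<phi> g(1)] mult_op_W[OF \<phi> h(1)]
      by (simp add: W_add L2_mult[OF \<phi>] g h)
  qed
  show "mult_op \<phi> (c *\<^sub>C x) = c *\<^sub>C mult_op \<phi> x" for c x
  proof -
    obtain g where g: "g \<in> L2_functions M" "x = W g" by (rule W_cases)
    have "mult_op \<phi> (c *\<^sub>C x) = W (\<lambda>t. c * (\<phi> t * g t))"
      unfolding g(2) W_scale[OF g(1), symmetric]
      by (subst mult_op_W[OF \<phi>]) (auto simp: L2_functions_scale g mult.left_commute)
    then show ?thesis
      unfolding g mult_op_W[OF \<phi> g(1)] by (simp add: W_scale L2_mult[OF \<phi>] g)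
  qed
qed

lemma operator_eqI:
  assumes "\<And>g. g \<in> L2_functions M \<Longrightarrow> A (W g) = B (W g)"
  shows "A = B"
proof
  fix x
  obtain g where g: "g \<in> L2_functions M" "x = W g" by (rule W_cases)
  show "A x = B x" unfolding g(2) by (rule assms[OF g(1)])
qed

lemma ess_bounded_mult:
  assumes "ess_bounded \<phi> B" "ess_bounded \<psi> C"
  shows "ess_bounded (\<lambda>t. \<phi> t * \<psi> t) (B * C)"
proof -
  have "AE t in M. cmod (\<phi> t) \<le> B" "AE t in M. cmod (\<psi> t) \<le> C" "0 \<le> B"
    using assms by (simp_all add: ess_bounded_def)
  from this(1,2) have "AE t in M. cmod (\<phi> t * \<psi> t) \<le> B * C"
    by eventually_elim (use \<open>0 \<le> B\<close> in \<open>simp add: norm_mult mult_mono\<close>)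
  then show ?thesis using assms by (auto simp: ess_bounded_def)
qed

lemma ess_bounded_diff:
  assumes "ess_bounded \<phi> B" "ess_bounded \<psi> C"
  shows "ess_bounded (\<lambda>t. \<phi> t - \<psi> t) (B + C)"
proof -
  have "AE t in M. cmod (\<phi> t) \<le> B" "AE t in M. cmod (\<psi> t) \<le> C"
    using assms by (simp_all add: ess_bounded_def)
  then have "AE t in M. cmod (\<phi> t - \<psi> t) \<le> B + C"
    by eventually_elim (rule order_trans[OF norm_triangle_ineq4 add_mono])
  then show ?thesis using assms by (auto simp: ess_bounded_def)
qed

lemma ess_bounded_const: "ess_bounded (\<lambda>t. c) (cmod c)"
  by (simp add: ess_bounded_def)

lemma ess_bounded_cnj: "ess_bounded \<phi> B \<Longrightarrow> ess_bounded (\<lambda>t. cnj (\<phi> t)) B"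
  by (auto simp: ess_bounded_def intro: borel_measurable_cnj)

lemma ess_bounded_power: "ess_bounded \<phi> B \<Longrightarrow> ess_bounded (\<lambda>t. \<phi> t ^ i) (B ^ i)"
proof (induction i)
  case 0
  show ?case using ess_bounded_const[of 1] by simp
next
  case (Suc i)
  then show ?case using ess_bounded_mult[of \<phi> B "\<lambda>t. \<phi> t ^ i"] by simp
qed

lemma mult_op_mult_op:
  assumes \<phi>: "ess_bounded \<phi> B" and \<psi>: "ess_bounded \<psi> C"
  shows "mult_op \<phi> \<circ> mult_op \<psi> = mult_op (\<lambda>t. \<phi> t * \<psi> t)"
proof (rule operator_eqI)
  fix g assume g: "g \<in> L2_functions M"
  show "(mult_op \<phi> \<circ> mult_op \<psi>) (W g) = mult_op (\<lambda>t. \<phi> t * \<psi> t) (W g)"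
    using mult_op_W[OF \<phi> L2_mult[OF \<psi> g]] mult_op_W[OF ess_bounded_mult[OF \<phi> \<psi>] g]
    by (simp add: mult_op_W[OF \<psi> g] mult.assoc)
qed

lemma mult_op_diff:
  assumes \<phi>: "ess_bounded \<phi> B" and \<psi>: "ess_bounded \<psi> C"
  shows "mult_op \<phi> x - mult_op \<psi> x = mult_op (\<lambda>t. \<phi> t - \<psi> t) x"
proof -
  obtain g where g: "g \<in> L2_functions M" "x = W g" by (rule W_cases)
  have "mult_op (\<lambda>t. \<phi> t - \<psi> t) x = W (\<lambda>t. \<phi> t * g t - \<psi> t * g t)"
    unfolding g(2) mult_op_W[OF ess_bounded_diff[OF \<phi> \<psi>] g(1)] by (simp add: left_diff_distrib)
  then show ?thesis
    unfolding g(2) mult_op_W[OF \<phi> g(1)] mult_op_W[OF \<psi> g(1)]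
    by (simp add: W_diff L2_mult[OF \<phi>] L2_mult[OF \<psi>] g)
qed

lemma mult_op_const: "mult_op (\<lambda>t. c) x = c *\<^sub>C x"
  using mult_op_W[OF ess_bounded_const rep(1)] W_scale[OF rep(1)] rep(2) by simp

lemma mult_op_cong_AE:
  assumes \<phi>: "ess_bounded \<phi> B" and \<psi>: "ess_bounded \<psi> C" and eq: "AE t in M. \<phi> t = \<psi> t"
  shows "mult_op \<phi> = mult_op \<psi>"
proof (rule operator_eqI)
  fix g assume g: "g \<in> L2_functions M"
  show "mult_op \<phi> (W g) = mult_op \<psi> (W g)"
    unfolding mult_op_W[OF \<phi> g] mult_op_W[OF \<psi> g]
  proof (subst W_eq_iff[OF L2_mult[OF \<phi> g] L2_mult[OF \<psi> g]])
    show "AE t in M. \<phi> t * g t = \<psi> t * g t"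
      using eq by eventually_elim simp
  qed
qed

lemma funpow_mult_op:
  assumes \<phi>: "ess_bounded \<phi> B"
  shows "mult_op \<phi> ^^ i = mult_op (\<lambda>t. \<phi> t ^ i)"
proof (induction i)
  case 0
  show ?case by (auto simp: mult_op_const)
next
  case (Suc i)
  then show ?case
    using mult_op_mult_op[OF \<phi> ess_bounded_power[OF \<phi>]] by simp
qed

lemma poly_operator_mult_op:
  assumes \<phi>: "ess_bounded \<phi> B"
  obtains C where "ess_bounded (\<lambda>t. poly p (\<phi> t)) C"
    and "poly_operator p (mult_op \<phi>) = mult_op (\<lambda>t. poly p (\<phi> t))"
proof -
  define C where "C = (\<Sum>i\<le>degree p. cmod (coeff p i) * B ^ i)"
  have B: "0 \<le> B" using \<phi> by (simp add: ess_bounded_def)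
  have [measurable]: "\<phi> \<in> borel_measurable borel" using \<phi> by (simp add: ess_bounded_def)
  have p: "(\<lambda>t. poly p (\<phi> t)) = (\<lambda>t. \<Sum>i\<le>degree p. coeff p i * \<phi> t ^ i)"
    by (simp add: poly_altdef)
  have eb: "ess_bounded (\<lambda>t. poly p (\<phi> t)) C"
    unfolding ess_bounded_def
  proof (intro conjI)
    show "(\<lambda>t. poly p (\<phi> t)) \<in> borel_measurable borel"
      unfolding p by measurable
    show "0 \<le> C" unfolding C_def using B by (intro sum_nonneg mult_nonneg_nonneg) auto
    have "AE t in M. cmod (\<phi> t) \<le> B" using \<phi> by (simp add: ess_bounded_def)
    then show "AE t in M. cmod (poly p (\<phi> t)) \<le> C"
    proof eventually_elim
      case (elim t)
      show ?case
        unfolding poly_altdef C_def using elim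
        by (intro sum_norm_le) (auto simp: norm_mult norm_power intro!: mult_left_mono power_mono)
    qed
  qed
  have "poly_operator p (mult_op \<phi>) = mult_op (\<lambda>t. poly p (\<phi> t))"
  proof (rule operator_eqI)
    fix g assume g: "g \<in> L2_functions M"
    note L = L2_mult[OF ess_bounded_power[OF \<phi>] g]
    have "poly_operator p (mult_op \<phi>) (W g) = (\<Sum>i\<le>degree p. W (\<lambda>t. coeff p i * (\<phi> t ^ i * g t)))"
      unfolding poly_operator_def funpow_mult_op[OF \<phi>] mult_op_W[OF ess_bounded_power[OF \<phi>] g]
      by (simp add: W_scale L)
    also have "\<dots> = W (\<lambda>t. \<Sum>i\<le>degree p. coeff p i * (\<phi> t ^ i * g t))"
      using W_sum[of "{..degree p}" "\<lambda>i t. coeff p i * (\<phi> t ^ i * g t)"]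
      by (simp add: L2_functions_scale L)
    also have "\<dots> = mult_op (\<lambda>t. poly p (\<phi> t)) (W g)"
      unfolding mult_op_W[OF eb g] by (simp add: poly_altdef sum_distrib_right mult.assoc)
    finally show "poly_operator p (mult_op \<phi>) (W g) = mult_op (\<lambda>t. poly p (\<phi> t)) (W g)" .
  qed
  with eb show ?thesis by (rule that)
qed

section \<open>Positive multiplication operators, square roots and absolute values\<close>

lemma positive_mult_op:
  assumes \<phi>: "ess_bounded (\<lambda>t. complex_of_real (\<phi> t)) B" and c: "0 \<le> c" "AE t in M. c \<le> \<phi> t"
  shows "Im (cinner (mult_op (\<lambda>t. complex_of_real (\<phi> t)) x) x) = 0"
    and "c * (norm x)\<^sup>2 \<le> Re (cinner (mult_op (\<lambda>t. complex_of_real (\<phi> t)) x) x)"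
proof -
  obtain g where g: "g \<in> L2_functions M" "x = W g" by (rule W_cases)
  note L = L2_mult[OF \<phi> g(1)]
  have eq: "complex_of_real (\<phi> t) * g t * cnj (g t) = complex_of_real (\<phi> t * (cmod (g t))\<^sup>2)" for t
    using complex_norm_square[of "g t"] by (simp add: mult.assoc)
  have int: "integrable M (\<lambda>t. complex_of_real (\<phi> t * (cmod (g t))\<^sup>2))"
    using L2_functions_integrable_mult[OF L g(1)] unfolding eq .
  then have int': "integrable M (\<lambda>t. \<phi> t * (cmod (g t))\<^sup>2)"
    unfolding complex_of_real_integrable_eq .
  have ip: "cinner (mult_op (\<lambda>t. complex_of_real (\<phi> t)) x) x = complex_of_real (LINT t|M. \<phi> t * (cmod (g t))\<^sup>2)"
    unfolding g(2) mult_op_W[OF \<phi> g(1)] W_inner[OF L g(1)] eq by (rule integral_complex_of_real)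
  then show "Im (cinner (mult_op (\<lambda>t. complex_of_real (\<phi> t)) x) x) = 0" by simp
  have "c * (norm x)\<^sup>2 = (LINT t|M. c * (cmod (g t))\<^sup>2)"
    using g by (simp add: W_norm)
  also have "\<dots> \<le> (LINT t|M. \<phi> t * (cmod (g t))\<^sup>2)"
  proof (rule integral_mono_AE[OF _ int'])
    show "AE t in M. c * (cmod (g t))\<^sup>2 \<le> \<phi> t * (cmod (g t))\<^sup>2"
      using c(2) by eventually_elim (simp add: mult_right_mono)
  qed (use g in \<open>auto simp: L2_functions_def\<close>)
  finally show "c * (norm x)\<^sup>2 \<le> Re (cinner (mult_op (\<lambda>t. complex_of_real (\<phi> t)) x) x)"
    by (simp add: ip)
qed

text \<open>Let P be multiplication by \<phi> and C its square. Q commutes with C = Q^2 and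
  therefore with P, a limit of polynomials in C. Then y = Q x - P x satisfies (Q + P) y = 0; as Q is
  positive and P is bounded below by c > 0, y vanishes.\<close>

lemma positive_sqrt_unique:
  assumes \<phi>: "ess_bounded (\<lambda>t. complex_of_real (\<phi> t)) B"
    and c: "0 < c" "AE t in M. c \<le> \<phi> t"
    and Q: "positive_operator Q" "Q \<circ> Q = mult_op (\<lambda>t. complex_of_real ((\<phi> t)\<^sup>2))"
  shows "Q = mult_op (\<lambda>t. complex_of_real (\<phi> t))"
proof
  fix x
  let ?P = "mult_op (\<lambda>t. complex_of_real (\<phi> t))"
  let ?C = "mult_op (\<lambda>t. complex_of_real ((\<phi> t)\<^sup>2))"
  have \<phi>2: "ess_bounded (\<lambda>t. complex_of_real ((\<phi> t)\<^sup>2)) (B\<^sup>2)"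
    using ess_bounded_power[OF \<phi>, of 2] by simp
  have PP: "?P (?P z) = ?C z" for z
    using fun_cong[OF mult_op_mult_op[OF \<phi> \<phi>], of z] by (simp add: power2_eq_square)
  have Qb: "Q \<in> bounded_operators" using Q(1) by (simp add: positive_operator_def)
  note Ql = bounded_operators_linear[OF Qb]
  have QQ: "Q (Q z) = ?C z" for z using fun_cong[OF Q(2), of z] by simp
  have QC: "Q (?C z) = ?C (Q z)" for z unfolding QQ[symmetric] ..
  have QP: "Q (?P x) = ?P (Q x)"
  proof -
    \<comment> \<open>The values of \<phi>^2 lie in [0, B^2] almost everywhere. Polynomials close to
      the square root there, evaluated at \<phi>^2, are close to \<phi> because \<phi> is
      nonnegative.\<close>
    have "compact {0..B\<^sup>2}" "continuous_on {0..B\<^sup>2} (\<lambda>s. complex_of_real (sqrt s))"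
      by (auto intro!: continuous_intros)
    then obtain p where p: "uniform_limit {0..B\<^sup>2} (\<lambda>k s. poly (p k) (complex_of_real s))
        (\<lambda>s. complex_of_real (sqrt s)) sequentially"
      by (rule complex_Weierstrass)
    have lim: "(\<lambda>k. poly_operator (p k) ?C z) \<longlonglongrightarrow> ?P z" for z
      unfolding tendsto_iff
    proof (intro allI impI)
      fix e :: real assume "0 < e"
      \<comment> \<open>The summand 1 keeps the denominator positive for z = 0 and makes e' * norm z
        strictly smaller than e.\<close>
      define e' where "e' = e / (norm z + 1)"
      have e': "0 < e'" using \<open>0 < e\<close> norm_ge_zero[of z] by (simp add: e'_def add_nonneg_pos)
      have "\<forall>\<^sub>F k in sequentially. \<forall>s\<in>{0..B\<^sup>2}. dist (poly (p k) (complex_of_real s)) (complex_of_real (sqrt s)) < e'"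
        using p e' by (auto simp: uniform_limit_iff)
      then show "\<forall>\<^sub>F k in sequentially. dist (poly_operator (p k) ?C z) (?P z) < e"
      proof eventually_elim
        case (elim k)
        note approx = elim
        obtain D where D: "ess_bounded (\<lambda>t. poly (p k) (complex_of_real ((\<phi> t)\<^sup>2))) D"
          "poly_operator (p k) ?C = mult_op (\<lambda>t. poly (p k) (complex_of_real ((\<phi> t)\<^sup>2)))"
          using poly_operator_mult_op[OF \<phi>2] by blast
        let ?d = "\<lambda>t. poly (p k) (complex_of_real ((\<phi> t)\<^sup>2)) - complex_of_real (\<phi> t)"
        have "ess_bounded ?d e'"
          unfolding ess_bounded_def
        proof (intro conjI)
          show "?d \<in> borel_measurable borel"
            using D(1) \<phi> by (auto simp: ess_bounded_def)
          have "AE t in M. cmod (complex_of_real (\<phi> t)) \<le> B" using \<phi> by (simp add: ess_bounded_def)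
          then show "AE t in M. cmod (?d t) \<le> e'"
            using c(2)
          proof eventually_elim
            case (elim t)
            then have "0 \<le> \<phi> t" "(\<phi> t)\<^sup>2 \<in> {0..B\<^sup>2}" using c(1) by (auto intro: power_mono)
            then show ?case
              using bspec[OF approx, of "(\<phi> t)\<^sup>2"] by (simp add: dist_norm)
          qed
        qed (use e' in simp)
        from mult_op_norm[OF this, of z]
        have "norm (poly_operator (p k) ?C z - ?P z) \<le> e' * norm z"
          unfolding D(2) mult_op_diff[OF D(1) \<phi>] .
        also have "\<dots> < e' * (norm z + 1)" using e' by simp
        also have "\<dots> = e"
        proof -
          have "norm z + 1 \<noteq> 0" using norm_ge_zero[of z] by linarith
          then show ?thesis by (simp add: e'_def)
        qed
        finally show ?case by (simp add: dist_norm)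
      qed
    qed
    have "(\<lambda>k. Q (poly_operator (p k) ?C x)) \<longlonglongrightarrow> Q (?P x)"
      by (rule bounded_linear.tendsto[OF Ql lim])
    moreover have "(\<lambda>k. Q (poly_operator (p k) ?C x)) \<longlonglongrightarrow> ?P (Q x)"
      using lim[of "Q x"] unfolding poly_operator_commute[of Q ?C, OF Qb QC] .
    ultimately show ?thesis by (rule LIMSEQ_unique)
  qed
  define y where "y = Q x - ?P x"
  have Pl: "bounded_linear ?P" by (rule bounded_operators_linear[OF mult_op_bounded[OF \<phi>]])
  \<comment> \<open>Q and P commute on x and have the same square C, so the two expressions are
    negatives of each other.\<close>
  have "Q y = ?C x - ?P (Q x)" "?P y = ?P (Q x) - ?C x"
    unfolding y_def using linear_diff[OF bounded_linear.linear[OF Ql], of "Q x" "?P x"]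
      linear_diff[OF bounded_linear.linear[OF Pl], of "Q x" "?P x"] QQ[of x] QP PP[of x] by simp_all
  then have "Q y + ?P y = 0" by simp
  then have "Re (cinner (Q y + ?P y) y) = 0" by simp
  then have "Re (cinner (Q y) y) + Re (cinner (?P y) y) = 0"
    unfolding cinner_add_left plus_complex.sel .
  moreover have "0 \<le> Re (cinner (Q y) y)" using Q(1) by (simp add: positive_operator_def)
  moreover have "c * (norm y)\<^sup>2 \<le> Re (cinner (?P y) y)"
    using positive_mult_op(2)[OF \<phi>] c by simp
  ultimately have "c * (norm y)\<^sup>2 \<le> 0" by linarith
  then have "y = 0" using c(1) by (simp add: mult_le_0_iff)
  then show "Q x = ?P x" by (simp add: y_def)
qed

lemma abs_operator_eqI:
  assumes \<phi>: "ess_bounded (\<lambda>t. complex_of_real (\<phi> t)) B"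
    and c: "0 < c" "AE t in M. c \<le> \<phi> t"
    and S: "adjoint_operator S \<circ> S = mult_op (\<lambda>t. complex_of_real ((\<phi> t)\<^sup>2))"
  shows "abs_operator S = mult_op (\<lambda>t. complex_of_real (\<phi> t))"
  unfolding abs_operator_def S
proof (rule the_equality)
  have "positive_operator (mult_op (\<lambda>t. complex_of_real (\<phi> t)))"
    unfolding positive_operator_def
  proof (intro conjI allI)
    fix x
    show "Im (cinner (mult_op (\<lambda>t. complex_of_real (\<phi> t)) x) x) = 0"
      using positive_mult_op(1)[OF \<phi> less_imp_le[OF c(1)] c(2)] .
    have "0 \<le> c * (norm x)\<^sup>2" using c by simp
    then show "0 \<le> Re (cinner (mult_op (\<lambda>t. complex_of_real (\<phi> t)) x) x)"
      using positive_mult_op(2)[OF \<phi> less_imp_le[OF c(1)] c(2), of x] by linarith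
  qed (rule mult_op_bounded[OF \<phi>])
  then show "positive_operator (mult_op (\<lambda>t. complex_of_real (\<phi> t))) \<and>
      mult_op (\<lambda>t. complex_of_real (\<phi> t)) \<circ> mult_op (\<lambda>t. complex_of_real (\<phi> t))
      = mult_op (\<lambda>t. complex_of_real ((\<phi> t)\<^sup>2))"
    using mult_op_mult_op[OF \<phi> \<phi>] by (simp add: power2_eq_square)
qed (use positive_sqrt_unique[OF \<phi> c] in auto)

end

section \<open>Multiplication by the independent variable\<close>

text \<open>Continuous approximations of the indicator of an open half-line. Spectral measures are
  specified by integrals of continuous functions, whereas measures on the line are compared on
  half-lines.\<close>

definition ramp :: "real \<Rightarrow> nat \<Rightarrow> real \<Rightarrow> real" where
  "ramp x n t = min 1 (max 0 (real n * (t - x)))"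

lemma ramp_bounds: "0 \<le> ramp x n t" "ramp x n t \<le> 1"
  by (auto simp: ramp_def)

lemma continuous_on_ramp: "continuous_on S (ramp x n)"
  unfolding ramp_def by (intro continuous_intros)

lemma borel_measurable_ramp [measurable]: "ramp x n \<in> borel_measurable borel"
  by (rule borel_measurable_continuous_onI[OF continuous_on_ramp])

lemma ramp_tendsto: "(\<lambda>n. ramp x n t) \<longlonglongrightarrow> indicator {x<..} t"
proof (cases "x < t")
  case True
  obtain N where N: "1 / (t - x) < real N" using reals_Archimedean2 by blast
  have "\<forall>\<^sub>F n in sequentially. ramp x n t = 1"
    using eventually_ge_at_top[of N]
  proof eventually_elim
    case (elim n)
    then have "1 / (t - x) < real n" using N by simp
    then have "1 \<le> real n * (t - x)" using True by (simp add: field_simps)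
    then show ?case by (simp add: ramp_def)
  qed
  then show ?thesis using True by (simp add: tendsto_eventually)
next
  case False
  then have "ramp x n t = 0" for n
  proof -
    have "real n * (t - x) \<le> 0" using False by (intro mult_nonneg_nonpos) auto
    then show ?thesis by (simp add: ramp_def)
  qed
  then show ?thesis using False by simp
qed

text \<open>Uniqueness for the definite description in \<open>spectral_measure\<close>: ramps carry
  the equality of integrals over to half-lines by dominated convergence.\<close>

lemma measure_eq_if_continuous_integrals_eq:
  fixes \<mu> \<nu> :: "real measure"
  assumes \<mu>: "sets \<mu> = sets borel" "finite_measure \<mu>" "emeasure \<mu> (- K) = 0"
    and \<nu>: "sets \<nu> = sets borel" "finite_measure \<nu>" "emeasure \<nu> (- K) = 0"
    and K: "closed K"
    and eq: "\<And>f :: real \<Rightarrow> complex. continuous_on K f \<Longrightarrow>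
      (LINT t:K|\<mu>. f t) = (LINT t:K|\<nu>. f t)"
  shows "\<mu> = \<nu>"
proof (rule measure_eqI_lessThan)
  fix x
  have lim: "(\<lambda>n. LINT t:K|m. complex_of_real (ramp x n t)) \<longlonglongrightarrow> complex_of_real (measure m {x<..})"
    if m: "sets m = sets borel" "finite_measure m" "emeasure m (- K) = 0" for m :: "real measure"
  proof -
    interpret finite_measure m by (rule m)
    note [measurable_cong] = m(1)
    have Kb [measurable]: "K \<in> sets borel" using K by simp
    have "(LINT t:K|m. complex_of_real (ramp x n t)) = complex_of_real (LINT t|m. indicator K t * ramp x n t)" for n
      unfolding set_lebesgue_integral_def integral_complex_of_real[symmetric]
      by (simp add: scaleR_conv_of_real)
    moreover have "(\<lambda>n. LINT t|m. indicator K t * ramp x n t) \<longlonglongrightarrow> (LINT t|m. indicator K t * indicator {x<..} t)"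
    proof (rule integral_dominated_convergence[where w = "\<lambda>t. 1"])
      show "AE t in m. (\<lambda>n. indicator K t * ramp x n t) \<longlonglongrightarrow> indicator K t * indicator {x<..} t"
        by (intro AE_I2 tendsto_mult tendsto_const ramp_tendsto)
      show "AE t in m. norm (indicator K t * ramp x n t) \<le> 1" for n
        using ramp_bounds[of x n] by (intro AE_I2) (auto simp: indicator_def)
    qed auto
    moreover have "(LINT t|m. indicator K t * indicat_real {x<..} t) = measure m {x<..}"
    proof -
      have "AE t in m. t \<notin> - K"
        using m(3) by (intro AE_not_in) (simp add: null_sets_def m(1))
      then have "(LINT t|m. indicator K t * indicator {x<..} t) = (LINT t|m. indicat_real {x<..} t)"
        by (intro integral_cong_AE) (auto elim!: eventually_mono simp: indicator_def)
      then show ?thesis using sets_eq_imp_space_eq[OF m(1)] by simp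
    qed
    ultimately show ?thesis by (simp add: tendsto_of_real)
  qed
  have "(LINT t:K|\<mu>. complex_of_real (ramp x n t)) = (LINT t:K|\<nu>. complex_of_real (ramp x n t))" for n
    by (intro eq continuous_on_of_real continuous_on_ramp)
  then have "complex_of_real (measure \<mu> {x<..}) = complex_of_real (measure \<nu> {x<..})"
    using LIMSEQ_unique[OF lim[OF \<mu>]] lim[OF \<nu>] by simp
  then show "emeasure \<mu> {x<..} = emeasure \<nu> {x<..}"
    by (simp add: finite_measure.emeasure_eq_measure[OF \<mu>(2)]
        finite_measure.emeasure_eq_measure[OF \<nu>(2)])
  show "emeasure \<mu> {x<..} < \<infinity>"
    by (simp add: finite_measure.emeasure_eq_measure[OF \<mu>(2)])
qed (use \<mu> \<nu> in auto)

lemma dense_subspace: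
  fixes D :: "'a::complex_hilbert set"
  assumes zero: "0 \<in> D" and add: "\<And>x y. x \<in> D \<Longrightarrow> y \<in> D \<Longrightarrow> x + y \<in> D"
    and scale: "\<And>c x. x \<in> D \<Longrightarrow> c *\<^sub>C x \<in> D" and total: "total_family D"
  shows "closure D = UNIV"
proof (rule closed_subspace_eq_UNIV)
  show "0 \<in> closure D" using zero closure_subset by blast
  show "x + y \<in> closure D" if "x \<in> closure D" "y \<in> closure D" for x y
  proof -
    from that obtain u v where "\<And>n. u n \<in> D" "u \<longlonglongrightarrow> x" "\<And>n. v n \<in> D" "v \<longlonglongrightarrow> y"
      unfolding closure_sequential by blast
    then show ?thesis
      unfolding closure_sequential
      by (intro exI[of _ "\<lambda>n. u n + v n"]) (auto intro: add tendsto_add)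
  qed
  show "c *\<^sub>C x \<in> closure D" if "x \<in> closure D" for c x
  proof -
    from that obtain u where "\<And>n. u n \<in> D" "u \<longlonglongrightarrow> x"
      unfolding closure_sequential by blast
    then show ?thesis
      unfolding closure_sequential
      by (intro exI[of _ "\<lambda>n. c *\<^sub>C u n"])
        (auto intro: scale bounded_linear.tendsto[OF bounded_linear_scaleC_right])
  qed
  show "x = 0" if "\<And>y. y \<in> closure D \<Longrightarrow> cinner x y = 0" for x
  proof -
    have "\<forall>d\<in>D. cinner x d = 0" using that closure_subset by blast
    then show ?thesis using total unfolding total_family_def by blast
  qed
qed simp

section \<open>Polynomials in the generated C*-algebra\<close>

lemma cstar_algebra_funpow:
  "cstar_algebra S \<Longrightarrow> A \<in> S \<Longrightarrow> id \<in> S \<Longrightarrow> A ^^ i \<in> S"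
  by (induction i) (simp_all add: cstar_algebra_def)

lemma cstar_algebra_sum:
  assumes S: "cstar_algebra S" and "finite I" and "\<And>i. i \<in> I \<Longrightarrow> F i \<in> S"
  shows "(\<lambda>x. \<Sum>i\<in>I. F i x) \<in> S"
  using assms(2,3)
proof (induction I rule: finite_induct)
  case empty
  then show ?case using S by (simp add: cstar_algebra_def)
next
  case (insert i I)
  have *: "\<And>A B. A \<in> S \<Longrightarrow> B \<in> S \<Longrightarrow> (\<lambda>x. A x + B x) \<in> S" using S by (simp add: cstar_algebra_def)
  have "(\<lambda>x. F i x + (\<Sum>i\<in>I. F i x)) \<in> S"
    using insert by (intro *) auto
  then show ?case using insert by simp
qed

lemma poly_operator_in_generated: "poly_operator p A \<in> generated_cstar_algebra A"
  unfolding generated_cstar_algebra_def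
proof
  fix S assume "S \<in> {S. cstar_algebra S \<and> A \<in> S \<and> id \<in> S}"
  then have S: "cstar_algebra S" "A \<in> S" "id \<in> S" by auto
  have "(\<lambda>x. coeff p i *\<^sub>C (A ^^ i) x) \<in> S" for i
    using S(1) cstar_algebra_funpow[OF S, of i] by (simp add: cstar_algebra_def)
  then show "poly_operator p A \<in> S"
    unfolding poly_operator_def by (intro cstar_algebra_sum[OF S(1)]) auto
qed

section \<open>Square-integrable functions of a completed measure\<close>

lemma borel_measurable_completion_cong_AE:
  fixes g :: "real \<Rightarrow> complex"
  assumes g': "g' \<in> borel_measurable M" and eq: "AE t in M. g t = g' t"
  shows "g \<in> borel_measurable (completion M)"
proof (rule measurableI)
  fix S :: "complex set" assume S: "S \<in> sets borel"
  have g'S: "g' -` S \<inter> space M \<in> sets (completion M)"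
    by (rule sets_completionI_sets[OF measurable_sets[OF g' S]])
  have ae: "AE t in completion M. t \<in> g' -` S \<inter> space M \<longleftrightarrow> t \<in> g -` S \<inter> space M"
    using AE_completion[OF eq] by eventually_elim auto
  have "g -` S \<inter> space M \<in> sets (completion M)"
    by (rule completion.in_sets_AE[OF ae g'S]) simp
  then show "g -` S \<inter> space (completion M) \<in> sets (completion M)" by simp
qed simp

lemma completion_ex_borel_measurable_complex:
  fixes g :: "real \<Rightarrow> complex"
  assumes "g \<in> borel_measurable (completion M)"
  obtains g' where "g' \<in> borel_measurable M" "AE t in M. g t = g' t"
proof -
  have "(\<lambda>t. Re (g t)) \<in> borel_measurable (completion M)" "(\<lambda>t. Im (g t)) \<in> borel_measurable (completion M)"
    using assms by auto
  from this[THEN completion_ex_borel_measurable_real] obtain u v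
    where [measurable]: "u \<in> borel_measurable M" "v \<in> borel_measurable M"
      and eq: "AE t in M. Re (g t) = u t" "AE t in M. Im (g t) = v t" by blast
  show ?thesis
  proof (rule that[of "\<lambda>t. complex_of_real (u t) + \<i> * complex_of_real (v t)"])
    show "AE t in M. g t = complex_of_real (u t) + \<i> * complex_of_real (v t)"
      using eq by eventually_elim (simp add: complex_eq_iff)
  qed measurable
qed

text \<open>The spectral measure is completed while the model measure is not. Up to null sets both
  have the same square-integrable functions, so W can serve for the completion as well.\<close>

lemma L2_functions_completion_iff:
  "g \<in> L2_functions (completion M) \<longleftrightarrow> (\<exists>g'\<in>L2_functions M. AE t in M. g t = g' t)"
proof
  assume g: "g \<in> L2_functions (completion M)"
  obtain g' where g': "g' \<in> borel_measurable M" "AE t in M. g t = g' t"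
    by (rule completion_ex_borel_measurable_complex[OF L2_functions_measurable[OF g]])
  have "g' \<in> L2_functions (completion M)"
    by (rule L2_functions_cong_AE[OF g measurable_completion[OF g'(1)] AE_completion[OF g'(2)]])
  then have "g' \<in> L2_functions M"
    using g' integrable_completion[of "\<lambda>t. (cmod (g' t))\<^sup>2" M] by (simp add: L2_functions_def)
  with g' show "\<exists>g'\<in>L2_functions M. AE t in M. g t = g' t" by blast
next
  assume "\<exists>g'\<in>L2_functions M. AE t in M. g t = g' t"
  then obtain g' where g': "g' \<in> L2_functions M" "AE t in M. g t = g' t" by blast
  have [measurable]: "g' \<in> borel_measurable M" by (rule L2_functions_measurable[OF g'(1)])
  have "(\<lambda>t. (cmod (g' t))\<^sup>2) \<in> borel_measurable M" by measurable
  then have "integrable (completion M) (\<lambda>t. (cmod (g' t))\<^sup>2)"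
    using integrable_completion L2_functions_integrable_sq[OF g'(1)] by blast
  then have "g' \<in> L2_functions (completion M)"
    using measurable_completion[OF L2_functions_measurable[OF g'(1)]]
    unfolding L2_functions_def by blast
  moreover have "g \<in> borel_measurable (completion M)"
    by (rule borel_measurable_completion_cong_AE[OF L2_functions_measurable[OF g'(1)] g'(2)])
  moreover have "AE t in completion M. g' t = g t"
    using AE_completion[OF g'(2)] by eventually_elim simp
  ultimately show "g \<in> L2_functions (completion M)" by (rule L2_functions_cong_AE)
qed

text \<open>The last two assumptions say that K is the support of M. A null complement puts the
  spectrum inside K, and positive mass near each point of K puts K inside the spectrum.\<close>

locale spectral_model = L2_unitary M W
  for M :: "real measure" and W :: "(real \<Rightarrow> complex) \<Rightarrow> 'a::complex_hilbert" +
  fixes K :: "real set"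
  assumes finite_M: "finite_measure M" and compact_K: "compact K"
    and null_K: "emeasure M (- K) = 0"
    and support_K: "\<And>t e. t \<in> K \<Longrightarrow> 0 < e \<Longrightarrow> emeasure M {t - e<..<t + e} \<noteq> 0"
begin

sublocale finite_measure M by (rule finite_M)

lemma K_borel [measurable]: "K \<in> sets borel"
  using compact_K by (simp add: compact_imp_closed)

lemma AE_K: "AE t in M. t \<in> K"
proof -
  have "AE t in M. t \<notin> - K"
    using null_K by (intro AE_not_in) (simp add: null_sets_def sets_M)
  then show ?thesis by simp
qed

lemma ess_boundedI:
  "\<phi> \<in> borel_measurable borel \<Longrightarrow> 0 \<le> B \<Longrightarrow> (\<And>t. t \<in> K \<Longrightarrow> cmod (\<phi> t) \<le> B) \<Longrightarrow> ess_bounded \<phi> B"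
  unfolding ess_bounded_def by (intro conjI eventually_mono[OF AE_K]) auto

lemma ess_bounded_id: obtains R where "ess_bounded complex_of_real R"
proof -
  obtain R where "\<And>t. t \<in> K \<Longrightarrow> norm t \<le> R"
    using compact_imp_bounded[OF compact_K] by (auto simp: bounded_iff)
  then have "ess_bounded complex_of_real (max R 0)"
    by (intro ess_boundedI) (auto simp: le_max_iff_disj)
  then show ?thesis by (rule that)
qed

lemma one_L2: "(\<lambda>t. 1) \<in> L2_functions M"
  by (simp add: L2_functions_def)

lemma ess_bounded_L2: "ess_bounded \<phi> B \<Longrightarrow> \<phi> \<in> L2_functions M"
  using L2_mult[OF _ one_L2] by simp

definition A :: "'a \<Rightarrow> 'a" where "A = mult_op complex_of_real"

definition \<xi> :: 'a where "\<xi> = W (\<lambda>t. 1)"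

lemma mult_op_\<xi>: "ess_bounded \<phi> B \<Longrightarrow> mult_op \<phi> \<xi> = W \<phi>"
  using mult_op_W[OF _ one_L2] by (simp add: \<xi>_def)

lemma A_minus:
  obtains B where "ess_bounded (\<lambda>s. complex_of_real s - c) B"
    and "(\<lambda>x. A x - c *\<^sub>C x) = mult_op (\<lambda>s. complex_of_real s - c)"
proof -
  obtain R where R: "ess_bounded complex_of_real R" by (rule ess_bounded_id)
  have "(\<lambda>x. A x - c *\<^sub>C x) = mult_op (\<lambda>s. complex_of_real s - c)"
    using mult_op_diff[OF R ess_bounded_const] by (simp add: A_def mult_op_const)
  with ess_bounded_diff[OF R ess_bounded_const] show ?thesis by (rule that)
qed

text \<open>Off K the function 1/(s - t) is essentially bounded, since a ball around t misses K, and
  gives the inverse. At t in K the indicators of small intervals around t are approximate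
  eigenvectors.\<close>

lemma real_spectrum_A: "real_spectrum A = K"
proof -
  have "invertible_operator (\<lambda>x. A x - complex_of_real t *\<^sub>C x)" if t: "t \<notin> K" for t
  proof -
    obtain B where B: "ess_bounded (\<lambda>s. complex_of_real s - complex_of_real t) B"
      and eq: "(\<lambda>x. A x - complex_of_real t *\<^sub>C x) = mult_op (\<lambda>s. complex_of_real s - complex_of_real t)"
      by (rule A_minus)
    have "open (- K)" using compact_K by (simp add: compact_imp_closed open_Compl)
    then obtain d where d: "0 < d" "ball t d \<subseteq> - K"
      using t openE[of "- K" t] by auto
    let ?r = "\<lambda>s. inverse (complex_of_real s - complex_of_real t)"
    have r: "ess_bounded ?r (inverse d)"
    proof (rule ess_boundedI)
      fix s assume s: "s \<in> K"
      then have "s \<notin> ball t d" using d(2) by auto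
      then have "d \<le> \<bar>s - t\<bar>" by (simp add: dist_real_def abs_minus_commute)
      moreover have "cmod (complex_of_real s - complex_of_real t) = \<bar>s - t\<bar>"
        by (simp flip: of_real_diff)
      ultimately show "cmod (?r s) \<le> inverse d"
        using d(1) by (simp add: norm_inverse le_imp_inverse_le)
    qed (use d in auto)
    \<comment> \<open>At s = t the totalised \<open>inverse\<close> yields 0, so the products below
      equal 1 only off that point, which is null because t is not in K.\<close>
    have ae: "AE s in M. complex_of_real s \<noteq> complex_of_real t"
      using AE_K by eventually_elim (use t in auto)
    have "mult_op (\<lambda>s. (complex_of_real s - complex_of_real t) * ?r s) = mult_op (\<lambda>s. 1)"
      using ae by (intro mult_op_cong_AE[OF ess_bounded_mult[OF B r] ess_bounded_const])
        (auto elim!: eventually_mono)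
    moreover have "mult_op (\<lambda>s. ?r s * (complex_of_real s - complex_of_real t)) = mult_op (\<lambda>s. 1)"
      using ae by (intro mult_op_cong_AE[OF ess_bounded_mult[OF r B] ess_bounded_const])
        (auto elim!: eventually_mono)
    moreover have "mult_op (\<lambda>s. 1) = id" by (simp add: fun_eq_iff mult_op_const)
    ultimately show ?thesis
      unfolding invertible_operator_def eq using mult_op_bounded[OF B] mult_op_bounded[OF r]
      by (auto simp: mult_op_mult_op[OF B r] mult_op_mult_op[OF r B]
          intro!: bexI[of _ "mult_op ?r"])
  qed
  moreover have "\<not> invertible_operator (\<lambda>x. A x - complex_of_real t *\<^sub>C x)" if t: "t \<in> K" for t
  proof
    assume inv: "invertible_operator (\<lambda>x. A x - complex_of_real t *\<^sub>C x)"
    obtain B where B: "ess_bounded (\<lambda>s. complex_of_real s - complex_of_real t) B"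
      and eq: "(\<lambda>x. A x - complex_of_real t *\<^sub>C x) = mult_op (\<lambda>s. complex_of_real s - complex_of_real t)"
      by (rule A_minus)
    obtain R where R: "R \<in> bounded_operators" "R \<circ> mult_op (\<lambda>s. complex_of_real s - complex_of_real t) = id"
      using inv unfolding invertible_operator_def eq by auto
    obtain b where b: "0 < b" "\<And>x. norm (R x) \<le> norm x * b"
      using bounded_linear.pos_bounded[OF bounded_operators_linear[OF R(1)]] by blast
    \<comment> \<open>On functions supported within distance e of t, A - t shrinks norms at least by
      the factor e, while R enlarges them at most by b. As e * b = 1/2, the composition cannot be
      the identity.\<close>
    define e where "e = 1 / (2 * b)"
    have e: "0 < e" using b(1) by (simp add: e_def)
    define g :: "real \<Rightarrow> complex" where "g = indicator {t - e<..<t + e}"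
    have gb: "ess_bounded g 1" unfolding g_def by (rule ess_boundedI) (auto simp: indicator_def)
    note g = ess_bounded_L2[OF gb]
    have "W g \<noteq> 0"
    proof
      assume "W g = 0"
      then have "AE s in M. g s = 0" by (simp add: W_eq_0_iff[OF g])
      then have "AE s in M. s \<notin> {t - e<..<t + e}"
        by eventually_elim (auto simp: g_def indicator_def)
      then have "emeasure M {t - e<..<t + e} = 0"
        using AE_iff_null_sets[of "{t - e<..<t + e}" M] by (simp add: sets_M null_sets_def)
      then show False using support_K[OF t e] by simp
    qed
    have "norm (W g) = norm (R (mult_op (\<lambda>s. complex_of_real s - complex_of_real t) (W g)))"
      using fun_cong[OF R(2), of "W g"] by simp
    also have "\<dots> \<le> norm (mult_op (\<lambda>s. complex_of_real s - complex_of_real t) (W g)) * b"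
      by (rule b(2))
    also have "\<dots> \<le> (e * norm (W g)) * b"
    proof (rule mult_right_mono)
      show "norm (mult_op (\<lambda>s. complex_of_real s - complex_of_real t) (W g)) \<le> e * norm (W g)"
        unfolding mult_op_W[OF B g]
      proof (rule W_norm_le[OF L2_mult[OF B g] g])
        show "AE s in M. cmod ((complex_of_real s - complex_of_real t) * g s) \<le> e * cmod (g s)"
          by (intro AE_I2) (auto simp: g_def indicator_def simp flip: of_real_diff)
      qed (use e in simp)
    qed (use b in simp)
    also have "\<dots> = norm (W g) / 2" using b(1) by (simp add: e_def)
    finally show False using \<open>W g \<noteq> 0\<close> by simp
  qed
  ultimately show ?thesis by (auto simp: real_spectrum_def spectrum_def)
qed

text \<open>Functions in the calculus are only continuous on K. Cutting them off outside K makes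
  them Borel and bounded and changes them on a null set.\<close>

definition ext :: "(real \<Rightarrow> complex) \<Rightarrow> real \<Rightarrow> complex" where
  "ext f t = indicator K t *\<^sub>R f t"

lemma ess_bounded_ext:
  assumes "continuous_on K f"
  obtains B where "ess_bounded (ext f) B"
proof -
  obtain B where B: "\<And>t. t \<in> K \<Longrightarrow> cmod (f t) \<le> B"
    using compact_imp_bounded[OF compact_continuous_image[OF assms compact_K]]
    by (auto simp: bounded_iff)
  have "ess_bounded (ext f) (max B 0)"
  proof (rule ess_boundedI)
    show "ext f \<in> borel_measurable borel"
      unfolding ext_def by (intro borel_measurable_continuous_on_indicator K_borel assms)
  qed (use B in \<open>auto simp: ext_def le_max_iff_disj\<close>)
  then show ?thesis by (rule that)
qed

lemma poly_operator_A:
  obtains B where "ess_bounded (\<lambda>t. poly p (complex_of_real t)) B"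
    and "poly_operator p A = mult_op (\<lambda>t. poly p (complex_of_real t))"
proof -
  obtain R where R: "ess_bounded complex_of_real R" by (rule ess_bounded_id)
  show ?thesis using poly_operator_mult_op[OF R, of p] that unfolding A_def by blast
qed

text \<open>The operator norm of a multiplication is at most any essential bound of the multiplier,
  so uniform convergence on K suffices.\<close>

lemma poly_operator_tendsto:
  assumes f: "continuous_on K f"
    and p: "uniform_limit K (\<lambda>k t. poly (p k) (complex_of_real t)) f sequentially"
  shows "(\<lambda>k. onorm (\<lambda>x. poly_operator (p k) A x - mult_op (ext f) x)) \<longlonglongrightarrow> 0"
  unfolding tendsto_iff
proof (intro allI impI)
  fix e :: real assume e: "0 < e"
  obtain B where B: "ess_bounded (ext f) B" by (rule ess_bounded_ext[OF f])
  have "\<forall>\<^sub>F k in sequentially. \<forall>t\<in>K. dist (poly (p k) (complex_of_real t)) (f t) < e / 2"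
    by (rule uniform_limitD[OF p]) (use e in simp)
  then show "\<forall>\<^sub>F k in sequentially. dist (onorm (\<lambda>x. poly_operator (p k) A x - mult_op (ext f) x)) 0 < e"
  proof eventually_elim
    case (elim k)
    obtain C where C: "ess_bounded (\<lambda>t. poly (p k) (complex_of_real t)) C"
      and pA: "poly_operator (p k) A = mult_op (\<lambda>t. poly (p k) (complex_of_real t))"
      by (rule poly_operator_A)
    have d: "ess_bounded (\<lambda>t. poly (p k) (complex_of_real t) - ext f t) (e / 2)"
    proof (rule ess_boundedI)
      show "(\<lambda>t. poly (p k) (complex_of_real t) - ext f t) \<in> borel_measurable borel"
        using B C by (auto simp: ess_bounded_def)
      show "cmod (poly (p k) (complex_of_real t) - ext f t) \<le> e / 2" if "t \<in> K" for t
        using elim that by (auto simp: ext_def dist_norm intro: less_imp_le)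
    qed (use e in simp)
    have "onorm (\<lambda>x. poly_operator (p k) A x - mult_op (ext f) x) \<le> e / 2"
      unfolding pA mult_op_diff[OF C B] using mult_op_norm[OF d] e by (intro onorm_bound) auto
    moreover have "0 \<le> onorm (\<lambda>x. poly_operator (p k) A x - mult_op (ext f) x)"
      unfolding pA mult_op_diff[OF C B]
      by (intro onorm_pos_le bounded_operators_linear[OF mult_op_bounded[OF d]])
    ultimately show ?case using e by simp
  qed
qed

lemma A_bounded: "A \<in> bounded_operators"
proof -
  obtain R where R: "ess_bounded complex_of_real R" by (rule ess_bounded_id)
  show ?thesis unfolding A_def by (rule mult_op_bounded[OF R])
qed

text \<open>The definite description demands convergence along all approximating sequences;
  uniqueness rests on the existence of one such sequence, by Weierstrass.\<close>

lemma functional_calculus_A: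
  assumes f: "continuous_on K f"
  shows "functional_calculus A f = mult_op (ext f)"
  unfolding functional_calculus_def real_spectrum_A
proof (rule the_equality)
  obtain C where C: "ess_bounded (ext f) C" by (rule ess_bounded_ext[OF f])
  show "mult_op (ext f) \<in> bounded_operators \<and>
    (\<forall>p. uniform_limit K (\<lambda>k t. poly (p k) (complex_of_real t)) f sequentially \<longrightarrow>
      (\<lambda>k. onorm (\<lambda>x. poly_operator (p k) A x - mult_op (ext f) x)) \<longlonglongrightarrow> 0)"
    using poly_operator_tendsto[OF f] mult_op_bounded[OF C] by blast
  fix B assume B: "B \<in> bounded_operators \<and>
    (\<forall>p. uniform_limit K (\<lambda>k t. poly (p k) (complex_of_real t)) f sequentially \<longrightarrow>
      (\<lambda>k. onorm (\<lambda>x. poly_operator (p k) A x - B x)) \<longlonglongrightarrow> 0)"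
  obtain p where p: "uniform_limit K (\<lambda>k t. poly (p k) (complex_of_real t)) f sequentially"
    by (rule complex_Weierstrass[OF compact_K f])
  have lim: "(\<lambda>k. poly_operator (p k) A x) \<longlonglongrightarrow> D x"
    if D: "D \<in> bounded_operators" "(\<lambda>k. onorm (\<lambda>x. poly_operator (p k) A x - D x)) \<longlonglongrightarrow> 0" for D x
  proof (rule LIM_zero_cancel, rule Lim_null_comparison)
    show "\<forall>\<^sub>F k in sequentially. norm (poly_operator (p k) A x - D x)
        \<le> onorm (\<lambda>x. poly_operator (p k) A x - D x) * norm x"
      using D(1) poly_operator_bounded_operators[OF A_bounded]
      by (intro always_eventually allI onorm bounded_linear_sub bounded_operators_linear) auto
    show "(\<lambda>k. onorm (\<lambda>x. poly_operator (p k) A x - D x) * norm x) \<longlonglongrightarrow> 0"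
      using tendsto_mult[OF D(2) tendsto_const, of "norm x"] by simp
  qed
  show "B = mult_op (ext f)"
  proof
    fix x
    have "(\<lambda>k. poly_operator (p k) A x) \<longlonglongrightarrow> B x" using B p by (intro lim) auto
    moreover have "(\<lambda>k. poly_operator (p k) A x) \<longlonglongrightarrow> mult_op (ext f) x"
      by (intro lim mult_op_bounded[OF C] poly_operator_tendsto[OF f p])
    ultimately show "B x = mult_op (ext f) x" by (rule LIMSEQ_unique)
  qed
qed

lemma functional_calculus_\<xi>:
  assumes f: "continuous_on K f"
  shows "functional_calculus A f \<xi> = W (ext f)"
proof -
  obtain B where B: "ess_bounded (ext f) B" by (rule ess_bounded_ext[OF f])
  show ?thesis unfolding functional_calculus_A[OF f] by (rule mult_op_\<xi>[OF B])
qed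

text \<open>Since \<xi> is the image of the constant 1, the inner product of f(A) \<xi> with \<xi>
  is the integral of f over K.\<close>

lemma spectral_measure_A: "spectral_measure A \<xi> = completion M"
proof -
  have M: "(LINT t:K|M. f t) = cinner (functional_calculus A f \<xi>) \<xi>" if f: "continuous_on K f" for f
  proof -
    obtain B where B: "ess_bounded (ext f) B" by (rule ess_bounded_ext[OF f])
    show ?thesis
      unfolding functional_calculus_\<xi>[OF f] set_lebesgue_integral_def
      by (simp add: \<xi>_def W_inner[OF ess_bounded_L2[OF B] one_L2] ext_def)
  qed
  have "(THE \<mu>. sets \<mu> = sets borel \<and> finite_measure \<mu> \<and> emeasure \<mu> (- real_spectrum A) = 0 \<and>
     (\<forall>f. continuous_on (real_spectrum A) f \<longrightarrow>
        (LINT t:real_spectrum A|\<mu>. f t) = cinner (functional_calculus A f \<xi>) \<xi>)) = M"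
    unfolding real_spectrum_A
  proof (rule the_equality)
    show "sets M = sets borel \<and> finite_measure M \<and> emeasure M (- K) = 0 \<and>
       (\<forall>f. continuous_on K f \<longrightarrow> (LINT t:K|M. f t) = cinner (functional_calculus A f \<xi>) \<xi>)"
      using sets_M finite_M null_K M by blast
    show "\<mu> = M" if "sets \<mu> = sets borel \<and> finite_measure \<mu> \<and> emeasure \<mu> (- K) = 0 \<and>
       (\<forall>f. continuous_on K f \<longrightarrow> (LINT t:K|\<mu>. f t) = cinner (functional_calculus A f \<xi>) \<xi>)" for \<mu>
      using that sets_M finite_M null_K M compact_imp_closed[OF compact_K]
      by (intro measure_eq_if_continuous_integrals_eq[of \<mu> K M]) auto
  qed
  then show ?thesis by (simp add: spectral_measure_def)
qed

text \<open>Orthogonality passes from polynomials to ramps by uniform approximation on K and from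
  ramps to half-lines by dominated convergence. Finiteness of M makes g integrable.\<close>

lemma orthogonal_to_polynomials:
  assumes g: "g \<in> L2_functions M"
    and orth: "\<And>p. cinner (W g) (W (\<lambda>t. poly p (complex_of_real t))) = 0"
  shows "W g = 0"
proof -
  have cont: "(LINT t|M. ramp q n t * g t) = 0" for q n
  proof -
    let ?f = "\<lambda>t. complex_of_real (ramp q n t)"
    have f: "continuous_on K ?f" by (intro continuous_on_of_real continuous_on_ramp)
    obtain B where B: "ess_bounded (ext ?f) B" by (rule ess_bounded_ext[OF f])
    obtain p where p: "uniform_limit K (\<lambda>k t. poly (p k) (complex_of_real t)) ?f sequentially"
      by (rule complex_Weierstrass[OF compact_K f])
    have lim: "(\<lambda>k. W (\<lambda>t. poly (p k) (complex_of_real t))) \<longlonglongrightarrow> W (ext ?f)"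
    proof (rule LIM_zero_cancel, rule Lim_null_comparison)
      show "(\<lambda>k. onorm (\<lambda>x. poly_operator (p k) A x - mult_op (ext ?f) x) * norm \<xi>) \<longlonglongrightarrow> 0"
        using tendsto_mult[OF poly_operator_tendsto[OF f p] tendsto_const, of "norm \<xi>"] by simp
      have "norm (W (\<lambda>t. poly (p k) (complex_of_real t)) - W (ext ?f))
          \<le> onorm (\<lambda>x. poly_operator (p k) A x - mult_op (ext ?f) x) * norm \<xi>" for k
      proof -
        obtain C where C: "ess_bounded (\<lambda>t. poly (p k) (complex_of_real t)) C"
          and pA: "poly_operator (p k) A = mult_op (\<lambda>t. poly (p k) (complex_of_real t))"
          by (rule poly_operator_A)
        have "bounded_linear (\<lambda>x. poly_operator (p k) A x - mult_op (ext ?f) x)"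
          by (intro bounded_linear_sub bounded_operators_linear mult_op_bounded[OF B]
              poly_operator_bounded_operators A_bounded)
        from onorm[OF this, of \<xi>] show ?thesis
          unfolding pA mult_op_\<xi>[OF C] mult_op_\<xi>[OF B] .
      qed
      then show "\<forall>\<^sub>F k in sequentially. norm (W (\<lambda>t. poly (p k) (complex_of_real t)) - W (ext ?f))
          \<le> onorm (\<lambda>x. poly_operator (p k) A x - mult_op (ext ?f) x) * norm \<xi>"
        by simp
    qed
    have "(\<lambda>k. cinner (W g) (W (\<lambda>t. poly (p k) (complex_of_real t)))) \<longlonglongrightarrow> cinner (W g) (W (ext ?f))"
      by (rule bounded_linear.tendsto[OF bounded_linear_cinner_right lim])
    then have "cinner (W g) (W (ext ?f)) = 0"
      unfolding orth by (simp add: LIMSEQ_const_iff)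
    then have "(LINT t|M. g t * cnj (ext ?f t)) = 0"
      by (simp add: W_inner[OF g ess_bounded_L2[OF B]])
    moreover have "(LINT t|M. g t * cnj (ext ?f t)) = (LINT t|M. ramp q n t * g t)"
    proof (rule integral_cong_AE)
      show "AE t in M. g t * cnj (ext ?f t) = ramp q n t * g t"
        using AE_K by eventually_elim (simp add: ext_def mult.commute)
      show "(\<lambda>t. g t * cnj (ext ?f t)) \<in> borel_measurable M"
        using L2_functions_integrable_mult[OF g ess_bounded_L2[OF B]] by simp
      show "(\<lambda>t. complex_of_real (ramp q n t) * g t) \<in> borel_measurable M"
        using L2_borel[OF g] by (simp add: measurable_M)
    qed
    ultimately show ?thesis by simp
  qed
  have gi: "integrable M g"
    using L2_functions_integrable_mult[OF g one_L2] by simp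
  have "AE t in M. g t = 0"
  proof (rule AE_zero_if_integral_half_lines_zero[OF sets_M gi])
    fix q
    have "(\<lambda>n. LINT t|M. ramp q n t * g t) \<longlonglongrightarrow> (LINT t|M. indicator {q<..} t * g t)"
    proof (rule integral_dominated_convergence[where w = "\<lambda>t. cmod (g t)"])
      have "(\<lambda>n. complex_of_real (ramp q n t) * g t) \<longlonglongrightarrow> complex_of_real (indicator {q<..} t) * g t" for t
        by (intro tendsto_mult tendsto_const tendsto_of_real ramp_tendsto)
      then show "AE t in M. (\<lambda>n. complex_of_real (ramp q n t) * g t) \<longlonglongrightarrow> indicator {q<..} t * g t"
        by (simp add: of_real_indicator)
      show "AE t in M. norm (complex_of_real (ramp q n t) * g t) \<le> cmod (g t)" for n
        using ramp_bounds[of q n] by (intro AE_I2) (simp add: norm_mult mult_left_le_one_le)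
    qed (use gi L2_borel[OF g] in \<open>auto simp: measurable_M\<close>)
    then show "(LINT t|M. indicator {q<..} t * g t) = 0"
      unfolding cont by (simp add: LIMSEQ_const_iff)
  qed
  then show ?thesis by (simp add: W_eq_0_iff[OF g])
qed

text \<open>Polynomials in A lie in the generated algebra, and applied to \<xi> they give the images
  of the polynomial functions. These form a subspace with trivial orthogonal complement.\<close>

lemma cyclic_vector_A: "cyclic_vector A \<xi>"
proof -
  define D where "D = range (\<lambda>p. W (\<lambda>t. poly p (complex_of_real t)))"
  have L2: "(\<lambda>t. poly p (complex_of_real t)) \<in> L2_functions M" for p
    by (rule poly_operator_A[of p]) (rule ess_bounded_L2)
  have "closure D = UNIV"
  proof (rule dense_subspace)
    have "W (\<lambda>t. poly 0 (complex_of_real t)) = 0" by (simp add: W_zero)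
    then show "0 \<in> D" unfolding D_def by (metis rangeI)
    show "x + y \<in> D" if xy: "x \<in> D" "y \<in> D" for x y
    proof -
      obtain p q where "x = W (\<lambda>t. poly p (complex_of_real t))" "y = W (\<lambda>t. poly q (complex_of_real t))"
        using xy by (auto simp: D_def)
      then have eq: "x + y = W (\<lambda>t. poly (p + q) (complex_of_real t))" by (simp add: W_add L2)
      show ?thesis unfolding eq D_def by (rule rangeI)
    qed
    show "c *\<^sub>C x \<in> D" if x: "x \<in> D" for c x
    proof -
      obtain p where "x = W (\<lambda>t. poly p (complex_of_real t))" using x by (auto simp: D_def)
      then have eq: "c *\<^sub>C x = W (\<lambda>t. poly (smult c p) (complex_of_real t))" by (simp add: W_scale L2)
      show ?thesis unfolding eq D_def by (rule rangeI)
    qed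
    show "total_family D"
      unfolding total_family_def
    proof (intro allI impI)
      fix x assume x: "\<forall>d\<in>D. cinner x d = 0"
      obtain g where g: "g \<in> L2_functions M" "x = W g" by (rule W_cases)
      show "x = 0"
        unfolding g(2) by (rule orthogonal_to_polynomials[OF g(1)]) (use x g(2) in \<open>auto simp: D_def\<close>)
    qed
  qed
  moreover have "D \<subseteq> (\<lambda>B. B \<xi>) ` generated_cstar_algebra A"
  proof
    fix x assume "x \<in> D"
    then obtain p where p: "x = W (\<lambda>t. poly p (complex_of_real t))" by (auto simp: D_def)
    obtain C where C: "ess_bounded (\<lambda>t. poly p (complex_of_real t)) C"
      and pA: "poly_operator p A = mult_op (\<lambda>t. poly p (complex_of_real t))"
      by (rule poly_operator_A)
    have "x = poly_operator p A \<xi>" unfolding p pA mult_op_\<xi>[OF C] ..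
    then show "x \<in> (\<lambda>B. B \<xi>) ` generated_cstar_algebra A"
      using poly_operator_in_generated by (rule image_eqI)
  qed
  then have "closure D \<subseteq> closure ((\<lambda>B. B \<xi>) ` generated_cstar_algebra A)" by (rule closure_mono)
  ultimately show ?thesis by (auto simp: cyclic_vector_def)
qed

text \<open>W is specified only on functions measurable for M; a function measurable for the
  completion is first replaced by such a representative.\<close>

definition U :: "(real \<Rightarrow> complex) \<Rightarrow> 'a" where
  "U g = W (SOME g'. g' \<in> L2_functions M \<and> (AE t in M. g t = g' t))"

lemma U_eq:
  assumes g': "g' \<in> L2_functions M" "AE t in M. g t = g' t"
  shows "U g = W g'"
proof -
  let ?h = "SOME g'. g' \<in> L2_functions M \<and> (AE t in M. g t = g' t)"
  have "\<exists>g'. g' \<in> L2_functions M \<and> (AE t in M. g t = g' t)" using g' by blast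
  from someI_ex[OF this] have h: "?h \<in> L2_functions M" "AE t in M. g t = ?h t" by blast+
  from h(2) g'(2) have "AE t in M. ?h t = g' t" by eventually_elim simp
  then show ?thesis unfolding U_def by (simp add: W_eq_iff[OF h(1) g'(1)])
qed

text \<open>This existence result makes the choice in \<open>L2_calculus_vector\<close> an actual
  cyclic unitary.\<close>

lemma cyclic_unitary_U: "cyclic_unitary A \<xi> U"
  unfolding cyclic_unitary_def Let_def spectral_measure_A real_spectrum_A
proof (intro conjI ballI allI impI)
  fix g h assume "g \<in> L2_functions (completion M)" "h \<in> L2_functions (completion M)"
  then obtain g' h' where g': "g' \<in> L2_functions M" "AE t in M. g t = g' t"
    and h': "h' \<in> L2_functions M" "AE t in M. h t = h' t"
    by (auto simp: L2_functions_completion_iff)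
  note gm = borel_measurable_completion_cong_AE[OF L2_functions_measurable[OF g'(1)] g'(2)]
  note hm = borel_measurable_completion_cong_AE[OF L2_functions_measurable[OF h'(1)] h'(2)]
  note gm' = L2_functions_measurable[OF g'(1)] and hm' = L2_functions_measurable[OF h'(1)]
  have "AE t in M. g t + h t = g' t + h' t" using g'(2) h'(2) by eventually_elim simp
  then show "U (\<lambda>t. g t + h t) = U g + U h"
    using U_eq[OF L2_functions_add[OF g'(1) h'(1)]] U_eq[OF g'] U_eq[OF h'] W_add[OF g'(1) h'(1)]
    by simp
  have "(LINT t|completion M. g t * cnj (h t)) = (LINT t|completion M. g' t * cnj (h' t))"
  proof (rule integral_cong_AE)
    show "AE t in completion M. g t * cnj (h t) = g' t * cnj (h' t)"
      using AE_completion[OF g'(2)] AE_completion[OF h'(2)] by eventually_elim simp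
  qed (use gm hm gm' hm' in \<open>auto intro!: borel_measurable_times borel_measurable_cnj measurable_completion\<close>)
  also have "\<dots> = (LINT t|M. g' t * cnj (h' t))"
    using gm' hm' by (intro integral_completion borel_measurable_times borel_measurable_cnj)
  finally show "cinner (U g) (U h) = (LINT t|completion M. g t * cnj (h t))"
    by (simp add: U_eq[OF g'] U_eq[OF h'] W_inner[OF g'(1) h'(1)])
next
  fix c g assume "g \<in> L2_functions (completion M)"
  then obtain g' where g': "g' \<in> L2_functions M" "AE t in M. g t = g' t"
    by (auto simp: L2_functions_completion_iff)
  have "AE t in M. c * g t = c * g' t" using g'(2) by eventually_elim simp
  then show "U (\<lambda>t. c * g t) = c *\<^sub>C U g"
    using U_eq[OF L2_functions_scale[OF g'(1)]] U_eq[OF g'] W_scale[OF g'(1)] by simp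
next
  have "x \<in> U ` L2_functions (completion M)" for x
  proof -
    obtain g where g: "g \<in> L2_functions M" "x = W g" by (rule W_cases)
    then have "x = U g" using U_eq[OF g(1), of g] by simp
    moreover have "g \<in> L2_functions (completion M)"
      unfolding L2_functions_completion_iff using g(1) by auto
    ultimately show ?thesis by (rule image_eqI)
  qed
  then show "U ` L2_functions (completion M) = UNIV" by auto
next
  fix f :: "real \<Rightarrow> complex" assume f: "continuous_on K f"
  obtain B where B: "ess_bounded (ext f) B" by (rule ess_bounded_ext[OF f])
  have "AE t in M. f t = ext f t" using AE_K by eventually_elim (simp add: ext_def)
  then show "U f = functional_calculus A f \<xi>"
    unfolding functional_calculus_\<xi>[OF f] by (rule U_eq[OF ess_bounded_L2[OF B]])
qed

text \<open>The vector y is forced, so the content is that g(1/t) is again square-integrable and has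
  a nonzero image. Invariance of M under inversion gives both; of the chosen unitary only the
  isometry is used.\<close>

lemma lebesgue_inversion_condition_A:
  assumes inv: "distr M borel inverse = M"
  shows "lebesgue_inversion_condition A \<xi>"
  unfolding lebesgue_inversion_condition_def Let_def spectral_measure_A L2_calculus_vector_def
proof (intro allI ballI impI)
  define V where "V = (SOME U. cyclic_unitary A \<xi> U)"
  have "cyclic_unitary A \<xi> V" unfolding V_def by (rule someI[where P = "cyclic_unitary A \<xi>", OF cyclic_unitary_U])
  then have V: "\<And>g. g \<in> L2_functions (completion M) \<Longrightarrow>
      cinner (V g) (V g) = (LINT t|completion M. g t * cnj (g t))"
    unfolding cyclic_unitary_def Let_def spectral_measure_A by blast
  fix x g
  assume g: "g \<in> L2_functions (completion M)"
    and "x \<noteq> 0 \<and> \<not> (AE t in completion M. g t = 0) \<and> x = (SOME U. cyclic_unitary A \<xi> U) g"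
  then have nz: "\<not> (AE t in M. g t = 0)" by (simp add: AE_completion_iff)
  have [measurable]: "inverse \<in> measurable M borel" by (simp add: measurable_M)
  have AE_inv: "AE t in M. P (inverse t)" if "AE t in M. P t" for P
  proof -
    have "AE t in distr M borel inverse. P t" unfolding inv by (rule that)
    then show ?thesis by (rule AE_distrD[rotated]) measurable
  qed
  obtain g' where g': "g' \<in> L2_functions M" "AE t in M. g t = g' t"
    using g by (auto simp: L2_functions_completion_iff)
  have [measurable]: "g' \<in> borel_measurable borel" by (rule L2_borel[OF g'(1)])
  have "integrable (distr M borel inverse) (\<lambda>t. (cmod (g' t))\<^sup>2)"
    unfolding inv by (rule L2_functions_integrable_sq[OF g'(1)])
  then have "integrable M (\<lambda>t. (cmod (g' (inverse t)))\<^sup>2)"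
    by (subst (asm) integrable_distr_eq) auto
  then have "(\<lambda>t. g' (inverse t)) \<in> L2_functions M"
    by (simp add: L2_functions_def measurable_M)
  then have gi: "(\<lambda>t. g (inverse t)) \<in> L2_functions (completion M)"
    unfolding L2_functions_completion_iff
    by (rule bexI[where x = "\<lambda>t. g' (inverse t)", rotated]) (rule AE_inv[OF g'(2)])
  have "V (\<lambda>t. g (inverse t)) \<noteq> 0"
  proof
    assume "V (\<lambda>t. g (inverse t)) = 0"
    then have "(LINT t|completion M. (cmod (g (inverse t)))\<^sup>2) = 0"
      using V[OF gi] by (simp add: integral_mult_cnj_self)
    then have "AE t in completion M. (cmod (g (inverse t)))\<^sup>2 = 0"
      using gi by (subst (asm) integral_nonneg_eq_0_iff_AE) (auto simp: L2_functions_def)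
    then have "AE t in M. g (inverse t) = 0" by (simp add: AE_completion_iff)
    \<comment> \<open>Inverting once more returns to g, since \<open>inverse\<close> is an
      involution on all reals, 0 included.\<close>
    from AE_inv[OF this] show False using nz by simp
  qed
  then show "\<exists>!y. y \<noteq> 0 \<and> (\<lambda>t. g (inverse t)) \<in> L2_functions (completion M) \<and>
      y = (SOME U. cyclic_unitary A \<xi> U) (\<lambda>t. g (inverse t))"
    using gi unfolding V_def[symmetric] by auto
qed

end

section \<open>Change of variables\<close>

text \<open>By the fundamental theorem of calculus, both measures give a half-line the increment of
  a over its preimage. Extended real endpoints cover the whole line, needed for the arctangent sum,
  as well as the bounded interval needed for \<open>ln\<close>.\<close>

lemma distr_density_derivative:
  fixes a b :: "real \<Rightarrow> real" and \<alpha> \<beta> :: ereal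
  assumes \<alpha>\<beta>: "\<alpha> < \<beta>"
    and [measurable]: "a \<in> borel_measurable borel" "b \<in> borel_measurable borel"
    and deriv: "\<And>t. \<alpha> < ereal t \<Longrightarrow> ereal t < \<beta> \<Longrightarrow> DERIV a t :> b t"
    and cont: "\<And>t. \<alpha> < ereal t \<Longrightarrow> ereal t < \<beta> \<Longrightarrow> isCont b t"
    and nonneg: "\<And>t. \<alpha> < ereal t \<Longrightarrow> ereal t < \<beta> \<Longrightarrow> 0 \<le> b t"
    and mono: "\<And>s t. s \<in> einterval \<alpha> \<beta> \<Longrightarrow> t \<in> einterval \<alpha> \<beta> \<Longrightarrow> a s < a t \<longleftrightarrow> s < t"
    and image: "a ` einterval \<alpha> \<beta> = {L<..<R}"
    and LR: "L < R"
    and limL: "((a \<circ> real_of_ereal) \<longlongrightarrow> L) (at_right \<alpha>)"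
    and limR: "((a \<circ> real_of_ereal) \<longlongrightarrow> R) (at_left \<beta>)"
  shows "distr (density lborel (\<lambda>t. ennreal (indicator (einterval \<alpha> \<beta>) t * b t))) borel a
    = density lborel (\<lambda>y. ennreal (indicator {L<..<R} y))"
proof (rule measure_eqI_lessThan)
  \<comment> \<open>The left endpoint varies: it is \<alpha> if x lies below the range of a, and the
    preimage of x if x lies inside the range.\<close>
  have FTC: "(\<integral>\<^sup>+t. ennreal (indicator (einterval \<gamma> \<beta>) t * b t) \<partial>lborel) = ennreal (R - l)"
    if \<gamma>: "\<alpha> \<le> \<gamma>" "\<gamma> < \<beta>" and l: "((a \<circ> real_of_ereal) \<longlongrightarrow> l) (at_right \<gamma>)" for \<gamma> l
  proof -
    have int: "set_integrable lborel (einterval \<gamma> \<beta>) b" "(LBINT t=\<gamma>..\<beta>. b t) = R - l"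
      using interval_integral_FTC_nonneg[OF \<gamma>(2), of a b l R] deriv cont nonneg l limR \<gamma>(1)
      by (auto dest: order_le_less_trans)
    have "(\<integral>\<^sup>+t. ennreal (indicator (einterval \<gamma> \<beta>) t * b t) \<partial>lborel)
        = ennreal (LBINT t. indicator (einterval \<gamma> \<beta>) t * b t)"
    proof (rule nn_integral_eq_integral)
      show "integrable lborel (\<lambda>t. indicator (einterval \<gamma> \<beta>) t * b t)"
        using int(1) by (simp add: set_integrable_def)
      show "AE t in lborel. 0 \<le> indicator (einterval \<gamma> \<beta>) t * b t"
        using nonneg \<gamma>(1) by (intro AE_I2) (auto simp: indicator_def einterval_def dest: order_le_less_trans)
    qed
    also have "(LBINT t. indicator (einterval \<gamma> \<beta>) t * b t) = R - l"
      using int(2) less_imp_le[OF \<gamma>(2)] by (simp add: interval_lebesgue_integral_def set_lebesgue_integral_def)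
    finally show ?thesis .
  qed
  fix x
  have [measurable]: "einterval \<alpha> \<beta> \<in> sets borel" by simp
  have lhs: "emeasure (distr (density lborel (\<lambda>t. ennreal (indicator (einterval \<alpha> \<beta>) t * b t))) borel a) {x<..}
      = (\<integral>\<^sup>+t. ennreal (indicator {t \<in> einterval \<alpha> \<beta>. x < a t} t * b t) \<partial>lborel)"
    using measurable_sets[of a borel borel "{x<..}"]
    by (subst emeasure_distr, simp, simp, subst emeasure_density)
      (auto intro!: nn_integral_cong simp: indicator_def)
  have rhs: "emeasure (density lborel (\<lambda>y. ennreal (indicator {L<..<R} y))) {x<..}
      = emeasure lborel ({L<..<R} \<inter> {x<..})"
    by (subst emeasure_density)
      (auto simp: indicator_def nn_integral_indicator[symmetric] simp del: nn_integral_indicator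
        intro!: nn_integral_cong)
  have bnd: "L < a t" "a t < R" if "t \<in> einterval \<alpha> \<beta>" for t
    using image that by (metis greaterThanLessThan_iff imageI)+
  have "emeasure (distr (density lborel (\<lambda>t. ennreal (indicator (einterval \<alpha> \<beta>) t * b t))) borel a) {x<..}
      = emeasure lborel ({L<..<R} \<inter> {x<..})
    \<and> emeasure lborel ({L<..<R} \<inter> {x<..}) < \<infinity>"
  proof -
    consider "x \<le> L" | "L < x" "x < R" | "R \<le> x" by linarith
    then show ?thesis
    proof cases
      case 1
      then have "{t \<in> einterval \<alpha> \<beta>. x < a t} = einterval \<alpha> \<beta>" using bnd by force
      moreover have "{L<..<R} \<inter> {x<..} = {L<..<R}" using 1 by auto
      ultimately show ?thesis using FTC[OF order_refl \<alpha>\<beta> limL] LR by (simp add: lhs)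
    next
      case 2
      then have "x \<in> a ` einterval \<alpha> \<beta>" by (simp add: image)
      then obtain s where s: "s \<in> einterval \<alpha> \<beta>" "a s = x" by auto
      then have s': "\<alpha> < ereal s" "ereal s < \<beta>" by (auto simp: einterval_def)
      have eq: "{t \<in> einterval \<alpha> \<beta>. x < a t} = einterval (ereal s) \<beta>"
      proof (intro set_eqI iffI)
        fix t assume "t \<in> {t \<in> einterval \<alpha> \<beta>. x < a t}"
        then show "t \<in> einterval (ereal s) \<beta>"
          using mono[OF s(1), of t] s(2) by (auto simp: einterval_def)
      next
        fix t assume t: "t \<in> einterval (ereal s) \<beta>"
        then have "t \<in> einterval \<alpha> \<beta>"
          using s'(1) by (auto simp: einterval_def intro: less_trans)
        then show "t \<in> {t \<in> einterval \<alpha> \<beta>. x < a t}"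
          using mono[OF s(1), of t] s(2) t by (auto simp: einterval_def)
      qed
      have "isCont a s" using deriv[OF s'] by (rule DERIV_isCont)
      then have "(a \<longlongrightarrow> a s) (at_right s)"
        using continuous_at_imp_continuous_at_within continuous_within by blast
      then have "((a \<circ> real_of_ereal) \<longlongrightarrow> x) (at_right (ereal s))"
        by (simp add: ereal_tendsto_simps s(2))
      moreover have "{L<..<R} \<inter> {x<..} = {x<..<R}" using 2 by auto
      ultimately show ?thesis
        using FTC[OF less_imp_le[OF s'(1)] s'(2)] 2 by (simp add: lhs eq)
    next
      case 3
      then have "{t \<in> einterval \<alpha> \<beta>. x < a t} = {}" "{L<..<R} \<inter> {x<..} = {}"
        using bnd by force+
      then show ?thesis by (simp add: lhs)
    qed
  qed
  then show "emeasure (distr (density lborel (\<lambda>t. ennreal (indicator (einterval \<alpha> \<beta>) t * b t))) borel a) {x<..} < \<infinity>"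
    "emeasure (distr (density lborel (\<lambda>t. ennreal (indicator (einterval \<alpha> \<beta>) t * b t))) borel a) {x<..}
      = emeasure (density lborel (\<lambda>y. ennreal (indicator {L<..<R} y))) {x<..}"
    by (simp_all add: rhs)
qed auto

section \<open>Sums of shifted arctangents\<close>

lemma tendsto_arctan_shift:
  "((\<lambda>t. arctan (d + t)) \<longlongrightarrow> pi / 2) at_top" "((\<lambda>t. arctan (d + t)) \<longlongrightarrow> - (pi / 2)) at_bot"
proof -
  have "filterlim (\<lambda>t. d + t) at_top at_top" "filterlim (\<lambda>t. d + t) at_bot at_bot"
    by (simp_all add: filterlim_tendsto_add_at_top_iff[OF tendsto_const]
        filterlim_tendsto_add_at_bot_iff[OF tendsto_const] filterlim_ident)
  then show "((\<lambda>t. arctan (d + t)) \<longlongrightarrow> pi / 2) at_top" "((\<lambda>t. arctan (d + t)) \<longlongrightarrow> - (pi / 2)) at_bot"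
    by (auto intro: filterlim_compose[OF tendsto_arctan_at_top] filterlim_compose[OF tendsto_arctan_at_bot])
qed

text \<open>For suitable shifts d this is the logarithm of the weight of the n-th power, and also
  that of its absolute value. Arbitrary shifts are allowed because monotonicity and range do not
  depend on them.\<close>

definition arctan_sum :: "(nat \<Rightarrow> real) \<Rightarrow> nat \<Rightarrow> real \<Rightarrow> real" where
  "arctan_sum d n t = (\<Sum>k<n. arctan (d k + t))"

definition arctan_sum_deriv :: "(nat \<Rightarrow> real) \<Rightarrow> nat \<Rightarrow> real \<Rightarrow> real" where
  "arctan_sum_deriv d n t = (\<Sum>k<n. inverse (1 + (d k + t)\<^sup>2))"

lemma DERIV_arctan_sum: "DERIV (arctan_sum d n) t :> arctan_sum_deriv d n t"
  unfolding arctan_sum_def arctan_sum_deriv_def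
  by (rule DERIV_sum) (auto intro!: derivative_eq_intros)

lemma one_plus_power2_nonzero: "1 + (x::real)\<^sup>2 \<noteq> 0"
  using zero_le_power2[of x] by linarith

lemma isCont_arctan_sum_deriv: "isCont (arctan_sum_deriv d n) t"
  unfolding arctan_sum_deriv_def
  by (intro continuous_intros) (simp_all add: one_plus_power2_nonzero)

lemma arctan_sum_deriv_pos: "0 < n \<Longrightarrow> 0 < arctan_sum_deriv d n t"
  unfolding arctan_sum_deriv_def by (intro sum_pos) (auto intro: add_pos_nonneg)

lemma arctan_sum_less_iff: "0 < n \<Longrightarrow> arctan_sum d n s < arctan_sum d n t \<longleftrightarrow> s < t"
proof -
  assume n: "0 < n"
  have mono: "arctan_sum d n s < arctan_sum d n t" if "s < t" for s t
    unfolding arctan_sum_def using n that by (intro sum_strict_mono) (auto simp: arctan_less_iff)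
  show ?thesis using mono[of s t] mono[of t s] by (metis linorder_neqE_linordered_idom order_less_asym)
qed

lemma arctan_sum_tendsto:
  "(arctan_sum d n \<longlongrightarrow> real n * (pi / 2)) at_top"
  "(arctan_sum d n \<longlongrightarrow> - (real n * (pi / 2))) at_bot"
  using tendsto_sum[of "{..<n}" "\<lambda>k t. arctan (d k + t)" "\<lambda>_. pi / 2" at_top]
    tendsto_sum[of "{..<n}" "\<lambda>k t. arctan (d k + t)" "\<lambda>_. - (pi / 2)" at_bot]
  by (simp_all add: arctan_sum_def[abs_def] tendsto_arctan_shift)

lemma abs_arctan_sum_le: "\<bar>arctan_sum d n t\<bar> \<le> real n * (pi / 2)"
proof -
  have "\<bar>arctan_sum d n t\<bar> \<le> (\<Sum>k<n. \<bar>arctan (d k + t)\<bar>)"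
    unfolding arctan_sum_def by (rule sum_abs)
  also have "\<dots> \<le> (\<Sum>k<n. pi / 2)"
  proof (intro sum_mono)
    show "\<bar>arctan (d k + t)\<bar> \<le> pi / 2" for k
      using arctan_bounded[of "d k + t"] by linarith
  qed
  finally show ?thesis by simp
qed

lemma range_arctan_sum:
  assumes n: "0 < n"
  shows "range (arctan_sum d n) = {- (real n * (pi / 2))<..<real n * (pi / 2)}"
proof (intro set_eqI iffI)
  fix y assume "y \<in> range (arctan_sum d n)"
  then obtain t where t: "y = arctan_sum d n t" by auto
  \<comment> \<open>The available bound on the sum is not strict; comparing with the values at t - 1
    and t + 1 makes it strict.\<close>
  have "arctan_sum d n (t - 1) < y" "y < arctan_sum d n (t + 1)"
    unfolding t by (simp_all add: arctan_sum_less_iff[OF n])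
  then show "y \<in> {- (real n * (pi / 2))<..<real n * (pi / 2)}"
    using abs_arctan_sum_le[of d n "t - 1"] abs_arctan_sum_le[of d n "t + 1"] by (simp add: abs_le_iff) linarith
next
  fix y assume y: "y \<in> {- (real n * (pi / 2))<..<real n * (pi / 2)}"
  obtain t where t: "y < arctan_sum d n t"
    using order_tendstoD(1)[OF arctan_sum_tendsto(1), of y n d] y eventually_happens by fastforce
  obtain s where s: "arctan_sum d n s < y"
    using order_tendstoD(2)[OF arctan_sum_tendsto(2), of n y d] y eventually_happens by fastforce
  have "s < t" using s t arctan_sum_less_iff[OF n, of d s t] by simp
  have "\<exists>x\<ge>s. x \<le> t \<and> arctan_sum d n x = y"
    by (rule IVT) (use s t \<open>s < t\<close> DERIV_isCont[OF DERIV_arctan_sum] in auto)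
  then show "y \<in> range (arctan_sum d n)" by auto
qed

lemma borel_measurable_arctan_sum [measurable]:
  "arctan_sum d n \<in> borel_measurable borel" "arctan_sum_deriv d n \<in> borel_measurable borel"
  using DERIV_isCont[OF DERIV_arctan_sum] isCont_arctan_sum_deriv
  by (auto intro!: borel_measurable_continuous_onI continuous_at_imp_continuous_on)

text \<open>Taken as an image under exp, so that inversion becomes reflection of the interval (-c,
  c).\<close>

definition log_uniform :: "real \<Rightarrow> real measure" where
  "log_uniform c = distr (density lborel (\<lambda>y. ennreal (indicator {- c<..<c} y))) borel exp"

definition log_density :: "real \<Rightarrow> real \<Rightarrow> real" where
  "log_density c x = indicator {exp (- c)<..<exp c} x / x"

text \<open>Only the range of the sum enters the image measure, so it depends on n and not on the
  shifts. This is why the translation parameter leaves no trace in the spectral measure.\<close>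

lemma distr_arctan_sum:
  assumes n: "0 < n"
  shows "distr (density lborel (\<lambda>t. ennreal (arctan_sum_deriv d n t))) borel (\<lambda>t. exp (arctan_sum d n t))
    = log_uniform (real n * (pi / 2))"
proof -
  have "distr (density lborel (\<lambda>t. ennreal (indicator (einterval (-\<infinity>) \<infinity>) t * arctan_sum_deriv d n t)))
      borel (arctan_sum d n)
    = density lborel (\<lambda>y. ennreal (indicator {- (real n * (pi / 2))<..<real n * (pi / 2)} y))"
  proof (rule distr_density_derivative)
    show "arctan_sum d n ` einterval (-\<infinity>) \<infinity> = {- (real n * (pi / 2))<..<real n * (pi / 2)}"
      using range_arctan_sum[OF n] by (simp add: einterval_def)
    show "((arctan_sum d n \<circ> real_of_ereal) \<longlongrightarrow> - (real n * (pi / 2))) (at_right (- \<infinity>))"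
      unfolding ereal_tendsto_simps by (rule arctan_sum_tendsto)
    show "((arctan_sum d n \<circ> real_of_ereal) \<longlongrightarrow> real n * (pi / 2)) (at_left \<infinity>)"
      unfolding ereal_tendsto_simps by (rule arctan_sum_tendsto)
  qed (use n in \<open>auto simp: DERIV_arctan_sum isCont_arctan_sum_deriv arctan_sum_less_iff
      less_imp_le[OF arctan_sum_deriv_pos]\<close>)
  then have *: "distr (density lborel (\<lambda>t. ennreal (arctan_sum_deriv d n t))) borel (arctan_sum d n)
    = density lborel (\<lambda>y. ennreal (indicator {- (real n * (pi / 2))<..<real n * (pi / 2)} y))"
    by (simp add: einterval_def)
  show ?thesis
    unfolding log_uniform_def *[symmetric] by (subst distr_distr) (auto simp: o_def)
qed

text \<open>The derivative of \<open>ln\<close> is 1/x, so the change of variables along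
  \<open>ln\<close> sends the density to Lebesgue measure on (-c, c), and \<open>exp\<close> brings
  it back.\<close>

lemma log_uniform_density:
  assumes c: "0 < c"
  shows "log_uniform c = density lborel (\<lambda>x. ennreal (indicator {0..} x * log_density c x))"
proof -
  let ?N = "density lborel (\<lambda>x. ennreal (indicator {0..} x * log_density c x))"
  have eq: "indicator {0..} x * log_density c x
      = indicator (einterval (ereal (exp (- c))) (ereal (exp c))) x * inverse x" for x
    by (auto simp: log_density_def indicator_def einterval_def divide_inverse
        intro: order_trans[OF less_imp_le[OF exp_gt_zero]] dest: less_imp_le)
  have pos: "0 < t" if "exp (- c) < t" for t using less_trans[OF exp_gt_zero that] .
  have "distr ?N borel ln = density lborel (\<lambda>y. ennreal (indicator {- c<..<c} y))"
    unfolding eq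
  proof (rule distr_density_derivative)
    show "ln ` einterval (ereal (exp (- c))) (ereal (exp c)) = {- c<..<c}"
    proof (intro set_eqI iffI)
      fix y assume "y \<in> ln ` einterval (ereal (exp (- c))) (ereal (exp c))"
      then obtain x where x: "exp (- c) < x" "x < exp c" "y = ln x" by (auto simp: einterval_def)
      then show "y \<in> {- c<..<c}" using pos[OF x(1)] ln_less_cancel_iff[of "exp (- c)" x]
          ln_less_cancel_iff[of x "exp c"] by simp
    next
      fix y assume "y \<in> {- c<..<c}"
      then show "y \<in> ln ` einterval (ereal (exp (- c))) (ereal (exp c))"
        by (intro image_eqI[of _ _ "exp y"]) (auto simp: einterval_def)
    qed
    show "((ln \<circ> real_of_ereal) \<longlongrightarrow> - c) (at_right (ereal (exp (- c))))"
      unfolding ereal_tendsto_simps by (rule tendsto_eq_rhs[OF tendsto_ln[OF tendsto_ident_at]]) auto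
    show "((ln \<circ> real_of_ereal) \<longlongrightarrow> c) (at_left (ereal (exp c)))"
      unfolding ereal_tendsto_simps by (rule tendsto_eq_rhs[OF tendsto_ln[OF tendsto_ident_at]]) auto
  qed (use c pos in \<open>auto simp: einterval_def intro!: derivative_eq_intros continuous_intros
        less_imp_le simp: inverse_eq_divide\<close>)
  then have "log_uniform c = distr (distr ?N borel ln) borel exp"
    by (simp add: log_uniform_def)
  also have "\<dots> = distr ?N borel (\<lambda>x. exp (ln x))"
    by (subst distr_distr) (auto simp: o_def)
  also have "\<dots> = distr ?N borel (\<lambda>x. x)"
  proof (rule distr_cong_AE)
    \<comment> \<open>The identity requires x > 0; elsewhere the density vanishes.\<close>
    show "AE x in ?N. exp (ln x) = x"
      by (subst AE_density)
        (auto simp: log_density_def indicator_def intro!: AE_I2 dest: pos split: if_splits)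
  qed auto
  also have "\<dots> = ?N"
    by (rule distr_id2) simp
  finally show ?thesis .
qed

lemma sets_log_uniform: "sets (log_uniform c) = sets borel"
  by (simp add: log_uniform_def)

lemma emeasure_log_uniform:
  assumes [measurable]: "S \<in> sets borel"
  shows "emeasure (log_uniform c) S = emeasure lborel ({- c<..<c} \<inter> exp -` S)"
proof -
  have [measurable]: "exp -` S \<in> sets borel"
    using measurable_sets[of exp borel borel S] by simp
  have "emeasure (log_uniform c) S = (\<integral>\<^sup>+y. ennreal (indicator {- c<..<c} y) * indicator (exp -` S) y \<partial>lborel)"
    unfolding log_uniform_def by (subst emeasure_distr) (auto simp: emeasure_density)
  also have "\<dots> = (\<integral>\<^sup>+y. indicator ({- c<..<c} \<inter> exp -` S) y \<partial>lborel)"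
    by (intro nn_integral_cong) (auto simp: indicator_def)
  finally show ?thesis by simp
qed

lemma finite_measure_log_uniform:
  assumes "0 < c"
  shows "finite_measure (log_uniform c)"
proof (rule finite_measureI)
  have "emeasure (log_uniform c) UNIV = ennreal (2 * c)"
    using assms by (subst emeasure_log_uniform) auto
  then show "emeasure (log_uniform c) (space (log_uniform c)) \<noteq> \<infinity>"
    using sets_eq_imp_space_eq[OF sets_log_uniform, of c] by simp
qed

lemma log_uniform_null: "emeasure (log_uniform c) (- {exp (- c)..exp c}) = 0"
proof -
  have "{- c<..<c} \<inter> exp -` (- {exp (- c)..exp c}) = {}" by auto
  then show ?thesis by (subst emeasure_log_uniform) auto
qed

text \<open>As t may be an endpoint, ln t is only known to lie in the closure of (-c, c). The open
  preimage of the neighbourhood still meets (-c, c), and the intersection contains a ball.\<close>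

lemma log_uniform_support:
  assumes c: "0 < c" and t: "t \<in> {exp (- c)..exp c}" and e: "0 < e"
  shows "emeasure (log_uniform c) {t - e<..<t + e} \<noteq> 0"
proof -
  let ?E = "exp -` {t - e<..<t + e} :: real set"
  have oE: "open ?E" by (intro open_vimage continuous_intros open_greaterThanLessThan)
  have tpos: "0 < t" using t less_le_trans[OF exp_gt_zero] by auto
  then have "ln t \<in> ?E \<inter> {- c..c}"
    using t e ln_le_cancel_iff[of "exp (- c)" t] ln_le_cancel_iff[of t "exp c"] by simp
  then have "?E \<inter> closure {- c<..<c} \<noteq> {}"
    using c by (auto simp: closure_greaterThanLessThan)
  then have "?E \<inter> {- c<..<c} \<noteq> {}"
    using open_Int_closure_eq_empty[OF oE] by blast
  then obtain s where "s \<in> {- c<..<c} \<inter> ?E" by blast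
  then obtain d where d: "0 < d" "ball s d \<subseteq> {- c<..<c} \<inter> ?E"
    using openE[OF open_Int[OF open_greaterThanLessThan oE]] by blast
  have "0 < emeasure lborel {s - d<..<s + d}" using d(1) by simp
  also have "\<dots> \<le> emeasure lborel ({- c<..<c} \<inter> ?E)"
  proof (rule emeasure_mono)
    show "{s - d<..<s + d} \<subseteq> {- c<..<c} \<inter> ?E"
      using d(2) by (simp add: ball_eq_greaterThanLessThan)
    show "{- c<..<c} \<inter> ?E \<in> sets lborel"
      using open_Int[OF open_greaterThanLessThan oE] by simp
  qed
  finally show ?thesis by (subst emeasure_log_uniform) auto
qed

text \<open>Since 1 / exp y = exp (- y), the claim reduces to the reflection invariance of Lebesgue
  measure on (-c, c).\<close>

lemma distr_log_uniform_inverse: "distr (log_uniform c) borel inverse = log_uniform c"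
proof -
  let ?i = "\<lambda>y. ennreal (indicator {- c<..<c} y)"
  have "density lborel ?i = density (distr lborel borel uminus) ?i"
    by (simp add: lborel_distr_uminus)
  also have "\<dots> = distr (density lborel (\<lambda>y. ?i (- y))) borel uminus"
    by (rule density_distr) auto
  also have "(\<lambda>y. ?i (- y)) = ?i" by (auto simp: indicator_def fun_eq_iff)
  finally have R: "distr (density lborel ?i) borel uminus = density lborel ?i" ..
  have "distr (log_uniform c) borel inverse = distr (density lborel ?i) borel (\<lambda>y. exp (- y))"
    unfolding log_uniform_def by (subst distr_distr) (auto simp: o_def exp_minus)
  also have "\<dots> = distr (distr (density lborel ?i) borel uminus) borel exp"
    by (subst distr_distr) (auto simp: o_def)
  also have "\<dots> = log_uniform c" by (simp add: R log_uniform_def)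
  finally show ?thesis .
qed

text \<open>Both sides are x on the interval, which inversion maps to itself, and 0 off it.\<close>

lemma log_density_inverse:
  assumes "0 < x"
  shows "x\<^sup>2 * log_density c x = log_density c (inverse x)"
proof -
  have "exp (- c) < inverse x \<longleftrightarrow> x < exp c"
    using assms by (simp add: exp_minus)
  moreover have "inverse x < exp c \<longleftrightarrow> exp (- c) < x"
    using assms inverse_less_iff_less[of x "exp (- c)"] by (simp add: exp_minus)
  ultimately show ?thesis
    using assms by (auto simp: log_density_def indicator_def power2_eq_square divide_inverse)
qed

section \<open>Weighted translations\<close>

context L2_unitary
begin

text \<open>The factor sqrt b compensates the density, so the new map is isometric; it is onto
  because \<phi> has the measurable left inverse \<psi>. It sends the constant 1 to the image of
  sqrt b under W, the later cyclic vector.\<close>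

lemma L2_unitary_pushforward:
  assumes b [measurable]: "b \<in> borel_measurable borel" and b_pos: "\<And>t. 0 < b t"
    and [measurable]: "\<phi> \<in> borel_measurable borel" "\<psi> \<in> borel_measurable borel"
    and \<psi>: "\<And>t. \<psi> (\<phi> t) = t"
  shows "L2_unitary (distr (density M (\<lambda>t. ennreal (b t))) borel \<phi>)
    (\<lambda>g. W (\<lambda>t. complex_of_real (sqrt (b t)) * g (\<phi> t)))"
proof -
  note [measurable_cong] = sets_M
  let ?N = "distr (density M (\<lambda>t. ennreal (b t))) borel \<phi>"
  let ?r = "\<lambda>g t. complex_of_real (sqrt (b t)) * g (\<phi> t)"
  have sq: "(cmod (?r g t))\<^sup>2 = b t * (cmod (g (\<phi> t)))\<^sup>2" for g t
    using b_pos[of t] by (simp add: norm_mult power_mult_distrib)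
  \<comment> \<open>An equivalence, because surjectivity needs the direction from M back to the
    image measure.\<close>
  have r_iff: "?r g \<in> L2_functions M \<longleftrightarrow> g \<in> L2_functions ?N" if [measurable]: "g \<in> borel_measurable borel" for g
  proof -
    have "integrable ?N (\<lambda>t. (cmod (g t))\<^sup>2)
        \<longleftrightarrow> integrable (density M (\<lambda>t. ennreal (b t))) (\<lambda>t. (cmod (g (\<phi> t)))\<^sup>2)"
      by (intro integrable_distr_eq) auto
    also have "\<dots> \<longleftrightarrow> integrable M (\<lambda>t. b t *\<^sub>R (cmod (g (\<phi> t)))\<^sup>2)"
      by (intro integrable_density) (auto intro: less_imp_le b_pos)
    also have "\<dots> \<longleftrightarrow> integrable M (\<lambda>t. (cmod (?r g t))\<^sup>2)" by (simp add: sq)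
    finally have "integrable ?N (\<lambda>t. (cmod (g t))\<^sup>2) \<longleftrightarrow> integrable M (\<lambda>t. (cmod (?r g t))\<^sup>2)" .
    then show ?thesis by (simp add: L2_functions_def)
  qed
  have meas: "g \<in> borel_measurable borel" if "g \<in> L2_functions ?N" for g :: "real \<Rightarrow> complex"
    using L2_functions_measurable[OF that] by simp
  have r: "?r g \<in> L2_functions M" if "g \<in> L2_functions ?N" for g
    using r_iff[OF meas[OF that]] that by simp
  show ?thesis
  proof
    show "sets ?N = sets borel" by simp
    fix g h and c :: complex
    assume g: "g \<in> L2_functions ?N"
    show "W (?r (\<lambda>t. c * g t)) = c *\<^sub>C W (?r g)"
      using W_scale[OF r[OF g], of c] by (simp add: mult.left_commute)
    assume h: "h \<in> L2_functions ?N"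
    show "W (?r (\<lambda>t. g t + h t)) = W (?r g) + W (?r h)"
      using W_add[OF r[OF g] r[OF h]] by (simp add: distrib_left)
    note [measurable] = meas[OF g] meas[OF h]
    have "cinner (W (?r g)) (W (?r h)) = (LINT t|M. ?r g t * cnj (?r h t))"
      by (rule W_inner[OF r[OF g] r[OF h]])
    also have "\<dots> = (LINT t|M. b t *\<^sub>R (g (\<phi> t) * cnj (h (\<phi> t))))"
    proof (intro Bochner_Integration.integral_cong refl)
      fix t
      have "complex_of_real (sqrt (b t)) * complex_of_real (sqrt (b t)) = complex_of_real (b t)"
        using b_pos[of t] by (simp flip: of_real_mult)
      then show "?r g t * cnj (?r h t) = b t *\<^sub>R (g (\<phi> t) * cnj (h (\<phi> t)))"
        by (simp add: scaleR_conv_of_real mult_ac)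
    qed
    also have "\<dots> = (LINT t|density M (\<lambda>t. ennreal (b t)). g (\<phi> t) * cnj (h (\<phi> t)))"
      by (intro integral_density[symmetric]) (auto intro: less_imp_le b_pos)
    also have "\<dots> = (LINT t|?N. g t * cnj (h t))"
      by (intro integral_distr[symmetric]) auto
    finally show "cinner (W (?r g)) (W (?r h)) = (LINT t|?N. g t * cnj (h t))" .
  next
    have "x \<in> (\<lambda>g. W (?r g)) ` L2_functions ?N" for x
    proof -
      obtain u where u: "u \<in> L2_functions M" "x = W u" by (rule W_cases)
      note [measurable] = L2_borel[OF u(1)]
      \<comment> \<open>The preimage of u divides by sqrt b and undoes \<phi>; its values off the
        range of \<phi> do not matter.\<close>
      define g where "g y = u (\<psi> y) / complex_of_real (sqrt (b (\<psi> y)))" for y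
      have "?r g = u" using less_imp_neq[OF b_pos] by (auto simp: g_def \<psi> fun_eq_iff)
      moreover have "g \<in> borel_measurable borel" unfolding g_def by measurable
      ultimately have "g \<in> L2_functions ?N" "x = W (?r g)" using r_iff[of g] u by simp_all
      then show ?thesis by (intro image_eqI)
    qed
    then show "(\<lambda>g. W (?r g)) ` L2_functions ?N = UNIV" by blast
  qed
qed

end

locale L2_line = L2_unitary lborel W for W :: "(real \<Rightarrow> complex) \<Rightarrow> 'a::complex_hilbert"
begin

definition wtrans :: "(real \<Rightarrow> complex) \<Rightarrow> real \<Rightarrow> 'a \<Rightarrow> 'a" where
  "wtrans \<omega> s x = W (\<lambda>t. \<omega> t * rep x (s + t))"

lemma AE_shift: "AE t in lborel. P t \<Longrightarrow> AE t in lborel. P (s + t)" for s :: real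
proof -
  assume "AE t in lborel. P t"
  then have "AE t in distr lborel borel ((+) s). P t" unfolding lborel_distr_plus .
  then show ?thesis by (rule AE_distrD[rotated]) simp
qed

lemma L2_shift: "g \<in> L2_functions lborel \<Longrightarrow> (\<lambda>t. g (s + t)) \<in> L2_functions lborel"
proof -
  assume g: "g \<in> L2_functions lborel"
  note [measurable] = L2_borel[OF g]
  have "integrable (distr lborel borel ((+) s)) (\<lambda>t. (cmod (g t))\<^sup>2)"
    using g by (simp add: lborel_distr_plus L2_functions_def)
  then have "integrable lborel (\<lambda>t. (cmod (g (s + t)))\<^sup>2)"
    by (subst (asm) integrable_distr_eq) auto
  then show ?thesis by (simp add: L2_functions_def)
qed

lemma integral_shift:
  fixes g :: "real \<Rightarrow> complex"
  assumes [measurable]: "g \<in> borel_measurable borel"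
  shows "(LINT t|lborel. g (s + t)) = (LINT t|lborel. g t)"
proof -
  have "(LINT t|lborel. g t) = (LINT t|distr lborel borel ((+) s). g t)" by (simp add: lborel_distr_plus)
  also have "\<dots> = (LINT t|lborel. g (s + t))" by (rule integral_distr) auto
  finally show ?thesis by simp
qed

lemma ess_bounded_shift:
  assumes "ess_bounded \<omega> B"
  shows "ess_bounded (\<lambda>t. \<omega> (s + t)) B"
proof -
  have [measurable]: "\<omega> \<in> borel_measurable borel" using assms by (simp add: ess_bounded_def)
  have "AE t in lborel. cmod (\<omega> (s + t)) \<le> B" using assms by (intro AE_shift) (simp add: ess_bounded_def)
  then show ?thesis using assms by (auto simp: ess_bounded_def)
qed

lemma L2_wtrans: "ess_bounded \<omega> B \<Longrightarrow> g \<in> L2_functions lborel \<Longrightarrow>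
    (\<lambda>t. \<omega> t * g (s + t)) \<in> L2_functions lborel"
  by (rule L2_mult[OF _ L2_shift])

lemma wtrans_W:
  assumes \<omega>: "ess_bounded \<omega> B" and g: "g \<in> L2_functions lborel"
  shows "wtrans \<omega> s (W g) = W (\<lambda>t. \<omega> t * g (s + t))"
  unfolding wtrans_def W_eq_iff[OF L2_wtrans[OF \<omega> rep(1)] L2_wtrans[OF \<omega> g]]
  using AE_shift[OF rep_W[OF g], of s] by eventually_elim simp

lemma wtrans_0: "wtrans \<omega> 0 = mult_op \<omega>"
  by (simp add: wtrans_def mult_op_def fun_eq_iff)

lemma wtrans_bounded:
  assumes \<omega>: "ess_bounded \<omega> B"
  shows "wtrans \<omega> s \<in> bounded_operators"
proof (rule bounded_operatorsI)
  fix x y and c :: complex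
  obtain g where g: "g \<in> L2_functions lborel" "x = W g" by (rule W_cases)
  obtain h where h: "h \<in> L2_functions lborel" "y = W h" by (rule W_cases)
  note Lg = L2_wtrans[OF \<omega> g(1), of s] and Lh = L2_wtrans[OF \<omega> h(1), of s]
  show "wtrans \<omega> s (x + y) = wtrans \<omega> s x + wtrans \<omega> s y"
    unfolding g(2) h(2) W_add[OF g(1) h(1), symmetric] wtrans_W[OF \<omega> L2_functions_add[OF g(1) h(1)]]
      wtrans_W[OF \<omega> g(1)] wtrans_W[OF \<omega> h(1)] W_add[OF Lg Lh, symmetric] by (simp add: distrib_left)
  show "wtrans \<omega> s (c *\<^sub>C x) = c *\<^sub>C wtrans \<omega> s x"
    unfolding g(2) W_scale[OF g(1), symmetric] wtrans_W[OF \<omega> L2_functions_scale[OF g(1)]]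
      wtrans_W[OF \<omega> g(1)] W_scale[OF Lg, symmetric] by (simp add: mult.left_commute)
  \<comment> \<open>Translation is isometric, so only the weight contributes to the operator
    bound.\<close>
  have "norm (W (\<lambda>t. g (s + t))) = norm (W g)"
  proof -
    have "(norm (W (\<lambda>t. g (s + t))))\<^sup>2 = (norm (W g))\<^sup>2"
    proof -
      have [measurable]: "g \<in> borel_measurable borel" by (rule L2_borel[OF g(1)])
      have "complex_of_real ((norm (W (\<lambda>t. g (s + t))))\<^sup>2) = complex_of_real ((norm (W g))\<^sup>2)"
        unfolding cinner_norm[symmetric] W_inner[OF L2_shift[OF g(1)] L2_shift[OF g(1)]] W_inner[OF g(1) g(1)]
        by (rule integral_shift[of "\<lambda>t. g t * cnj (g t)"]) measurable
      then show ?thesis by (simp only: of_real_eq_iff)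
    qed
    then show ?thesis by simp
  qed
  then show "norm (wtrans \<omega> s x) \<le> B * norm x"
    using mult_op_norm[OF \<omega>, of "W (\<lambda>t. g (s + t))"]
    by (simp add: g(2) wtrans_W[OF \<omega> g(1)] mult_op_W[OF \<omega> L2_shift[OF g(1)]])
qed

lemma wtrans_wtrans:
  assumes \<omega>: "ess_bounded \<omega> B" and \<omega>': "ess_bounded \<omega>' C"
  shows "wtrans \<omega> s \<circ> wtrans \<omega>' s' = wtrans (\<lambda>t. \<omega> t * \<omega>' (s + t)) (s + s')"
proof (rule operator_eqI)
  fix g assume g: "g \<in> L2_functions lborel"
  show "(wtrans \<omega> s \<circ> wtrans \<omega>' s') (W g) = wtrans (\<lambda>t. \<omega> t * \<omega>' (s + t)) (s + s') (W g)"
    unfolding o_def wtrans_W[OF \<omega>' g] wtrans_W[OF \<omega> L2_wtrans[OF \<omega>' g]]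
      wtrans_W[OF ess_bounded_mult[OF \<omega> ess_bounded_shift[OF \<omega>']] g]
    by (simp add: mult.assoc add_ac)
qed

text \<open>Substituting t - s for t in the inner product moves weight and translation to the other
  factor.\<close>

lemma adjoint_wtrans:
  assumes \<omega>: "ess_bounded \<omega> B"
  shows "adjoint_operator (wtrans \<omega> s) = wtrans (\<lambda>t. cnj (\<omega> (- s + t))) (- s)"
proof (rule adjoint_operator_eqI)
  fix x y
  obtain g where g: "g \<in> L2_functions lborel" "x = W g" by (rule W_cases)
  obtain h where h: "h \<in> L2_functions lborel" "y = W h" by (rule W_cases)
  note \<omega>' = ess_bounded_cnj[OF ess_bounded_shift[OF \<omega>, of "- s"]]
  have [measurable]: "\<omega> \<in> borel_measurable borel" using \<omega> by (simp add: ess_bounded_def)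
  note [measurable] = L2_borel[OF g(1)] L2_borel[OF h(1)]
  have "(LINT t|lborel. (\<omega> (- s + (s + t)) * g (s + t)) * cnj (h (- s + (s + t))))
      = (LINT t|lborel. (\<omega> (- s + t) * g t) * cnj (h (- s + t)))"
    by (rule integral_shift[of "\<lambda>t. (\<omega> (- s + t) * g t) * cnj (h (- s + t))"]) measurable
  then show "cinner (wtrans \<omega> s x) y = cinner x (wtrans (\<lambda>t. cnj (\<omega> (- s + t))) (- s) y)"
    unfolding g(2) h(2) wtrans_W[OF \<omega> g(1)] wtrans_W[OF \<omega>' h(1)]
      W_inner[OF L2_wtrans[OF \<omega> g(1)] h(1)] W_inner[OF g(1) L2_wtrans[OF \<omega>' h(1)]]
    by (simp add: mult_ac)
qed

section \<open>Powers, absolute values and spectral models of the weighted translations\<close>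

definition weight :: "(nat \<Rightarrow> real) \<Rightarrow> nat \<Rightarrow> real \<Rightarrow> complex" where
  "weight d n t = complex_of_real (exp (arctan_sum d n t))"

lemma weight_ess_bounded: "ess_bounded (weight d n) (exp (real n * (pi / 2)))"
  unfolding ess_bounded_def weight_def
proof (intro conjI AE_I2)
  show "cmod (complex_of_real (exp (arctan_sum d n t))) \<le> exp (real n * (pi / 2))" for t
    using abs_arctan_sum_le[of d n t] by (simp add: abs_le_iff)
qed auto

definition T :: "real \<Rightarrow> 'a \<Rightarrow> 'a" where
  "T \<tau> = wtrans (\<lambda>t. complex_of_real (exp (arctan t))) \<tau>"

lemma arctan_weight: "(\<lambda>t. complex_of_real (exp (arctan t))) = weight (\<lambda>_. 0) 1"
  by (simp add: weight_def arctan_sum_def fun_eq_iff)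

lemma T_power: "T \<tau> ^^ n = wtrans (weight (\<lambda>k. real k * \<tau>) n) (real n * \<tau>)"
proof (induction n)
  case 0
  show ?case by (auto simp: wtrans_0 weight_def arctan_sum_def mult_op_const)
next
  case (Suc n)
  have "T \<tau> ^^ Suc n = wtrans (weight (\<lambda>_. 0) 1) \<tau> \<circ> wtrans (weight (\<lambda>k. real k * \<tau>) n) (real n * \<tau>)"
    unfolding funpow.simps Suc by (simp only: T_def arctan_weight)
  also have "\<dots> = wtrans (\<lambda>t. weight (\<lambda>_. 0) 1 t * weight (\<lambda>k. real k * \<tau>) n (\<tau> + t)) (\<tau> + real n * \<tau>)"
    by (rule wtrans_wtrans[OF weight_ess_bounded weight_ess_bounded])
  also have "(\<lambda>t. weight (\<lambda>_. 0) 1 t * weight (\<lambda>k. real k * \<tau>) n (\<tau> + t)) = weight (\<lambda>k. real k * \<tau>) (Suc n)"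
  proof
    fix t
    \<comment> \<open>The first summand is split off, not the last: the outermost factor contributes
      the unshifted arctangent, and the weight of the remaining power is evaluated at \<tau> +
      t.\<close>
    have "arctan_sum (\<lambda>k. real k * \<tau>) (Suc n) t = arctan t + arctan_sum (\<lambda>k. real k * \<tau>) n (\<tau> + t)"
      unfolding arctan_sum_def sum.lessThan_Suc_shift by (simp add: algebra_simps)
    then show "weight (\<lambda>_. 0) 1 t * weight (\<lambda>k. real k * \<tau>) n (\<tau> + t) = weight (\<lambda>k. real k * \<tau>) (Suc n) t"
      by (simp add: weight_def exp_add) (simp add: arctan_sum_def)
  qed
  also have "\<tau> + real n * \<tau> = real (Suc n) * \<tau>" by (simp add: algebra_simps)
  finally show ?case .
qed

lemma weight_cnj: "cnj (weight d n t) = weight d n t"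
  by (simp add: weight_def)

text \<open>The adjoint carries the weight moved back by n \<tau>. In its product with the power the
  translations cancel, and the square of the moved weight remains.\<close>

lemma abs_T_power:
  "abs_operator (T \<tau> ^^ n) = mult_op (weight (\<lambda>k. real k * \<tau> - real n * \<tau>) n)"
proof -
  let ?d = "\<lambda>k. real k * \<tau>" and ?e = "\<lambda>k. real k * \<tau> - real n * \<tau>"
  have shift: "weight ?d n (- (real n * \<tau>) + t) = weight ?e n t" for t
    by (simp add: weight_def arctan_sum_def algebra_simps)
  note w = weight_ess_bounded[of ?d n] and w' = weight_ess_bounded[of ?e n]
  have "adjoint_operator (T \<tau> ^^ n) = wtrans (weight ?e n) (- (real n * \<tau>))"
    unfolding T_power adjoint_wtrans[OF w] weight_cnj shift ..
  then have "adjoint_operator (T \<tau> ^^ n) \<circ> (T \<tau> ^^ n)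
      = wtrans (weight ?e n) (- (real n * \<tau>)) \<circ> wtrans (weight ?d n) (real n * \<tau>)"
    by (simp only: T_power)
  also have "\<dots> = mult_op (\<lambda>t. weight ?e n t * weight ?e n t)"
    unfolding wtrans_wtrans[OF w' w] by (simp only: shift wtrans_0 add.left_inverse)
  finally have "adjoint_operator (T \<tau> ^^ n) \<circ> (T \<tau> ^^ n)
      = mult_op (\<lambda>t. complex_of_real ((exp (arctan_sum ?e n t))\<^sup>2))"
    by (simp add: weight_def power2_eq_square)
  then have "abs_operator (T \<tau> ^^ n) = mult_op (\<lambda>t. complex_of_real (exp (arctan_sum ?e n t)))"
  proof (rule abs_operator_eqI[rotated -1])
    show "ess_bounded (\<lambda>t. complex_of_real (exp (arctan_sum ?e n t))) (exp (real n * (pi / 2)))"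
      using w' by (simp add: weight_def[abs_def])
    \<comment> \<open>This positive lower bound is what the uniqueness of the square root
      requires.\<close>
    show "AE t in lborel. exp (- (real n * (pi / 2))) \<le> exp (arctan_sum ?e n t)"
    proof (intro AE_I2)
      show "exp (- (real n * (pi / 2))) \<le> exp (arctan_sum ?e n t)" for t
        using abs_arctan_sum_le[of ?e n t] unfolding exp_le_cancel_iff by linarith
    qed
  qed simp
  then show ?thesis by (simp add: weight_def[abs_def])
qed

text \<open>The unitary that turns the absolute value of the n-th power into multiplication by the
  independent variable, for the shifts found in \<open>abs_T_power\<close>.\<close>

definition model :: "(nat \<Rightarrow> real) \<Rightarrow> nat \<Rightarrow> (real \<Rightarrow> complex) \<Rightarrow> 'a" where
  "model d n g = W (\<lambda>t. complex_of_real (sqrt (arctan_sum_deriv d n t)) * g (exp (arctan_sum d n t)))"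

lemma spectral_model:
  assumes n: "0 < n"
  shows "spectral_model (log_uniform (real n * (pi / 2))) (model d n)
    {exp (- (real n * (pi / 2)))..exp (real n * (pi / 2))}"
proof -
  let ?a = "arctan_sum d n" and ?b = "arctan_sum_deriv d n" and ?c = "real n * (pi / 2)"
  have c: "0 < ?c" using n by simp
  define I where "I = {exp (- ?c)<..<exp ?c}"
  \<comment> \<open>\<psi> inverts the exponential of the arctangent sum; off its range I it takes
    the default value 0.\<close>
  define \<psi> where "\<psi> y = (if y \<in> I then THE t. exp (?a t) = y else 0)" for y
  have inj: "?a s = ?a t \<longleftrightarrow> s = t" for s t
    using arctan_sum_less_iff[OF n, of d s t] arctan_sum_less_iff[OF n, of d t s] by force
  have bound: "- ?c < ?a t" "?a t < ?c" for t
    using range_arctan_sum[OF n, of d] by auto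
  have \<psi>: "\<psi> (exp (?a t)) = t" for t
  proof -
    have "exp (?a t) \<in> I" using bound[of t] by (simp add: I_def)
    then show ?thesis unfolding \<psi>_def by (simp add: inj)
  qed
  have surj: "\<exists>t. y = exp (?a t)" if "y \<in> I" for y
  proof -
    have y: "0 < y" using that unfolding I_def using less_trans[OF exp_gt_zero] by auto
    then have "ln y \<in> {- ?c<..<?c}"
      using that y unfolding I_def using ln_less_cancel_iff[of "exp (- ?c)" y] ln_less_cancel_iff[of y "exp ?c"] by simp
    then have "ln y \<in> range ?a" by (simp only: range_arctan_sum[OF n])
    then obtain t where "ln y = ?a t" by auto
    then have "y = exp (?a t)" using y by (metis exp_ln)
    then show ?thesis ..
  qed
  have [measurable]: "\<psi> \<in> borel_measurable borel"
    unfolding borel_measurable_iff_greater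
  proof
    fix x
    \<comment> \<open>On I the function \<psi> is increasing, so its superlevel set is a half-line
      cut with I; off I only the sign of x matters.\<close>
    have "{y \<in> space borel. x < \<psi> y} = {y. y \<in> I \<and> exp (?a x) < y}
        \<union> {y. y \<notin> I \<and> x < 0}"
    proof (intro set_eqI)
      fix y
      show "y \<in> {y \<in> space borel. x < \<psi> y} \<longleftrightarrow> y \<in> {y. y \<in> I \<and> exp (?a x) < y}
        \<union> {y. y \<notin> I \<and> x < 0}"
      proof (cases "y \<in> I")
        case True
        then obtain t where t: "y = exp (?a t)" using surj by blast
        have "x < \<psi> y \<longleftrightarrow> exp (?a x) < y"
          by (simp add: t \<psi> arctan_sum_less_iff[OF n])
        then show ?thesis using True by simp
      qed (simp add: \<psi>_def)
    qed
    moreover have "I \<in> sets borel" by (simp add: I_def)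
    ultimately show "{y \<in> space borel. x < \<psi> y} \<in> sets borel" by simp
  qed
  have "L2_unitary (distr (density lborel (\<lambda>t. ennreal (?b t))) borel (\<lambda>t. exp (?a t))) (model d n)"
    unfolding model_def[abs_def]
    by (rule L2_unitary_pushforward[where \<psi> = \<psi>]) (simp_all add: arctan_sum_deriv_pos[OF n] \<psi>)
  then interpret N: L2_unitary "log_uniform ?c" "model d n"
    by (simp only: distr_arctan_sum[OF n])
  show ?thesis
    by (intro spectral_model.intro N.L2_unitary_axioms spectral_model_axioms.intro
        finite_measure_log_uniform[OF c] log_uniform_null log_uniform_support[OF c] compact_Icc)
qed

text \<open>The conditions are met from n = 1 on. For n = 0 the power is the identity, which has no
  cyclic vector in this infinite-dimensional space.\<close>

lemma lebesgue_operator_T: "T \<tau> \<in> lebesgue_operators"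
proof -
  let ?e = "\<lambda>n k. real k * \<tau> - real n * \<tau>"
  define \<xi> where "\<xi> n = model (?e n) n (\<lambda>t. 1)" for n
  have main: "cyclic_vector (abs_operator (T \<tau> ^^ n)) (\<xi> n) \<and>
      lebesgue_density_condition (abs_operator (T \<tau> ^^ n)) (\<xi> n) \<and>
      lebesgue_inversion_condition (abs_operator (T \<tau> ^^ n)) (\<xi> n)" if n: "n \<ge> 1" for n
  proof -
    let ?c = "real n * (pi / 2)"
    have n0: "0 < n" and c: "0 < ?c" using n by simp_all
    interpret S: spectral_model "log_uniform ?c" "model (?e n) n" "{exp (- ?c)..exp ?c}"
      by (rule spectral_model[OF n0])
    obtain R where R: "S.ess_bounded complex_of_real R" by (rule S.ess_bounded_id)
    have "abs_operator (T \<tau> ^^ n) = S.A"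
      unfolding abs_T_power
    proof (rule S.operator_eqI)
      fix g assume g: "g \<in> L2_functions (log_uniform ?c)"
      let ?h = "\<lambda>t. complex_of_real (sqrt (arctan_sum_deriv (?e n) n t)) * g (exp (arctan_sum (?e n) n t))"
      have [measurable]: "g \<in> borel_measurable borel" by (rule S.L2_borel[OF g])
      \<comment> \<open>Square integrability of g for the image measure is unwound, through
        substitution and density, to that of ?h on the line.\<close>
      have h: "?h \<in> L2_functions lborel"
      proof -
        have "integrable (distr (density lborel (\<lambda>t. ennreal (arctan_sum_deriv (?e n) n t))) borel
            (\<lambda>t. exp (arctan_sum (?e n) n t))) (\<lambda>t. (cmod (g t))\<^sup>2)"
          unfolding distr_arctan_sum[OF n0] by (rule L2_functions_integrable_sq[OF g])
        then have "integrable (density lborel (\<lambda>t. ennreal (arctan_sum_deriv (?e n) n t)))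
            (\<lambda>t. (cmod (g (exp (arctan_sum (?e n) n t))))\<^sup>2)"
          by (subst (asm) integrable_distr_eq) auto
        then have "integrable lborel (\<lambda>t. arctan_sum_deriv (?e n) n t *\<^sub>R (cmod (g (exp (arctan_sum (?e n) n t))))\<^sup>2)"
          by (subst (asm) integrable_density) (auto intro: less_imp_le arctan_sum_deriv_pos[OF n0])
        then show ?thesis
          by (simp add: L2_functions_def norm_mult power_mult_distrib
              less_imp_le[OF arctan_sum_deriv_pos[OF n0]])
      qed
      \<comment> \<open>The substitution turns the independent variable into the weight, so both
        sides are the image of the weight times ?h.\<close>
      show "mult_op (weight (?e n) n) (model (?e n) n g) = S.A (model (?e n) n g)"
        unfolding S.A_def S.mult_op_W[OF R g]
        unfolding model_def mult_op_W[OF weight_ess_bounded h]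
        by (simp add: weight_def mult.left_commute)
    qed
    moreover have "\<xi> n = S.\<xi>" by (simp add: \<xi>_def S.\<xi>_def)
    moreover have "lebesgue_density_condition S.A S.\<xi>"
      unfolding lebesgue_density_condition_def S.spectral_measure_A
    proof (intro exI[of _ "log_density ?c"] conjI allI impI)
      \<comment> \<open>Integrability of 1/x on the interval is read off from the finite mass of the
        measure.\<close>
      have fin: "(\<integral>\<^sup>+x. ennreal (indicator {0..} x * log_density ?c x) \<partial>lborel) < \<infinity>"
        using S.emeasure_finite[of UNIV] unfolding log_uniform_density[OF c]
        by (subst (asm) emeasure_density) (auto simp: log_density_def less_top)
      show nonneg: "0 \<le> log_density ?c x" if "0 \<le> x" for x
        using that by (simp add: log_density_def)
      have "integrable lborel (\<lambda>x. indicator {0..} x * log_density ?c x)"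
      proof (rule integrableI_nonneg[OF _ _ fin])
        show "AE x in lborel. 0 \<le> indicator {0..} x * log_density ?c x"
          using nonneg by (intro AE_I2) (auto simp: indicator_def)
      qed (auto simp: log_density_def)
      then show "set_integrable lborel {0..} (log_density ?c)" by (simp add: set_integrable_def)
      show "completion (log_uniform ?c)
          = completion (density lborel (\<lambda>x. ennreal (indicator {0..} x * log_density ?c x)))"
        by (simp only: log_uniform_density[OF c])
    qed (use log_density_inverse in auto)
    ultimately show ?thesis
      using S.cyclic_vector_A S.lebesgue_inversion_condition_A[OF distr_log_uniform_inverse] by simp
  qed
  have "invertible_operator (T \<tau>)"
  proof -
    \<comment> \<open>The inverse divides by the weight first and translates back afterwards, so the
      reciprocal weight is evaluated at t - \<tau>.\<close>
    let ?w = "\<lambda>t. complex_of_real (exp (arctan t))" and ?v = "\<lambda>t. complex_of_real (exp (- arctan (- \<tau> + t)))"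
    have w: "ess_bounded ?w (exp (1 * (pi / 2)))"
      unfolding arctan_weight using weight_ess_bounded[of "\<lambda>_. 0" 1] by simp
    have "ess_bounded (\<lambda>t. complex_of_real (exp (- arctan t))) (exp (pi / 2))"
      unfolding ess_bounded_def
    proof (intro conjI AE_I2)
      show "cmod (complex_of_real (exp (- arctan t))) \<le> exp (pi / 2)" for t
        using arctan_bounded[of t] by simp
    qed auto
    from ess_bounded_shift[OF this] have v: "ess_bounded ?v (exp (pi / 2))" .
    have "T \<tau> \<circ> wtrans ?v (- \<tau>) = id" "wtrans ?v (- \<tau>) \<circ> T \<tau> = id"
      unfolding T_def wtrans_wtrans[OF w v] wtrans_wtrans[OF v w]
      by (simp_all add: wtrans_0 fun_eq_iff mult_op_const flip: of_real_mult exp_add)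
    then show ?thesis
      unfolding invertible_operator_def using wtrans_bounded[OF w] wtrans_bounded[OF v]
      by (auto simp: T_def)
  qed
  then show ?thesis
    unfolding lebesgue_operators_def using main by (auto intro!: exI[of _ \<xi>] exI[of _ "1::nat"])
qed

section \<open>Normality without translation and its failure for translation by 1\<close>

lemma T_bounded: "T \<tau> \<in> bounded_operators"
  unfolding T_def arctan_weight by (rule wtrans_bounded[OF weight_ess_bounded])

text \<open>Both products are multiplication operators, but only the second multiplier depends on
  \<tau>; comparing the two decides normality.\<close>

lemma T_commutators:
  "T \<tau> \<circ> adjoint_operator (T \<tau>) = mult_op (\<lambda>t. complex_of_real ((exp (arctan t))\<^sup>2))"
  "adjoint_operator (T \<tau>) \<circ> T \<tau> = mult_op (\<lambda>t. complex_of_real ((exp (arctan (- \<tau> + t)))\<^sup>2))"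
proof -
  let ?w = "\<lambda>t. complex_of_real (exp (arctan t))"
  have w: "ess_bounded ?w (exp (real 1 * (pi / 2)))"
    unfolding arctan_weight by (rule weight_ess_bounded)
  note w' = ess_bounded_cnj[OF ess_bounded_shift[OF w, of "- \<tau>"]]
  show "T \<tau> \<circ> adjoint_operator (T \<tau>) = mult_op (\<lambda>t. complex_of_real ((exp (arctan t))\<^sup>2))"
    "adjoint_operator (T \<tau>) \<circ> T \<tau> = mult_op (\<lambda>t. complex_of_real ((exp (arctan (- \<tau> + t)))\<^sup>2))"
    unfolding T_def adjoint_wtrans[OF w] wtrans_wtrans[OF w w'] wtrans_wtrans[OF w' w]
    by (simp_all add: wtrans_0 power2_eq_square)
qed

lemma T_0_normal: "T 0 \<in> normal_operators"
  unfolding normal_operators_def T_commutators using T_bounded[of 0] T_commutators[of 0] by simp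

lemma T_1_not_normal: "T 1 \<notin> normal_operators"
proof
  assume "T 1 \<in> normal_operators"
  then have eq: "mult_op (\<lambda>t. complex_of_real ((exp (arctan t))\<^sup>2))
      = mult_op (\<lambda>t. complex_of_real ((exp (arctan (- 1 + t)))\<^sup>2))" (is "mult_op ?u = mult_op ?v")
    by (simp add: normal_operators_def T_commutators)
  have u: "ess_bounded ?u ((exp (real 1 * (pi / 2)))\<^sup>2)"
    using ess_bounded_power[OF weight_ess_bounded[of "\<lambda>_. 0" 1], of 2]
    unfolding arctan_weight[symmetric] by simp
  have v: "ess_bounded ?v ((exp (real 1 * (pi / 2)))\<^sup>2)"
    using ess_bounded_shift[OF u, of "- 1"] .
  \<comment> \<open>One test vector suffices, as long as it is nonzero on a set of positive measure:
    the two weights must agree almost everywhere on that set.\<close>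
  let ?g = "indicator {0<..1} :: real \<Rightarrow> complex"
  note g = indicator_L2_functions[of 0 1]
  have "AE t in lborel. ?u t * ?g t = ?v t * ?g t"
    using fun_cong[OF eq, of "W ?g"]
    unfolding mult_op_W[OF u g] mult_op_W[OF v g] W_eq_iff[OF L2_mult[OF u g] L2_mult[OF v g]] .
  \<comment> \<open>The arctangent is strictly increasing, so the weights differ at every point;
    agreement on (0, 1] would make this interval null.\<close>
  then have "AE t in lborel. t \<notin> {0<..1::real}"
  proof eventually_elim
    case (elim t)
    have "exp (arctan (- 1 + t)) < exp (arctan t)" by (simp add: arctan_less_iff)
    then have "(exp (arctan (- 1 + t)))\<^sup>2 < (exp (arctan t))\<^sup>2"
      by (intro power_strict_mono) auto
    then show ?case
      using elim by (auto simp: indicator_def simp flip: of_real_power split: if_splits)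
  qed
  then have "{0<..1::real} \<in> null_sets lborel" by (subst AE_iff_null_sets) auto
  then show False by (simp add: null_sets_def)
qed

end

theorem corollary5p7:
  assumes separable: "\<exists>D::'a::complex_hilbert set. countable D \<and> closure D = UNIV"
    and infinite_dimensional: "\<not> (\<exists>B::'a set. finite B \<and> module.span scaleC B = UNIV)"
  shows "(lebesgue_operators :: ('a \<Rightarrow> 'a) set) \<inter> normal_operators \<noteq> {} \<and>
         (lebesgue_operators :: ('a \<Rightarrow> 'a) set) \<inter> (bounded_operators - normal_operators) \<noteq> {}"
proof -
  obtain V :: "l2 \<Rightarrow> 'a" where V: "\<And>x y. V (x + y) = V x + V y" "\<And>c x. V (c *\<^sub>C x) = c *\<^sub>C V x"
    "\<And>x y. cinner (V x) (V y) = cinner x y" "surj V"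
    using exists_l2_unitary[OF separable infinite_dimensional] by blast
  \<comment> \<open>The operators are built from functions on the line, so the quotient map followed
    by V supplies the model of the given space.\<close>
  interpret L2_line "\<lambda>g. V (abs_l2 g)"
  proof
    have "y \<in> (\<lambda>g. V (abs_l2 g)) ` L2_functions lborel" for y
    proof -
      obtain x where "y = V x" using V(4) by (rule surjE)
      moreover obtain f where "f \<in> L2_functions lborel" "abs_l2 f = x" by (rule abs_l2_surj)
      ultimately show ?thesis by blast
    qed
    then show "(\<lambda>g. V (abs_l2 g)) ` L2_functions lborel = UNIV" by blast
  qed (simp_all add: V abs_l2_add[symmetric] scaleC_abs_l2[symmetric] cinner_abs_l2)
  show ?thesis
    using lebesgue_operator_T T_0_normal T_1_not_normal T_bounded by blast
qed

end
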